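(* For every uncountable regular cardinal $\lambda$ the following categories are dually equivalent: (1) the category of $\lambda$-basic varieties of quantitative algebras (for arbitrary $\lambda$-ary signatures) and concrete functors over $\mathsf{Met}$; (2) the category of $\lambda$-basic monads on $\mathsf{Met}$ and monad morphisms.
   Context: $\mathsf{Met}$ is the category of extended metric spaces (distance $\infty$ allowed) and nonexpanding maps, enriched over itself: $[A,B]$ is the set of nonexpanding maps with the supremum metric. All categories, functors and monads are enriched over $\mathsf{Met}$ (functors are nonexpanding on hom-spaces; a monad is enriched iff its underlying endofunctor is). A monad on $\mathsf{Met}$ is $\lambda$-basic if it is enriched, its endofunctor is $\lambda$-accessible (preserves $\lambda$-directed colimits), and its endofunctor preserves surjective morphisms. A $\lambda$-ary signature $\Sigma$ is a set of operation symbols whose arities are cardinals $n<\lambda$. A quantitative $\Sigma$-algebra is a metric space $A$ with a nonexpanding operation $\sigma_A:A^n\to A$ ($A^n$ with the supremum metric) for each $n$-ary $\sigma\in\Sigma$; homomorphisms are nonexpanding maps preserving the operations; they form $\Sigma\text{-}\mathsf{Met}$ (hom-sets with the supremum metric). For a metric space $M$, $T_\Sigma M$ denotes the free quantitative $\Sigma$-algebra on $M$: its elements are the $\Sigma$-terms over variables from $M$; terms that do not have the same structure up to names of variables have distance $\infty$, variables have their distance in $M$, and structurally similar terms $\sigma(t_i)_{i<n}$, $\sigma(t'_i)_{i<n}$ have distance $\sup_{i<n} d(t_i,t_i')$. For a nonexpanding map $f:M\to A$ into an algebra, $f^\sharp:T_\Sigma M\to A$ is the unique homomorphism extending $f$.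 A $\lambda$-basic quantitative equation is an expression $M\vdash l=_\varepsilon r$ where $M$ is a metric space with $\mathrm{card}\,M<\lambda$, $l,r\in T_\Sigma M$ and $\varepsilon\ge0$ is rational. An algebra $A$ satisfies it if $d(f^\sharp(l),f^\sharp(r))\le\varepsilon$ for every nonexpanding $f:M\to A$. A $\lambda$-basic variety is a full subcategory of some $\Sigma\text{-}\mathsf{Met}$ ($\Sigma$ $\lambda$-ary) presented by a set of $\lambda$-basic quantitative equations. Each variety $\mathcal V$ has its forgetful functor $U_{\mathcal V}:\mathcal V\to\mathsf{Met}$; a concrete functor $\mathcal V\to\mathcal W$ is an (enriched) functor $F$ with $U_{\mathcal W}\circ F=U_{\mathcal V}$. Two categories are dually equivalent if one is equivalent to the opposite of the other. *)

theory Defs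
  imports "HOL-Library.Extended_Nonnegative_Real" "HOL-Library.FuncSet"
begin

unbundle cardinal_syntax

text \<open>Size conventions.  HOL has no type of all sets, so the type \<open>'u\<close> plays the role of the universe:
  all spaces, algebras and operation symbols are made of elements of \<open>'u\<close>, and ``set'' (as opposed
  to ``class'') means fewer elements than \<open>'u\<close>.  If the cardinality of \<open>'u\<close> is strongly inaccessible,
  this is the usual reading with a Grothendieck universe.  The hypothesis \<open>universe_for\<close> only asks for the
  closure properties (regularity and closure under powers with exponent below \<open>lam\<close>) that let the
  free algebras exist; it covers all inaccessible cases (lemma \<open>inaccessible_universe_for\<close> below), but
  is also satisfied by types that can be constructed in HOL, e.g. by a type of the successor
  cardinality of the continuum for \<open>lam\<close> the first uncountable cardinal.

  A cardinal is a minimal well-order \<open>lam :: 'u rel\<close>, as in the BNF cardinal library.\<close>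

definition small :: "'u itself \<Rightarrow> 'x set \<Rightarrow> bool" where
  "small U X \<longleftrightarrow> |X| <o |UNIV :: 'u set|"

definition uncountable_regular_cardinal :: "'u rel \<Rightarrow> bool" where
  "uncountable_regular_cardinal lam \<longleftrightarrow> Card_order lam \<and> natLeq <o lam \<and> regularCard lam"

definition universe_for :: "'u rel \<Rightarrow> bool" where
  "universe_for lam \<longleftrightarrow>
     regularCard |UNIV :: 'u set| \<and> lam <o |UNIV :: 'u set| \<and>
     (\<forall>(X :: 'u set) (Y :: 'u set). small TYPE('u) X \<and> |Y| <o lam \<longrightarrow> small TYPE('u) (Y \<rightarrow>\<^sub>E X))"

lemma inaccessible_universe_for:
  fixes lam :: "'u rel"
  assumes "regularCard |UNIV :: 'u set|" and "Card_order lam" and "lam <o |UNIV :: 'u set|"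
    and "natLeq <o lam"
    and strong_limit: "\<And>X :: 'u set. small TYPE('u) X \<Longrightarrow> small TYPE('u) (Pow X)"
  shows "universe_for lam"
proof -
  have inf: "infinite (UNIV :: 'u set)"
    using assms(3,4) by (meson card_of_ordLeq_infinite infinite_iff_natLeq_ordLeq ordLess_imp_ordLeq ordLess_transitive)
  have "small TYPE('u) (Y \<rightarrow>\<^sub>E X)" if X: "small TYPE('u) X" and Y: "|Y| <o lam" for X Y :: "'u set"
  proof -
    have "|Y| <o |UNIV :: 'u set|" using Y assms(3) ordLess_transitive by blast
    moreover have X': "|X| <o |UNIV :: 'u set|" using X unfolding small_def .
    ultimately have "|Y \<times> X| <o |UNIV :: 'u set|"
    proof (cases "finite X \<and> finite Y")
      case True
      then have "|Y \<times> X| <o natLeq" by (simp flip: finite_iff_ordLess_natLeq)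
      then show ?thesis using inf infinite_iff_natLeq_ordLeq ordLess_ordLeq_trans by blast
    next
      case False
      then have inf': "infinite (X <+> Y)" by (simp add: finite_Plus_iff)
      have "|Y \<times> X| \<le>o |X <+> Y|"
        by (rule card_of_Times_ordLeq_infinite_Field)
          (simp_all only: Field_card_of inf' not_False_eq_True card_of_Plus1 card_of_Plus2 card_of_card_order_on)
      also have "|X <+> Y| <o |UNIV :: 'u set|"
        using card_of_Plus_ordLess_infinite[OF inf X' \<open>|Y| <o |UNIV :: 'u set|\<close>] .
      finally show ?thesis .
    qed
    then obtain Z :: "'u set" where Z: "|Y \<times> X| =o |Z|" "|Z| <o |UNIV :: 'u set|"
      unfolding internalize_card_of_ordLess[of "Y \<times> X"] by blast
    from Z(1) obtain h where h: "bij_betw h (Y \<times> X) Z"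
      unfolding card_of_ordIso[symmetric] by blast
    let ?g = "\<lambda>f. (\<lambda>y. h (y, f y)) ` Y"
    have "inj_on ?g (Y \<rightarrow>\<^sub>E X)"
    proof (rule inj_onI)
      fix f f' assume f: "f \<in> Y \<rightarrow>\<^sub>E X" and f': "f' \<in> Y \<rightarrow>\<^sub>E X" and e: "?g f = ?g f'"
      show "f = f'"
      proof (rule PiE_ext[OF f f'])
        fix y assume y: "y \<in> Y"
        then obtain y' where y': "y' \<in> Y" "h (y, f y) = h (y', f' y')" using e by blast
        have "(y, f y) \<in> Y \<times> X" "(y', f' y') \<in> Y \<times> X" using f f' y y' by auto
        then have "(y, f y) = (y', f' y')" using y'(2) h by (meson bij_betw_imp_inj_on inj_onD)
        then show "f y = f' y" by auto
      qed
    qed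
    moreover have "?g ` (Y \<rightarrow>\<^sub>E X) \<subseteq> Pow Z" using bij_betwE[OF h] by auto
    ultimately have "|Y \<rightarrow>\<^sub>E X| \<le>o |Pow Z|" unfolding card_of_ordLeq[symmetric] by blast
    also have "|Pow Z| <o |UNIV :: 'u set|" using strong_limit[of Z] Z(2) unfolding small_def .
    finally show ?thesis unfolding small_def .
  qed
  then show ?thesis using assms unfolding universe_for_def by blast
qed

subsection \<open>Met-enriched categories\<close>

text \<open>Hom-sets of different pairs of objects may overlap; therefore composition and the action of a
  functor on morphisms carry their objects as arguments: \<open>Comp C A B D g f\<close> is the
  composite of \<open>f : A \<rightarrow> B\<close> and \<open>g : B \<rightarrow> D\<close>.\<close>

record ('o, 'm) cat =
  Obj :: "'o set"
  Mor :: "'o \<Rightarrow> 'o \<Rightarrow> 'm set"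
  Ident :: "'o \<Rightarrow> 'm"
  Comp :: "'o \<Rightarrow> 'o \<Rightarrow> 'o \<Rightarrow> 'm \<Rightarrow> 'm \<Rightarrow> 'm"

record ('o, 'm) mcat = "('o, 'm) cat" +
  hdist :: "'o \<Rightarrow> 'o \<Rightarrow> 'm \<Rightarrow> 'm \<Rightarrow> ennreal"

definition is_category :: "('o, 'm, 'z) cat_scheme \<Rightarrow> bool" where
  "is_category C \<longleftrightarrow>
     (\<forall>A\<in>Obj C. Ident C A \<in> Mor C A A) \<and>
     (\<forall>A\<in>Obj C. \<forall>B\<in>Obj C. \<forall>D\<in>Obj C. \<forall>f\<in>Mor C A B. \<forall>g\<in>Mor C B D. Comp C A B D g f \<in> Mor C A D) \<and>
     (\<forall>A\<in>Obj C. \<forall>B\<in>Obj C. \<forall>f\<in>Mor C A B.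
        Comp C A A B f (Ident C A) = f \<and> Comp C A B B (Ident C B) f = f) \<and>
     (\<forall>A\<in>Obj C. \<forall>B\<in>Obj C. \<forall>D\<in>Obj C. \<forall>E\<in>Obj C. \<forall>f\<in>Mor C A B. \<forall>g\<in>Mor C B D. \<forall>h\<in>Mor C D E.
        Comp C A D E h (Comp C A B D g f) = Comp C A B E (Comp C B D E h g) f)"

definition op_cat :: "('o, 'm, 'z) cat_scheme \<Rightarrow> ('o, 'm) cat" where
  "op_cat C = \<lparr>Obj = Obj C, Mor = (\<lambda>A B. Mor C B A), Ident = Ident C,
               Comp = (\<lambda>A B D g f. Comp C D B A f g)\<rparr>"

record ('o, 'm, 'p, 'n) func =
  fo :: "'o \<Rightarrow> 'p"
  fm :: "'o \<Rightarrow> 'o \<Rightarrow> 'm \<Rightarrow> 'n"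

text \<open>Functors and natural transformations are required to be \<open>undefined\<close> outside their domain, so
  that equality in HOL is equality of functors and of natural transformations.\<close>

definition mk_func :: "('o, 'm, 'z) cat_scheme \<Rightarrow> ('o \<Rightarrow> 'p) \<Rightarrow> ('o \<Rightarrow> 'o \<Rightarrow> 'm \<Rightarrow> 'n) \<Rightarrow> ('o, 'm, 'p, 'n) func"
  where
  "mk_func C F1 F2 =
     \<lparr>fo = (\<lambda>A\<in>Obj C. F1 A),
      fm = (\<lambda>A B f. if A \<in> Obj C \<and> B \<in> Obj C \<and> f \<in> Mor C A B then F2 A B f else undefined)\<rparr>"

definition is_functor ::
  "('o, 'm, 'y) cat_scheme \<Rightarrow> ('p, 'n, 'z) cat_scheme \<Rightarrow> ('o, 'm, 'p, 'n) func \<Rightarrow> bool" where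
  "is_functor C D F \<longleftrightarrow>
     F = mk_func C (fo F) (fm F) \<and>
     (\<forall>A\<in>Obj C. fo F A \<in> Obj D) \<and>
     (\<forall>A\<in>Obj C. \<forall>B\<in>Obj C. \<forall>f\<in>Mor C A B. fm F A B f \<in> Mor D (fo F A) (fo F B)) \<and>
     (\<forall>A\<in>Obj C. fm F A A (Ident C A) = Ident D (fo F A)) \<and>
     (\<forall>A\<in>Obj C. \<forall>B\<in>Obj C. \<forall>E\<in>Obj C. \<forall>f\<in>Mor C A B. \<forall>g\<in>Mor C B E.
        fm F A E (Comp C A B E g f) = Comp D (fo F A) (fo F B) (fo F E) (fm F B E g) (fm F A B f))"

definition enriched_functor ::
  "('o, 'm, 'y) mcat_scheme \<Rightarrow> ('p, 'n, 'z) mcat_scheme \<Rightarrow> ('o, 'm, 'p, 'n) func \<Rightarrow> bool" where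
  "enriched_functor C D F \<longleftrightarrow>
     is_functor C D F \<and>
     (\<forall>A\<in>Obj C. \<forall>B\<in>Obj C. \<forall>f\<in>Mor C A B. \<forall>g\<in>Mor C A B.
        hdist D (fo F A) (fo F B) (fm F A B f) (fm F A B g) \<le> hdist C A B f g)"

definition id_func :: "('o, 'm, 'z) cat_scheme \<Rightarrow> ('o, 'm, 'o, 'm) func" where
  "id_func C = mk_func C (\<lambda>A. A) (\<lambda>A B f. f)"

definition comp_func ::
  "('o, 'm, 'z) cat_scheme \<Rightarrow> ('p, 'n, 'q, 'r) func \<Rightarrow> ('o, 'm, 'p, 'n) func \<Rightarrow> ('o, 'm, 'q, 'r) func" where
  "comp_func C G F = mk_func C (\<lambda>A. fo G (fo F A)) (\<lambda>A B f. fm G (fo F A) (fo F B) (fm F A B f))"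

definition nat_trans ::
  "('o, 'm, 'y) cat_scheme \<Rightarrow> ('p, 'n, 'z) cat_scheme \<Rightarrow> ('o, 'm, 'p, 'n) func \<Rightarrow> ('o, 'm, 'p, 'n) func \<Rightarrow>
   ('o \<Rightarrow> 'n) set" where
  "nat_trans C D F G = {\<alpha> \<in> extensional (Obj C).
     (\<forall>A\<in>Obj C. \<alpha> A \<in> Mor D (fo F A) (fo G A)) \<and>
     (\<forall>A\<in>Obj C. \<forall>B\<in>Obj C. \<forall>f\<in>Mor C A B.
        Comp D (fo F A) (fo F B) (fo G B) (\<alpha> B) (fm F A B f) =
        Comp D (fo F A) (fo G A) (fo G B) (fm G A B f) (\<alpha> A))}"

definition is_iso :: "('o, 'm, 'z) cat_scheme \<Rightarrow> 'o \<Rightarrow> 'o \<Rightarrow> 'm \<Rightarrow> bool" where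
  "is_iso C A B f \<longleftrightarrow> f \<in> Mor C A B \<and>
     (\<exists>g\<in>Mor C B A. Comp C A B A g f = Ident C A \<and> Comp C B A B f g = Ident C B)"

definition naturally_isomorphic ::
  "('o, 'm, 'y) cat_scheme \<Rightarrow> ('p, 'n, 'z) cat_scheme \<Rightarrow> ('o, 'm, 'p, 'n) func \<Rightarrow> ('o, 'm, 'p, 'n) func \<Rightarrow> bool"
  where
  "naturally_isomorphic C D F G \<longleftrightarrow>
     (\<exists>\<alpha>\<in>nat_trans C D F G. \<forall>A\<in>Obj C. is_iso D (fo F A) (fo G A) (\<alpha> A))"

definition equivalent_categories :: "('o, 'm, 'y) cat_scheme \<Rightarrow> ('p, 'n, 'z) cat_scheme \<Rightarrow> bool" where
  "equivalent_categories C D \<longleftrightarrow>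
     is_category C \<and> is_category D \<and>
     (\<exists>F G. is_functor C D F \<and> is_functor D C G \<and>
        naturally_isomorphic C C (comp_func C G F) (id_func C) \<and>
        naturally_isomorphic D D (comp_func D F G) (id_func D))"

definition dually_equivalent :: "('o, 'm, 'y) cat_scheme \<Rightarrow> ('p, 'n, 'z) cat_scheme \<Rightarrow> bool" where
  "dually_equivalent C D \<longleftrightarrow> equivalent_categories (op_cat C) D"

subsection \<open>Directed colimits\<close>

definition poset_cat :: "'i set \<Rightarrow> 'i rel \<Rightarrow> ('i, unit) cat" where
  "poset_cat I r = \<lparr>Obj = I, Mor = (\<lambda>i j. if (i, j) \<in> r then {()} else {}), Ident = (\<lambda>_. ()),
                    Comp = (\<lambda>_ _ _ _ _. ())\<rparr>"

definition directed_poset :: "'u rel \<Rightarrow> 'i set \<Rightarrow> 'i rel \<Rightarrow> bool" where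
  "directed_poset lam I r \<longleftrightarrow> partial_order_on I r \<and>
     (\<forall>J\<subseteq>I. |J| <o lam \<longrightarrow> (\<exists>i\<in>I. \<forall>j\<in>J. (j, i) \<in> r))"

definition is_cocone ::
  "('i, 'k, 'y) cat_scheme \<Rightarrow> ('o, 'm, 'z) cat_scheme \<Rightarrow> ('i, 'k, 'o, 'm) func \<Rightarrow> 'o \<Rightarrow> ('i \<Rightarrow> 'm) \<Rightarrow> bool" where
  "is_cocone J C D c \<gamma> \<longleftrightarrow> c \<in> Obj C \<and>
     (\<forall>i\<in>Obj J. \<gamma> i \<in> Mor C (fo D i) c) \<and>
     (\<forall>i\<in>Obj J. \<forall>j\<in>Obj J. \<forall>k\<in>Mor J i j. Comp C (fo D i) (fo D j) c (\<gamma> j) (fm D i j k) = \<gamma> i)"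

definition is_colimit ::
  "('i, 'k, 'y) cat_scheme \<Rightarrow> ('o, 'm, 'z) cat_scheme \<Rightarrow> ('i, 'k, 'o, 'm) func \<Rightarrow> 'o \<Rightarrow> ('i \<Rightarrow> 'm) \<Rightarrow> bool" where
  "is_colimit J C D c \<gamma> \<longleftrightarrow> is_cocone J C D c \<gamma> \<and>
     (\<forall>c' \<gamma>'. is_cocone J C D c' \<gamma>' \<longrightarrow>
        (\<exists>!h. h \<in> Mor C c c' \<and> (\<forall>i\<in>Obj J. Comp C (fo D i) c c' h (\<gamma> i) = \<gamma>' i)))"

definition accessible ::
  "'u rel \<Rightarrow> ('o, 'm, 'y) cat_scheme \<Rightarrow> ('p, 'n, 'z) cat_scheme \<Rightarrow> ('o, 'm, 'p, 'n) func \<Rightarrow> bool" where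
  "accessible lam C C' F \<longleftrightarrow>
     (\<forall>(I :: 'u set) r D c \<gamma>.
        small TYPE('u) I \<and> directed_poset lam I r \<and> is_functor (poset_cat I r) C D \<and>
        is_colimit (poset_cat I r) C D c \<gamma> \<longrightarrow>
        is_colimit (poset_cat I r) C' (comp_func (poset_cat I r) F D) (fo F c)
          (\<lambda>i. fm F (fo D i) c (\<gamma> i)))"

subsection \<open>Extended metric spaces\<close>

record 'a emet =
  pts :: "'a set"
  edist :: "'a \<Rightarrow> 'a \<Rightarrow> ennreal"

definition is_emet :: "'a emet \<Rightarrow> bool" where
  "is_emet A \<longleftrightarrow>
     (\<forall>x y. x \<notin> pts A \<or> y \<notin> pts A \<longrightarrow> edist A x y = undefined) \<and>
     (\<forall>x\<in>pts A. \<forall>y\<in>pts A. edist A x y = 0 \<longleftrightarrow> x = y) \<and>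
     (\<forall>x\<in>pts A. \<forall>y\<in>pts A. edist A x y = edist A y x) \<and>
     (\<forall>x\<in>pts A. \<forall>y\<in>pts A. \<forall>z\<in>pts A. edist A x z \<le> edist A x y + edist A y z)"

definition mk_emet :: "'a set \<Rightarrow> ('a \<Rightarrow> 'a \<Rightarrow> ennreal) \<Rightarrow> 'a emet" where
  "mk_emet X d = \<lparr>pts = X, edist = (\<lambda>x y. if x \<in> X \<and> y \<in> X then d x y else undefined)\<rparr>"

definition nonexp :: "'a emet \<Rightarrow> 'b emet \<Rightarrow> ('a \<Rightarrow> 'b) set" where
  "nonexp A B = {f \<in> pts A \<rightarrow>\<^sub>E pts B. \<forall>x\<in>pts A. \<forall>y\<in>pts A. edist B (f x) (f y) \<le> edist A x y}"

definition sup_dist :: "'a emet \<Rightarrow> 'b emet \<Rightarrow> ('a \<Rightarrow> 'b) \<Rightarrow> ('a \<Rightarrow> 'b) \<Rightarrow> ennreal" where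
  "sup_dist A B f g = (SUP x\<in>pts A. edist B (f x) (g x))"

definition power_space :: "'i set \<Rightarrow> 'a emet \<Rightarrow> ('i \<Rightarrow> 'a) emet" where
  "power_space n A = mk_emet (n \<rightarrow>\<^sub>E pts A) (\<lambda>a b. SUP i\<in>n. edist A (a i) (b i))"

definition Met :: "('u emet, 'u \<Rightarrow> 'u) mcat" where
  "Met = \<lparr>Obj = {A. is_emet A \<and> small TYPE('u) (pts A)}, Mor = nonexp, Ident = (\<lambda>A. \<lambda>x\<in>pts A. x),
          Comp = (\<lambda>A B C g f. compose (pts A) g f), hdist = sup_dist\<rparr>"

subsection \<open>Monads\<close>

record ('o, 'm) monad =
  Fun :: "('o, 'm, 'o, 'm) func"
  munit :: "'o \<Rightarrow> 'm"
  mmult :: "'o \<Rightarrow> 'm"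

definition is_monad :: "('o, 'm, 'z) cat_scheme \<Rightarrow> ('o, 'm) monad \<Rightarrow> bool" where
  "is_monad C T \<longleftrightarrow>
     (let F = fo (Fun T) in
     is_functor C C (Fun T) \<and>
     munit T \<in> nat_trans C C (id_func C) (Fun T) \<and>
     mmult T \<in> nat_trans C C (comp_func C (Fun T) (Fun T)) (Fun T) \<and>
     (\<forall>A\<in>Obj C.
        Comp C (F A) (F (F A)) (F A) (mmult T A) (munit T (F A)) = Ident C (F A) \<and>
        Comp C (F A) (F (F A)) (F A) (mmult T A) (fm (Fun T) A (F A) (munit T A)) = Ident C (F A) \<and>
        Comp C (F (F (F A))) (F (F A)) (F A) (mmult T A) (mmult T (F A)) =
        Comp C (F (F (F A))) (F (F A)) (F A) (mmult T A) (fm (Fun T) (F (F A)) (F A) (mmult T A))))"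

definition monad_mor :: "('o, 'm, 'z) cat_scheme \<Rightarrow> ('o, 'm) monad \<Rightarrow> ('o, 'm) monad \<Rightarrow> ('o \<Rightarrow> 'm) set" where
  "monad_mor C S T =
     (let F = fo (Fun S); G = fo (Fun T) in
     {\<alpha> \<in> nat_trans C C (Fun S) (Fun T).
       (\<forall>A\<in>Obj C.
          Comp C A (F A) (G A) (\<alpha> A) (munit S A) = munit T A \<and>
          Comp C (F (F A)) (F A) (G A) (\<alpha> A) (mmult S A) =
          Comp C (F (F A)) (G (G A)) (G A) (mmult T A)
            (Comp C (F (F A)) (G (F A)) (G (G A)) (fm (Fun T) (F A) (G A) (\<alpha> A)) (\<alpha> (F A))))})"

definition basic_monad :: "'u rel \<Rightarrow> ('u emet, 'u \<Rightarrow> 'u) monad \<Rightarrow> bool" where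
  "basic_monad lam T \<longleftrightarrow>
     is_monad Met T \<and> enriched_functor Met Met (Fun T) \<and> accessible lam Met Met (Fun T) \<and>
     (\<forall>A\<in>Obj Met. \<forall>B\<in>Obj Met. \<forall>f\<in>Mor Met A B. f ` pts A = pts B \<longrightarrow>
        fm (Fun T) A B f ` pts (fo (Fun T) A) = pts (fo (Fun T) B))"

definition basic_monads_cat :: "'u rel \<Rightarrow> (('u emet, 'u \<Rightarrow> 'u) monad, 'u emet \<Rightarrow> 'u \<Rightarrow> 'u) cat" where
  "basic_monads_cat lam =
     \<lparr>Obj = {T. basic_monad lam T},
      Mor = monad_mor Met,
      Ident = (\<lambda>T. \<lambda>A\<in>Obj Met. Ident Met (fo (Fun T) A)),
      Comp = (\<lambda>R S T \<beta> \<alpha>. \<lambda>A\<in>Obj Met.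
                Comp Met (fo (Fun R) A) (fo (Fun S) A) (fo (Fun T) A) (\<beta> A) (\<alpha> A))\<rparr>"

subsection \<open>Quantitative algebras\<close>

text \<open>The cardinals below \<open>lam\<close> are represented as by von Neumann: the elements \<open>n\<close> of the
  well-order \<open>lam\<close> are the ordinals below it, the set of predecessors \<open>underS lam n\<close> is the index
  set of \<open>n\<close>-tuples, and \<open>n\<close> is a cardinal if this initial segment is an initial ordinal.\<close>

definition cardinal_below :: "'u rel \<Rightarrow> 'u \<Rightarrow> bool" where
  "cardinal_below lam n \<longleftrightarrow>
     n \<in> Field lam \<and> card_order_on (underS lam n) (Restr lam (underS lam n))"

record 'u signature =
  syms :: "'u set"
  arity :: "'u \<Rightarrow> 'u"

definition is_signature :: "'u rel \<Rightarrow> 'u signature \<Rightarrow> bool" where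
  "is_signature lam S \<longleftrightarrow> small TYPE('u) (syms S) \<and> arity S \<in> extensional (syms S) \<and>
     (\<forall>\<sigma>\<in>syms S. cardinal_below lam (arity S \<sigma>))"

abbreviation args :: "'u rel \<Rightarrow> 'u signature \<Rightarrow> 'u \<Rightarrow> 'u set" where
  "args lam S \<sigma> \<equiv> underS lam (arity S \<sigma>)"

record ('u, 'a) qalg =
  qspace :: "'a emet"
  interp :: "'u \<Rightarrow> ('u \<Rightarrow> 'a) \<Rightarrow> 'a"

definition is_qalg :: "'u rel \<Rightarrow> 'u signature \<Rightarrow> ('u, 'a) qalg \<Rightarrow> bool" where
  "is_qalg lam S A \<longleftrightarrow> is_emet (qspace A) \<and> interp A \<in> extensional (syms S) \<and>
     (\<forall>\<sigma>\<in>syms S. interp A \<sigma> \<in> nonexp (power_space (args lam S \<sigma>) (qspace A)) (qspace A))"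

definition qalg_hom :: "'u rel \<Rightarrow> 'u signature \<Rightarrow> ('u, 'a) qalg \<Rightarrow> ('u, 'b) qalg \<Rightarrow> ('a \<Rightarrow> 'b) set" where
  "qalg_hom lam S A B = {f \<in> nonexp (qspace A) (qspace B).
     \<forall>\<sigma>\<in>syms S. \<forall>a\<in>args lam S \<sigma> \<rightarrow>\<^sub>E pts (qspace A).
       f (interp A \<sigma> a) = interp B \<sigma> (\<lambda>i\<in>args lam S \<sigma>. f (a i))}"

text \<open>The category of those algebras in \<open>V\<close>, as a full subcategory of all quantitative algebras.\<close>

definition alg_cat :: "'u rel \<Rightarrow> 'u signature \<Rightarrow> ('u, 'u) qalg set \<Rightarrow> (('u, 'u) qalg, 'u \<Rightarrow> 'u) mcat" where
  "alg_cat lam S V =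
     \<lparr>Obj = V, Mor = qalg_hom lam S, Ident = (\<lambda>A. \<lambda>x\<in>pts (qspace A). x),
      Comp = (\<lambda>A B C g f. compose (pts (qspace A)) g f),
      hdist = (\<lambda>A B. sup_dist (qspace A) (qspace B))\<rparr>"

definition all_qalgs :: "'u rel \<Rightarrow> 'u signature \<Rightarrow> ('u, 'u) qalg set" where
  "all_qalgs lam S = {A. is_qalg lam S A \<and> qspace A \<in> Obj Met}"

subsection \<open>Terms and free algebras\<close>

datatype ('u, 'v) trm = Var 'v | Op 'u "'u \<Rightarrow> ('u, 'v) trm"

inductive_set terms :: "'u rel \<Rightarrow> 'u signature \<Rightarrow> 'v set \<Rightarrow> ('u, 'v) trm set"
  for lam S X where
  Var: "x \<in> X \<Longrightarrow> Var x \<in> terms lam S X"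
| Op: "\<sigma> \<in> syms S \<Longrightarrow> (\<And>i. i \<in> args lam S \<sigma> \<Longrightarrow> t i \<in> terms lam S X) \<Longrightarrow> t \<in> extensional (args lam S \<sigma>) \<Longrightarrow>
       Op \<sigma> t \<in> terms lam S X"

primrec tdist :: "'u rel \<Rightarrow> 'u signature \<Rightarrow> ('v \<Rightarrow> 'v \<Rightarrow> ennreal) \<Rightarrow> ('u, 'v) trm \<Rightarrow> ('u, 'v) trm \<Rightarrow> ennreal" where
  "tdist lam S d (Var x) = (\<lambda>t. case t of Var y \<Rightarrow> d x y | Op _ _ \<Rightarrow> \<infinity>)"
| "tdist lam S d (Op \<sigma> s) = (\<lambda>t. case t of Var _ \<Rightarrow> \<infinity>
     | Op \<tau> u \<Rightarrow> if \<sigma> = \<tau> then (SUP i\<in>args lam S \<sigma>. tdist lam S d (s i) (u i)) else \<infinity>)"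

definition free_qalg :: "'u rel \<Rightarrow> 'u signature \<Rightarrow> 'v emet \<Rightarrow> ('u, ('u, 'v) trm) qalg" where
  "free_qalg lam S M =
     \<lparr>qspace = mk_emet (terms lam S (pts M)) (tdist lam S (edist M)),
      interp = (\<lambda>\<sigma>\<in>syms S. \<lambda>t\<in>args lam S \<sigma> \<rightarrow>\<^sub>E terms lam S (pts M). Op \<sigma> t)\<rparr>"

text \<open>On the terms over \<open>pts M\<close>, \<open>term_ext lam S A f\<close> is the unique homomorphism from the free
  algebra on \<open>M\<close> to \<open>A\<close> that extends \<open>f\<close>; see \<open>term_ext_hom\<close> and \<open>term_ext_unique\<close>.\<close>

primrec term_ext :: "'u rel \<Rightarrow> 'u signature \<Rightarrow> ('u, 'a) qalg \<Rightarrow> ('v \<Rightarrow> 'a) \<Rightarrow> ('u, 'v) trm \<Rightarrow> 'a" where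
  "term_ext lam S A f (Var x) = f x"
| "term_ext lam S A f (Op \<sigma> t) = interp A \<sigma> (\<lambda>i\<in>args lam S \<sigma>. term_ext lam S A f (t i))"

lemma terms_tdist_self:
  assumes "is_emet M" and "s \<in> terms lam S (pts M)"
  shows "tdist lam S (edist M) s s = 0"
  using assms(2)
proof induction
  case (Var x) then show ?case using assms(1) by (simp add: is_emet_def)
next
  case (Op \<sigma> t) then show ?case by (auto simp flip: bot_ennreal)
qed

lemma terms_tdist_0:
  assumes "is_emet M" and "s \<in> terms lam S (pts M)" "t \<in> terms lam S (pts M)"
    and "tdist lam S (edist M) s t = 0"
  shows "s = t"
  using assms(2-)
proof (induction arbitrary: t)
  case (Var x)
  from Var(2) show ?case using Var assms(1) by cases (auto simp: is_emet_def)
next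
  case (Op \<sigma> s)
  from Op.prems(1) show ?case
  proof cases
    case (Var x) then show ?thesis using Op by simp
  next
    case (Op \<tau> u)
    then have [simp]: "\<tau> = \<sigma>" using Op.prems(2) by (auto split: if_splits)
    have "tdist lam S (edist M) (s i) (u i) = 0" if "i \<in> args lam S \<sigma>" for i
      using that Op.prems(2) Op SUP_upper[of i "args lam S \<sigma>" "\<lambda>i. tdist lam S (edist M) (s i) (u i)"] by simp
    then have "s = u" using Op Op.IH Op.hyps by (intro extensionalityI[of s "args lam S \<sigma>" u]) auto
    then show ?thesis using Op by simp
  qed
qed

lemma terms_tdist_sym:
  assumes "is_emet M" and "s \<in> terms lam S (pts M)" "t \<in> terms lam S (pts M)"
  shows "tdist lam S (edist M) s t = tdist lam S (edist M) t s"
  using assms(2-)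
proof (induction arbitrary: t)
  case (Var x)
  from Var(2) show ?case using Var assms(1) by cases (auto simp: is_emet_def)
next
  case (Op \<sigma> s)
  from Op.prems(1) show ?case by cases (auto intro!: SUP_cong Op.IH)
qed

lemma terms_tdist_triangle:
  assumes "is_emet M" and "s \<in> terms lam S (pts M)" "t \<in> terms lam S (pts M)" "u \<in> terms lam S (pts M)"
  shows "tdist lam S (edist M) s u \<le> tdist lam S (edist M) s t + tdist lam S (edist M) t u"
  using assms(2-)
proof (induction arbitrary: t u)
  case (Var x)
  from Var(2,3) Var(1) assms(1) show ?case by (auto simp: is_emet_def elim!: terms.cases)
next
  case (Op \<sigma> s)
  from Op.prems(1) show ?case
  proof cases
    case (Var x) then show ?thesis by simp
  next
    case t: (Op \<tau> t')
    show ?thesis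
    proof (cases "\<tau> = \<sigma>")
      case False then show ?thesis using t by simp
    next
      case eq: True
      from Op.prems(2) show ?thesis
      proof cases
        case (Var x) then show ?thesis using t by simp
      next
        case u: (Op \<rho> u')
        show ?thesis
        proof (cases "\<rho> = \<sigma>")
          case False then show ?thesis using t u eq by simp
        next
          case True
          have "(SUP i\<in>args lam S \<sigma>. tdist lam S (edist M) (s i) (u' i)) \<le>
            (SUP i\<in>args lam S \<sigma>. tdist lam S (edist M) (s i) (t' i)) +
            (SUP i\<in>args lam S \<sigma>. tdist lam S (edist M) (t' i) (u' i))"
            using t u eq True Op.IH
            by (intro SUP_least order_trans[OF Op.IH[of _ "t' _" "u' _"]] add_mono) (auto intro: SUP_upper)
          then show ?thesis using t u eq True by simp
        qed
      qed
    qed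
  qed
qed

lemma free_qalg_is_qalg:
  assumes "is_emet M"
  shows "is_qalg lam S (free_qalg lam S M)"
proof -
  have "is_emet (qspace (free_qalg lam S M))"
    using terms_tdist_self[OF assms] terms_tdist_0[OF assms] terms_tdist_sym[OF assms] terms_tdist_triangle[OF assms]
    by (simp add: is_emet_def[of "mk_emet _ _"] free_qalg_def) (auto simp: mk_emet_def)
  moreover have "interp (free_qalg lam S M) \<sigma> \<in>
      nonexp (power_space (args lam S \<sigma>) (qspace (free_qalg lam S M))) (qspace (free_qalg lam S M))"
    if \<sigma>: "\<sigma> \<in> syms S" for \<sigma>
  proof -
    have O: "Op \<sigma> a \<in> terms lam S (pts M)" if "a \<in> args lam S \<sigma> \<rightarrow>\<^sub>E terms lam S (pts M)" for a
      using that \<sigma> by (auto intro!: terms.Op simp: PiE_def)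
    have E: "(\<lambda>t\<in>args lam S \<sigma> \<rightarrow>\<^sub>E terms lam S (pts M). Op \<sigma> t) \<in>
       (args lam S \<sigma> \<rightarrow>\<^sub>E terms lam S (pts M)) \<rightarrow>\<^sub>E terms lam S (pts M)" using O by auto
    have "(SUP i\<in>args lam S \<sigma>. tdist lam S (edist M) (a i) (b i)) =
      (SUP i\<in>args lam S \<sigma>. edist (qspace (free_qalg lam S M)) (a i) (b i))"
      if "a \<in> args lam S \<sigma> \<rightarrow>\<^sub>E terms lam S (pts M)" "b \<in> args lam S \<sigma> \<rightarrow>\<^sub>E terms lam S (pts M)" for a b
      using that by (intro SUP_cong refl) (auto simp: free_qalg_def mk_emet_def PiE_mem)
    then show ?thesis using \<sigma> O E
      by (simp add: nonexp_def power_space_def mk_emet_def free_qalg_def)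
  qed
  ultimately show ?thesis by (auto simp: is_qalg_def free_qalg_def)
qed

lemma term_ext_closed:
  assumes "is_qalg lam S A" "f \<in> nonexp M (qspace A)" and "t \<in> terms lam S (pts M)"
  shows "term_ext lam S A f t \<in> pts (qspace A)"
  using assms(3)
proof induction
  case (Var x) then show ?case using assms(2) by (auto simp: nonexp_def)
next
  case (Op \<sigma> t)
  have "(\<lambda>i\<in>args lam S \<sigma>. term_ext lam S A f (t i)) \<in> args lam S \<sigma> \<rightarrow>\<^sub>E pts (qspace A)"
    using Op.IH by (simp only: restrict_PiE_iff) simp
  moreover have "interp A \<sigma> \<in> (args lam S \<sigma> \<rightarrow>\<^sub>E pts (qspace A)) \<rightarrow>\<^sub>E pts (qspace A)"
    using assms(1) Op.hyps(1) by (simp add: is_qalg_def nonexp_def power_space_def mk_emet_def)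
  ultimately show ?case by (auto simp only: term_ext.simps dest: PiE_mem)
qed

lemma term_ext_nonexp:
  assumes A: "is_qalg lam S A" and f: "f \<in> nonexp M (qspace A)"
    and "s \<in> terms lam S (pts M)" "t \<in> terms lam S (pts M)"
  shows "edist (qspace A) (term_ext lam S A f s) (term_ext lam S A f t) \<le> tdist lam S (edist M) s t"
  using assms(3-)
proof (induction arbitrary: t)
  case (Var x)
  from Var(2,1) f show ?case by (auto simp: nonexp_def elim!: terms.cases)
next
  case (Op \<sigma> s)
  from Op.prems show ?case
  proof cases
    case (Var x) then show ?thesis by simp
  next
    case (Op \<tau> u)
    show ?thesis
    proof (cases "\<tau> = \<sigma>")
      case False then show ?thesis using Op by simp
    next
      case True
      let ?s = "\<lambda>i\<in>args lam S \<sigma>. term_ext lam S A f (s i)" and ?u = "\<lambda>i\<in>args lam S \<sigma>. term_ext lam S A f (u i)"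
      have "?s \<in> args lam S \<sigma> \<rightarrow>\<^sub>E pts (qspace A)" "?u \<in> args lam S \<sigma> \<rightarrow>\<^sub>E pts (qspace A)"
        using Op True Op.hyps term_ext_closed[OF A f] by (simp_all only: restrict_PiE_iff) simp_all
      moreover have "edist (qspace A) (interp A \<sigma> a) (interp A \<sigma> b) \<le> (SUP i\<in>args lam S \<sigma>. edist (qspace A) (a i) (b i))"
        if "a \<in> args lam S \<sigma> \<rightarrow>\<^sub>E pts (qspace A)" "b \<in> args lam S \<sigma> \<rightarrow>\<^sub>E pts (qspace A)" for a b
        using A Op.hyps(1) that by (simp add: is_qalg_def nonexp_def power_space_def mk_emet_def)
      ultimately have "edist (qspace A) (interp A \<sigma> ?s) (interp A \<sigma> ?u) \<le> (SUP i\<in>args lam S \<sigma>. edist (qspace A) (?s i) (?u i))"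
        by blast
      also have "\<dots> \<le> (SUP i\<in>args lam S \<sigma>. tdist lam S (edist M) (s i) (u i))"
        using Op.IH Op True by (intro SUP_mono) auto
      finally show ?thesis using Op True by simp
    qed
  qed
qed

lemma term_ext_hom:
  assumes A: "is_qalg lam S A" and f: "f \<in> nonexp M (qspace A)"
  shows "restrict (term_ext lam S A f) (terms lam S (pts M)) \<in> qalg_hom lam S (free_qalg lam S M) A"
proof -
  have "Op \<sigma> a \<in> terms lam S (pts M)" if "\<sigma> \<in> syms S" "a \<in> args lam S \<sigma> \<rightarrow>\<^sub>E terms lam S (pts M)" for \<sigma> a
    using that by (auto intro!: terms.Op simp: PiE_def)
  moreover have "(\<lambda>i\<in>args lam S \<sigma>. term_ext lam S A f (a i)) =
      (\<lambda>i\<in>args lam S \<sigma>. restrict (term_ext lam S A f) (terms lam S (pts M)) (a i))"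
    if "a \<in> args lam S \<sigma> \<rightarrow>\<^sub>E terms lam S (pts M)" for \<sigma> a
    using that by (intro restrict_ext) (auto dest: PiE_mem)
  ultimately show ?thesis
    using term_ext_closed[OF assms] term_ext_nonexp[OF assms]
    by (simp add: qalg_hom_def nonexp_def free_qalg_def mk_emet_def)
qed

lemma term_ext_unique:
  assumes "h \<in> qalg_hom lam S (free_qalg lam S M) A" and "\<And>x. x \<in> pts M \<Longrightarrow> h (Var x) = f x"
    and "t \<in> terms lam S (pts M)"
  shows "h t = term_ext lam S A f t"
  using assms(3)
proof induction
  case (Var x) then show ?case using assms by simp
next
  case (Op \<sigma> t)
  have t: "t \<in> args lam S \<sigma> \<rightarrow>\<^sub>E terms lam S (pts M)" using Op by (auto simp: PiE_def)
  then have "h (interp (free_qalg lam S M) \<sigma> t) = interp A \<sigma> (\<lambda>i\<in>args lam S \<sigma>. h (t i))"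
    using assms(1) Op.hyps(1) unfolding qalg_hom_def by (auto simp: free_qalg_def mk_emet_def)
  then have "h (Op \<sigma> t) = interp A \<sigma> (\<lambda>i\<in>args lam S \<sigma>. h (t i))"
    using t Op.hyps(1) by (simp add: free_qalg_def)
  also have "(\<lambda>i\<in>args lam S \<sigma>. h (t i)) = (\<lambda>i\<in>args lam S \<sigma>. term_ext lam S A f (t i))"
    using Op.IH by auto
  finally show ?case unfolding term_ext.simps .
qed

subsection \<open>Varieties\<close>

record 'u qeq =
  ctxt :: "'u emet"
  lhs :: "('u, 'u) trm"
  rhs :: "('u, 'u) trm"
  eps :: rat

definition is_basic_qeq :: "'u rel \<Rightarrow> 'u signature \<Rightarrow> 'u qeq \<Rightarrow> bool" where
  "is_basic_qeq lam S e \<longleftrightarrow> is_emet (ctxt e) \<and> |pts (ctxt e)| <o lam \<and>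
     lhs e \<in> pts (qspace (free_qalg lam S (ctxt e))) \<and>
     rhs e \<in> pts (qspace (free_qalg lam S (ctxt e))) \<and> 0 \<le> eps e"

definition satisfies :: "'u rel \<Rightarrow> 'u signature \<Rightarrow> ('u, 'a) qalg \<Rightarrow> 'u qeq \<Rightarrow> bool" where
  "satisfies lam S A e \<longleftrightarrow> (\<forall>f\<in>nonexp (ctxt e) (qspace A).
     edist (qspace A) (term_ext lam S A f (lhs e)) (term_ext lam S A f (rhs e))
       \<le> ennreal (real_of_rat (eps e)))"

record 'u variety =
  sig :: "'u signature"
  algs :: "('u, 'u) qalg set"

definition basic_variety :: "'u rel \<Rightarrow> 'u variety \<Rightarrow> bool" where
  "basic_variety lam V \<longleftrightarrow> is_signature lam (sig V) \<and>
     (\<exists>E. small TYPE('u) E \<and> (\<forall>e\<in>E. is_basic_qeq lam (sig V) e) \<and>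
        algs V = {A \<in> all_qalgs lam (sig V). \<forall>e\<in>E. satisfies lam (sig V) A e})"

abbreviation var_cat :: "'u rel \<Rightarrow> 'u variety \<Rightarrow> (('u, 'u) qalg, 'u \<Rightarrow> 'u) mcat" where
  "var_cat lam V \<equiv> alg_cat lam (sig V) (algs V)"

definition forget :: "'u rel \<Rightarrow> 'u variety \<Rightarrow> (('u, 'u) qalg, 'u \<Rightarrow> 'u, 'u emet, 'u \<Rightarrow> 'u) func" where
  "forget lam V = mk_func (var_cat lam V) qspace (\<lambda>A B f. f)"

definition concrete_functor ::
  "'u rel \<Rightarrow> 'u variety \<Rightarrow> 'u variety \<Rightarrow> (('u, 'u) qalg, 'u \<Rightarrow> 'u, ('u, 'u) qalg, 'u \<Rightarrow> 'u) func \<Rightarrow> bool" where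
  "concrete_functor lam V W F \<longleftrightarrow> enriched_functor (var_cat lam V) (var_cat lam W) F \<and>
     comp_func (var_cat lam V) (forget lam W) F = forget lam V"

definition basic_varieties_cat ::
  "'u rel \<Rightarrow> ('u variety, (('u, 'u) qalg, 'u \<Rightarrow> 'u, ('u, 'u) qalg, 'u \<Rightarrow> 'u) func) cat" where
  "basic_varieties_cat lam =
     \<lparr>Obj = {V. basic_variety lam V},
      Mor = (\<lambda>V W. {F. concrete_functor lam V W F}),
      Ident = (\<lambda>V. id_func (var_cat lam V)),
      Comp = (\<lambda>V W X G F. comp_func (var_cat lam V) G F)\<rparr>"

end

theory Submission
  imports Defs
begin

text \<open>A variety \<open>V\<close> is sent to its free-algebra monad.  Concrete functors \<open>W \<rightarrow> V\<close> correspond to monad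
  morphisms \<open>T_V \<rightarrow> T_W\<close>, since an Eilenberg-Moore algebra \<open>e : T_V X \<rightarrow> X\<close> makes \<open>X\<close> a \<open>\<Sigma>\<close>-algebra that is a
  quotient of the free one along a map split in \<open>Met\<close>, and hence satisfies the equations of \<open>V\<close>.

  The monad \<open>T_V\<close> is accessible because \<open>lam\<close> is uncountable: in a \<open>lam\<close>-directed colimit the infimum that
  defines a distance is attained, so that operations and equations of fewer than \<open>lam\<close> variables lift to
  a single stage.

  Conversely, for a basic monad \<open>T\<close> take as \<open>n\<close>-ary operations the elements of \<open>T n\<close> for discrete \<open>n\<close>, and as
  equations all \<open>N \<turnstile> l =\<^sub>\<epsilon> r\<close> for which the values of \<open>l\<close> and \<open>r\<close> in \<open>T N\<close> have distance at most \<open>\<epsilon>\<close>.  As \<open>T\<close> preserves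
  the directed colimit of the small subspaces of \<open>M\<close> and the surjections from discrete spaces onto them,
  every element of \<open>T M\<close> is the value of a term and its distances are enforced by these equations; therefore
  \<open>T M\<close> is the free algebra on \<open>M\<close>.\<close>

subsection \<open>Cardinal arithmetic\<close>

text \<open>The obstacle is that contexts carry a metric. A nonexpanding assignment into a quotient
  need not lift to a nonexpanding one, so varieties are not closed under all surjective
  homomorphisms. For Eilenberg-Moore algebras and for directed colimits, membership is therefore
  derived from lifts of assignments of fewer than \<open>lam\<close> points: the unit supplies them
  in the first case, and in the second the attained distances, which lift such a family
  isometrically to one stage. Arities, unlike contexts, are discrete. Symbols can name only elements
  of \<open>T n\<close> for discrete \<open>n\<close>; the elements of \<open>T N\<close> for a
  small space \<open>N\<close> are reached because an enumeration \<open>n -> N\<close> stays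
  surjective under \<open>T\<close>, and the metric of \<open>N\<close> enters through the contexts.
  Rational bounds suffice, since a distance is the infimum of the rationals above it. The duality is
  contravariant because a concrete functor \<open>W -> V\<close> interprets the operations of
  \<open>V\<close> in the algebras of \<open>W\<close>, just as \<open>T_V -> T_W\<close> translates
  terms of \<open>V\<close> into terms of \<open>W\<close>. The equivalence is obtained from full
  faithfulness and essential surjectivity, with a quasi-inverse found by choice.\<close>

lemma ennreal_rat_between:
  fixes a b :: ennreal
  assumes "a < b"
  obtains q :: rat where "0 \<le> q" "a < ennreal (real_of_rat q)" "ennreal (real_of_rat q) < b"
proof -
  \<comment> \<open>The detour through \<open>c\<close> makes both bounds finite even if
    \<open>b\<close> is \<infinity>, so that density of the rationals in the reals applies.\<close>
  obtain c where c: "a < c" "c < b" using \<open>a < b\<close> dense by blast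
  obtain r s where r: "a = ennreal r" "0 \<le> r" and s: "c = ennreal s" "0 \<le> s"
    using c by (cases a; cases c) auto
  with c have "r < s" by (simp add: ennreal_less_iff)
  then obtain q :: rat where q: "r < real_of_rat q" "real_of_rat q < s" using of_rat_dense by blast
  then have q0: "0 < real_of_rat q" using r(2) by linarith
  then have "0 \<le> q" by simp
  moreover have "a < ennreal (real_of_rat q)" "ennreal (real_of_rat q) < c"
    using q q0 r s by (simp_all add: ennreal_less_iff)
  ultimately show thesis using that c(2) by (meson less_trans)
qed

text \<open>An equation can bound a distance only by a rational; this lemma recovers the exact
  bound. If \<open>b\<close> is infinite, the premise is vacuous and the claim trivial.\<close>

lemma ennreal_le_ratI:
  fixes a b :: ennreal
  assumes "\<And>q :: rat. 0 \<le> q \<Longrightarrow> b \<le> ennreal (real_of_rat q) \<Longrightarrow> a \<le> ennreal (real_of_rat q)"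
  shows "a \<le> b"
proof (rule ccontr)
  assume "\<not> a \<le> b"
  then have "b < a" by simp
  then obtain q :: rat where "0 \<le> q" "b < ennreal (real_of_rat q)" "ennreal (real_of_rat q) < a"
    by (rule ennreal_rat_between)
  then show False using assms[of q] by (meson less_imp_le not_le)
qed

section \<open>Sets of fewer than \<open>lam\<close> elements and small sets\<close>

locale cardinal_universe =
  fixes lam :: "'u rel"
  assumes lam: "uncountable_regular_cardinal lam" and univ: "universe_for lam"
begin

lemma lam_Card_order: "Card_order lam"
  using lam by (simp add: uncountable_regular_cardinal_def)

lemma lam_Well_order: "Well_order lam"
  using lam_Card_order by (auto simp: card_order_on_def)

lemma lam_Cinfinite: "Cinfinite lam"
  using lam unfolding uncountable_regular_cardinal_def
  by (meson cinfinite_mono natLeq_Cinfinite ordLess_imp_ordLeq)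

lemma lam_infinite: "infinite (Field lam)"
  using lam_Cinfinite by (simp add: cinfinite_def)

lemma lam_regularCard: "regularCard lam"
  using lam by (simp add: uncountable_regular_cardinal_def)

lemma lt_lam_imp_small: "|X| <o lam \<Longrightarrow> small TYPE('u) X"
  using univ unfolding universe_for_def small_def by (meson ordLess_transitive)

lemma UNIV_Cinfinite: "Cinfinite |UNIV :: 'u set|"
  using univ lam_Cinfinite unfolding universe_for_def
  by (meson cinfinite_mono ordLess_imp_ordLeq card_of_Card_order)

lemma small_subset: "small TYPE('u) Y \<Longrightarrow> X \<subseteq> Y \<Longrightarrow> small TYPE('u) X"
  unfolding small_def by (meson card_of_mono1 ordLeq_ordLess_trans)

lemma small_image: "small TYPE('u) X \<Longrightarrow> small TYPE('u) (f ` X)"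
  unfolding small_def by (meson card_of_image ordLeq_ordLess_trans)

lemma lt_image: "|X| <o lam \<Longrightarrow> |f ` X| <o lam"
  by (meson card_of_image ordLeq_ordLess_trans)

lemma small_inj: "small TYPE('u) Y \<Longrightarrow> inj_on f X \<Longrightarrow> f ` X \<subseteq> Y \<Longrightarrow> small TYPE('u) X"
  unfolding small_def by (meson card_of_ordLeq ordLeq_ordLess_trans)

lemma small_UN: "small TYPE('u) I \<Longrightarrow> (\<And>i. i \<in> I \<Longrightarrow> small TYPE('u) (X i)) \<Longrightarrow> small TYPE('u) (\<Union>i\<in>I. X i)"
  using UNIV_Cinfinite univ unfolding small_def universe_for_def
  by (metis card_of_UNION_ordLess_infinite_Field_regularCard)

lemma small_Un: "small TYPE('u) X \<Longrightarrow> small TYPE('u) Y \<Longrightarrow> small TYPE('u) (X \<union> Y)"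
  using UNIV_Cinfinite unfolding small_def cinfinite_def
  by (intro card_of_Un_ordLess_infinite) (simp_all add: Field_card_of)

lemma lt_UN: "|I| <o lam \<Longrightarrow> (\<And>i. i \<in> I \<Longrightarrow> |X i| <o lam) \<Longrightarrow> |\<Union>i\<in>I. X i| <o lam"
  using lam_Cinfinite lam_regularCard by (metis card_of_UNION_ordLess_infinite_Field_regularCard)

lemma lt_Un: "|X| <o lam \<Longrightarrow> |Y| <o lam \<Longrightarrow> |X \<union> Y| <o lam"
  by (rule card_of_Un_ordLess_infinite_Field[OF lam_infinite lam_Card_order])

text \<open>Uncountability of \<open>lam\<close> in usable form: a family indexed by the rationals
  counts as one of fewer than \<open>lam\<close> members and thus has upper bounds in
  \<open>lam\<close>-directed posets.\<close>

lemma lt_countable: "countable X \<Longrightarrow> |X| <o lam"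
proof -
  assume "countable X"
  then obtain f :: "_ \<Rightarrow> nat" where "inj_on f X" by (auto simp: countable_def)
  then have "|X| \<le>o |UNIV :: nat set|" by (auto simp flip: card_of_ordLeq)
  also have "|UNIV :: nat set| =o natLeq" by (rule card_of_nat)
  finally show ?thesis using lam unfolding uncountable_regular_cardinal_def
    by (meson ordLeq_ordLess_trans)
qed

lemma lt_finite: "finite X \<Longrightarrow> |X| <o lam"
  by (simp add: lt_countable countable_finite)

lemma small_countable: "countable X \<Longrightarrow> small TYPE('u) X"
  by (simp add: lt_countable lt_lam_imp_small)

lemma small_Sigma: "small TYPE('u) I \<Longrightarrow> (\<And>i. i \<in> I \<Longrightarrow> small TYPE('u) (X i)) \<Longrightarrow> small TYPE('u) (Sigma I X)"
proof -
  assume "small TYPE('u) I" "\<And>i. i \<in> I \<Longrightarrow> small TYPE('u) (X i)"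
  then have "small TYPE('u) (\<Union>i\<in>I. Pair i ` X i)" by (intro small_UN small_image)
  moreover have "Sigma I X = (\<Union>i\<in>I. Pair i ` X i)" by auto
  ultimately show ?thesis by simp
qed

lemma lt_Sigma: "|I| <o lam \<Longrightarrow> (\<And>i. i \<in> I \<Longrightarrow> |X i| <o lam) \<Longrightarrow> |Sigma I X| <o lam"
proof -
  assume "|I| <o lam" "\<And>i. i \<in> I \<Longrightarrow> |X i| <o lam"
  then have "|\<Union>i\<in>I. Pair i ` X i| <o lam" by (intro lt_UN lt_image)
  moreover have "Sigma I X = (\<Union>i\<in>I. Pair i ` X i)" by auto
  ultimately show ?thesis by simp
qed

text \<open>Smallness is what permits relabelling a set by elements of \<open>'u\<close>, of which
  all spaces and operation symbols have to be made.\<close>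

lemma small_code:
  assumes "small TYPE('u) X"
  obtains c :: "'x \<Rightarrow> 'u" where "inj_on c X"
  using assms unfolding small_def by (metis card_of_ordLeq ordLess_imp_ordLeq)

text \<open>The cardinal \<open>|Y|\<close> is a well-order below \<open>lam\<close>, hence
  isomorphic to a proper initial segment, and this segment is an initial ordinal because
  \<open>|Y|\<close> is one. In this way any set of fewer than \<open>lam\<close> elements serves as
  an arity or, after renaming, as a context.\<close>

lemma lt_code:
  assumes "|Y| <o lam"
  obtains n h where "cardinal_below lam n" "bij_betw h (underS lam n) Y"
proof -
  obtain n where n: "n \<in> Field lam" "|Y| =o Restr lam (underS lam n)"
    using assms ordLess_iff_ordIso_Restr[OF lam_Well_order, of "|Y|"] card_of_Well_order by blast
  have F: "Field (Restr lam (underS lam n)) = underS lam n"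
    using lam_Well_order by (intro Field_Restr_ofilter wo_rel.underS_ofilter) (simp_all add: wo_rel_def)
  have "Card_order (Restr lam (underS lam n))"
    using n(2) by (meson card_of_Card_order Card_order_ordIso2)
  then have c: "cardinal_below lam n" using n(1) F by (simp add: cardinal_below_def)
  have "|underS lam n| =o |Y|"
    using n(2) F \<open>Card_order _\<close> by (metis card_of_Field_ordIso ordIso_symmetric ordIso_transitive)
  then obtain h where "bij_betw h (underS lam n) Y" by (auto simp flip: card_of_ordIso)
  with c show thesis by (rule that)
qed

lemma lt_underS: "n \<in> Field lam \<Longrightarrow> |underS lam n| <o lam"
  using lam_Card_order by (simp add: card_of_underS)

lemma cardinal_below_lt: "cardinal_below lam n \<Longrightarrow> |underS lam n| <o lam"
  by (simp add: cardinal_below_def lt_underS)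

lemma small_Field_lam: "small TYPE('u) (Field lam)"
  using univ lam_Card_order unfolding universe_for_def small_def
  by (meson card_of_Field_ordIso ordIso_ordLess_trans)

text \<open>The hypothesis \<open>universe_for\<close> speaks only of subsets of \<open>'u\<close>.
  Coding the base in \<open>'u\<close> and the exponent as an initial segment of \<open>lam\<close>
  carries the closure under powers over to arbitrary types.\<close>

lemma small_PiE:
  assumes X: "small TYPE('u) X" and Y: "|Y| <o lam"
  shows "small TYPE('u) (Y \<rightarrow>\<^sub>E X)"
proof -
  obtain c :: "_ \<Rightarrow> 'u" where c: "inj_on c X" using small_code[OF X] .
  obtain n h where h: "bij_betw h (underS lam n) Y" using lt_code[OF Y] .
  have "small TYPE('u) (underS lam n \<rightarrow>\<^sub>E c ` X)"
    using univ small_image[OF X, of c] Y h unfolding universe_for_def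
    by (meson bij_betw_inv_into card_of_ordIsoI ordIso_ordLess_trans)
  moreover have "inj_on (\<lambda>f. \<lambda>i\<in>underS lam n. c (f (h i))) (Y \<rightarrow>\<^sub>E X)"
  proof (rule inj_onI)
    fix f g assume f: "f \<in> Y \<rightarrow>\<^sub>E X" and g: "g \<in> Y \<rightarrow>\<^sub>E X"
      and eq: "(\<lambda>i\<in>underS lam n. c (f (h i))) = (\<lambda>i\<in>underS lam n. c (g (h i)))"
    show "f = g"
    proof (rule PiE_ext[OF f g])
      fix y assume "y \<in> Y"
      then obtain i where i: "i \<in> underS lam n" "y = h i" using h by (auto simp: bij_betw_def)
      have "c (f y) = c (g y)" using fun_cong[OF eq, of i] i by simp
      then show "f y = g y" using c f g \<open>y \<in> Y\<close> by (auto dest: inj_onD)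
    qed
  qed
  moreover have "(\<lambda>f. \<lambda>i\<in>underS lam n. c (f (h i))) ` (Y \<rightarrow>\<^sub>E X) \<subseteq> underS lam n \<rightarrow>\<^sub>E c ` X"
    using h by (fastforce simp: bij_betw_def)
  ultimately show ?thesis by (rule small_inj)
qed

text \<open>An extended real is determined by the rationals below it, so there are at most as many
  as subsets of a countable set, and a countable exponent is below \<open>lam\<close>. The bound is
  needed to count the metrics on a context.\<close>

lemma small_ennreal: "small TYPE('u) (UNIV :: ennreal set)"
proof -
  have "small TYPE('u) ((UNIV :: rat set) \<rightarrow>\<^sub>E (UNIV :: bool set))"
    by (intro small_PiE small_countable lt_countable) auto
  moreover have "inj (\<lambda>x (q :: rat). ennreal (real_of_rat q) < x)"
  proof (rule injI)
    fix x y :: ennreal assume eq: "(\<lambda>q :: rat. ennreal (real_of_rat q) < x) = (\<lambda>q. ennreal (real_of_rat q) < y)"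
    have *: False if "a < b" "\<And>q :: rat. ennreal (real_of_rat q) < a \<longleftrightarrow> ennreal (real_of_rat q) < b" for a b :: ennreal
      using ennreal_rat_between[OF that(1)] that(2) by (metis order_less_asym)
    show "x = y" using *[of x y] *[of y x] fun_cong[OF eq] by (metis linorder_neqE)
  qed
  ultimately show ?thesis using small_inj[of "UNIV \<rightarrow>\<^sub>E UNIV"] by auto
qed

text \<open>Such a subset is the range of a function on an initial segment of \<open>lam\<close>,
  and these functions form a small set. It provides the index set for the small subspaces of a
  space.\<close>

lemma small_lt_subsets: 
  assumes "small TYPE('u) X"
  shows "small TYPE('u) {N. N \<subseteq> X \<and> |N| <o lam}"
proof -
  have "small TYPE('u) (\<Union>n\<in>Field lam. (\<lambda>f. f ` underS lam n) ` (underS lam n \<rightarrow>\<^sub>E X))"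
    by (intro small_UN small_image small_PiE small_Field_lam assms lt_underS)
  moreover have "N \<in> (\<Union>n\<in>Field lam. (\<lambda>f. f ` underS lam n) ` (underS lam n \<rightarrow>\<^sub>E X))"
    if N: "N \<subseteq> X" "|N| <o lam" for N
  proof -
    obtain n h where h: "cardinal_below lam n" "bij_betw h (underS lam n) N" using lt_code[OF N(2)] .
    have "restrict h (underS lam n) \<in> underS lam n \<rightarrow>\<^sub>E X" "N = restrict h (underS lam n) ` underS lam n"
      using h N by (auto simp: bij_betw_def)
    then show ?thesis using h(1) unfolding cardinal_below_def by blast
  qed
  ultimately show ?thesis by (elim small_subset) auto
qed

end

subsection \<open>Extended metric spaces and directed colimits\<close>

lemma nonexpI:
  assumes "\<And>x. x \<in> pts A \<Longrightarrow> f x \<in> pts B" "f \<in> extensional (pts A)"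
    and "\<And>x y. x \<in> pts A \<Longrightarrow> y \<in> pts A \<Longrightarrow> edist B (f x) (f y) \<le> edist A x y"
  shows "f \<in> nonexp A B"
  using assms by (auto simp: nonexp_def PiE_def)

lemma nonexp_in: "f \<in> nonexp A B \<Longrightarrow> x \<in> pts A \<Longrightarrow> f x \<in> pts B"
  by (auto simp: nonexp_def)

lemma nonexp_le: "f \<in> nonexp A B \<Longrightarrow> x \<in> pts A \<Longrightarrow> y \<in> pts A \<Longrightarrow> edist B (f x) (f y) \<le> edist A x y"
  by (auto simp: nonexp_def)

lemma nonexp_extensional: "f \<in> nonexp A B \<Longrightarrow> f \<in> extensional (pts A)"
  by (auto simp: nonexp_def PiE_def)

lemma nonexp_eqI:
  assumes "f \<in> nonexp A B" "g \<in> nonexp A C" "\<And>x. x \<in> pts A \<Longrightarrow> f x = g x"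
  shows "f = g"
  using assms by (intro extensionalityI[of f "pts A" g]) (auto dest: nonexp_extensional)

lemma nonexp_compose:
  assumes "f \<in> nonexp A B" "g \<in> nonexp B C"
  shows "compose (pts A) g f \<in> nonexp A C"
  using assms by (intro nonexpI) (auto simp: compose_eq nonexp_in intro!: order_trans[OF nonexp_le[OF assms(2)] nonexp_le])

lemma nonexp_ident: "(\<lambda>x\<in>pts A. x) \<in> nonexp A A"
  by (intro nonexpI) auto

lemma nonexp_restrict:
  assumes "\<And>x. x \<in> pts A \<Longrightarrow> f x \<in> pts B"
    and "\<And>x y. x \<in> pts A \<Longrightarrow> y \<in> pts A \<Longrightarrow> edist B (f x) (f y) \<le> edist A x y"
  shows "restrict f (pts A) \<in> nonexp A B"
  using assms by (intro nonexpI) auto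

lemma pts_mk_emet [simp]: "pts (mk_emet X d) = X"
  by (simp add: mk_emet_def)

lemma edist_mk_emet [simp]: "x \<in> X \<Longrightarrow> y \<in> X \<Longrightarrow> edist (mk_emet X d) x y = d x y"
  by (simp add: mk_emet_def)

lemma is_emet_mk_emet:
  assumes "\<And>x. x \<in> X \<Longrightarrow> d x x = 0" "\<And>x y. x \<in> X \<Longrightarrow> y \<in> X \<Longrightarrow> d x y = 0 \<Longrightarrow> x = y"
    and "\<And>x y. x \<in> X \<Longrightarrow> y \<in> X \<Longrightarrow> d x y = d y x"
    and "\<And>x y z. x \<in> X \<Longrightarrow> y \<in> X \<Longrightarrow> z \<in> X \<Longrightarrow> d x z \<le> d x y + d y z"
  shows "is_emet (mk_emet X d)"
  using assms unfolding is_emet_def by (auto simp: mk_emet_def)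

lemma edist_self: "is_emet A \<Longrightarrow> x \<in> pts A \<Longrightarrow> edist A x x = 0"
  by (simp add: is_emet_def)

lemma edist_0: "is_emet A \<Longrightarrow> x \<in> pts A \<Longrightarrow> y \<in> pts A \<Longrightarrow> edist A x y = 0 \<Longrightarrow> x = y"
  by (simp add: is_emet_def)

lemma edist_sym: "is_emet A \<Longrightarrow> x \<in> pts A \<Longrightarrow> y \<in> pts A \<Longrightarrow> edist A x y = edist A y x"
  by (simp add: is_emet_def)

lemma edist_tri:
  "is_emet A \<Longrightarrow> x \<in> pts A \<Longrightarrow> y \<in> pts A \<Longrightarrow> z \<in> pts A \<Longrightarrow> edist A x z \<le> edist A x y + edist A y z"
  by (simp add: is_emet_def)

lemma Met_simps [simp]:
  "Mor Met = nonexp" "Ident Met = (\<lambda>A. \<lambda>x\<in>pts A. x)" "Comp Met A B C g f = compose (pts A) g f"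
  "hdist Met = sup_dist"
  by (simp_all add: Met_def)

lemma Obj_MetI: "is_emet A \<Longrightarrow> small TYPE('u) (pts A) \<Longrightarrow> (A :: 'u emet) \<in> Obj Met"
  by (simp add: Met_def)

lemma Obj_Met_emet: "A \<in> Obj Met \<Longrightarrow> is_emet A"
  by (simp add: Met_def)

lemma Obj_Met_small: "(A :: 'u emet) \<in> Obj Met \<Longrightarrow> small TYPE('u) (pts A)"
  by (simp add: Met_def)

lemma compose_ident_left: "f \<in> X \<rightarrow>\<^sub>E Y \<Longrightarrow> compose X (\<lambda>y\<in>Y. y) f = f"
  by (rule extensionalityI[of _ X]) (auto simp: compose_eq PiE_def)

lemma nonexp_PiE: "f \<in> nonexp A B \<Longrightarrow> f \<in> pts A \<rightarrow>\<^sub>E pts B"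
  by (simp add: nonexp_def)

definition sub_emet :: "'a emet \<Rightarrow> 'a set \<Rightarrow> 'a emet" where
  "sub_emet A N = mk_emet N (edist A)"

lemma pts_sub_emet [simp]: "pts (sub_emet A N) = N"
  by (simp add: sub_emet_def)

lemma edist_sub_emet [simp]: "x \<in> N \<Longrightarrow> y \<in> N \<Longrightarrow> edist (sub_emet A N) x y = edist A x y"
  by (simp add: sub_emet_def)

lemma is_emet_sub_emet: "is_emet A \<Longrightarrow> N \<subseteq> pts A \<Longrightarrow> is_emet (sub_emet A N)"
  unfolding sub_emet_def
  by (rule is_emet_mk_emet) (auto simp: edist_self subset_iff dest: edist_0 edist_sym edist_tri)

context cardinal_universe
begin

text \<open>Directed colimits and free algebras are both constructed as such quotients. Classes
  cannot be used as points, which must lie in \<open>'u\<close>; each class is represented by the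
  code of one chosen member.\<close>

lemma pseudometric_quotient:
  fixes X :: "'x set"
  assumes X: "small TYPE('u) X" and refl: "\<And>x. x \<in> X \<Longrightarrow> d x x = 0"
    and sym: "\<And>x y. x \<in> X \<Longrightarrow> y \<in> X \<Longrightarrow> d x y = d y x"
    and tri: "\<And>x y z. x \<in> X \<Longrightarrow> y \<in> X \<Longrightarrow> z \<in> X \<Longrightarrow> d x z \<le> d x y + (d y z :: ennreal)"
  obtains Q :: "'u emet" and q where "Q \<in> Obj Met" "q ` X = pts Q"
    "\<And>x y. x \<in> X \<Longrightarrow> y \<in> X \<Longrightarrow> edist Q (q x) (q y) = d x y"
proof -
  obtain c :: "'x \<Rightarrow> 'u" where c: "inj_on c X" using small_code[OF X] .
  \<comment> \<open>The predicate under \<open>SOME\<close> is the same for all members of a class,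
    so \<open>R\<close> is constant on classes; this is what \<open>Req\<close> verifies.\<close>
  define R where "R x = (SOME y. y \<in> X \<and> d x y = 0)" for x
  have R: "R x \<in> X \<and> d x (R x) = 0" if "x \<in> X" for x
  proof -
    have "\<exists>y. y \<in> X \<and> d x y = 0" using that refl by blast
    then show ?thesis unfolding R_def by (rule someI_ex)
  qed
  have dd: "d (R x) (R y) = d x y" if "x \<in> X" "y \<in> X" for x y
  proof (rule antisym)
    have "d (R x) (R y) \<le> d (R x) x + (d x y + d y (R y))"
      using R that tri[of "R x" x "R y"] tri[of x y "R y"] by (meson add_left_mono order_trans)
    also have "\<dots> = d x y" using R that sym[of "R x" x] by simp
    finally show "d (R x) (R y) \<le> d x y" .
    have "d x y \<le> d x (R x) + (d (R x) (R y) + d (R y) y)"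
      using R that tri[of x "R x" y] tri[of "R x" "R y" y] by (meson add_left_mono order_trans)
    also have "\<dots> = d (R x) (R y)" using R that sym[of y "R y"] by simp
    finally show "d x y \<le> d (R x) (R y)" .
  qed
  have Req: "R x = R y" if "x \<in> X" "y \<in> X" "d x y = 0" for x y
  proof -
    have "d x z = 0 \<longleftrightarrow> d y z = 0" if "z \<in> X" for z
      using tri[of x y z] tri[of y x z] sym[of x y] \<open>d x y = 0\<close> \<open>x \<in> X\<close> \<open>y \<in> X\<close> that by auto
    then show ?thesis unfolding R_def by metis
  qed
  define q where "q x = c (R x)" for x
  \<comment> \<open>The choice of preimages is harmless since \<open>d\<close> does not change when
    its arguments move within their classes.\<close>
  define e where "e p p' = d (inv_into X q p) (inv_into X q p')" for p p'
  have iX: "inv_into X q (q x) \<in> X" "q (inv_into X q (q x)) = q x" if "x \<in> X" for x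
    using that by (auto intro: inv_into_into f_inv_into_f)
  have "R (inv_into X q (q x)) = R x" if "x \<in> X" for x
    using iX[OF that] R[OF that] R[OF iX(1)[OF that]] c by (auto simp: q_def dest: inj_onD)
  then have e: "e (q x) (q y) = d x y" if "x \<in> X" "y \<in> X" for x y
    unfolding e_def using dd[of "inv_into X q (q x)" "inv_into X q (q y)"] dd[OF that] iX that by simp
  have 1: "q x = q y" if "x \<in> X" "y \<in> X" "d x y = 0" for x y
    using Req[OF that] by (simp add: q_def)
  show thesis
  proof (rule that[of "mk_emet (q ` X) e" q])
    show "mk_emet (q ` X) e \<in> Obj Met"
      by (intro Obj_MetI is_emet_mk_emet) (auto simp: e refl sym tri X small_image intro: 1)
  qed (auto simp: e)
qed

end

section \<open>Directed colimits of metric spaces, described by points\<close>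

locale directed_diagram = cardinal_universe lam for lam :: "'u rel" +
  fixes I :: "'u set" and r :: "'u rel" and X :: "'u \<Rightarrow> 'u emet" and b :: "'u \<Rightarrow> 'u \<Rightarrow> 'u \<Rightarrow> 'u"
  assumes small_I: "small TYPE('u) I" and directed: "directed_poset lam I r"
    and X_Obj: "\<And>i. i \<in> I \<Longrightarrow> X i \<in> Obj Met"
    and b_nonexp: "\<And>i j. (i, j) \<in> r \<Longrightarrow> b i j \<in> nonexp (X i) (X j)"
    and b_id: "\<And>i x. i \<in> I \<Longrightarrow> x \<in> pts (X i) \<Longrightarrow> b i i x = x"
    and b_comp: "\<And>i j k x. (i, j) \<in> r \<Longrightarrow> (j, k) \<in> r \<Longrightarrow> x \<in> pts (X i) \<Longrightarrow> b j k (b i j x) = b i k x"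
begin

lemma r_refl: "i \<in> I \<Longrightarrow> (i, i) \<in> r"
  using directed by (auto simp: directed_poset_def partial_order_on_def preorder_on_def refl_on_def)

lemma r_trans: "(i, j) \<in> r \<Longrightarrow> (j, k) \<in> r \<Longrightarrow> (i, k) \<in> r"
  using directed by (auto simp: directed_poset_def partial_order_on_def preorder_on_def dest: transD)

lemma r_I: "(i, j) \<in> r \<Longrightarrow> i \<in> I" "(i, j) \<in> r \<Longrightarrow> j \<in> I"
  using directed by (auto simp: directed_poset_def partial_order_on_def preorder_on_def refl_on_def)

lemma upper_bound:
  assumes "J \<subseteq> I" "|J| <o lam"
  obtains k where "k \<in> I" "\<forall>j\<in>J. (j, k) \<in> r"
proof -
  have "\<exists>k\<in>I. \<forall>j\<in>J. (j, k) \<in> r" using directed assms by (simp add: directed_poset_def)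
  then show thesis using that by blast
qed

lemma upper_bound2:
  assumes "i \<in> I" "j \<in> I"
  obtains k where "k \<in> I" "(i, k) \<in> r" "(j, k) \<in> r"
proof -
  have "{i, j} \<subseteq> I" "|{i, j}| <o lam" using assms by (simp_all add: lt_finite)
  then obtain k where "k \<in> I" "\<forall>l\<in>{i, j}. (l, k) \<in> r" by (rule upper_bound)
  then show thesis using that by simp
qed

lemma b_in: "(i, j) \<in> r \<Longrightarrow> x \<in> pts (X i) \<Longrightarrow> b i j x \<in> pts (X j)"
  using b_nonexp by (rule nonexp_in)

lemma X_emet: "i \<in> I \<Longrightarrow> is_emet (X i)"
  using X_Obj by (rule Obj_Met_emet)

lemma edist_b_decreasing:
  assumes "(i, k) \<in> r" "(j, k) \<in> r" "(k, l) \<in> r" "x \<in> pts (X i)" "y \<in> pts (X j)"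
  shows "edist (X l) (b i l x) (b j l y) \<le> edist (X k) (b i k x) (b j k y)"
  using nonexp_le[OF b_nonexp[OF assms(3)] b_in[OF assms(1,4)] b_in[OF assms(2,5)]] b_comp assms by simp

text \<open>A pair \<open>(i, x)\<close> stands for the point \<open>x\<close> of stage
  \<open>i\<close>. This is the pseudometric on the disjoint union of the stages whose quotient is
  the colimit.\<close>

definition delta :: "'u \<times> 'u \<Rightarrow> 'u \<times> 'u \<Rightarrow> ennreal" where
  "delta p p' = (INF k\<in>{k. (fst p, k) \<in> r \<and> (fst p', k) \<in> r}.
     edist (X k) (b (fst p) k (snd p)) (b (fst p') k (snd p')))"

lemma delta_le: "(i, k) \<in> r \<Longrightarrow> (j, k) \<in> r \<Longrightarrow> delta (i, x) (j, y) \<le> edist (X k) (b i k x) (b j k y)"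
  unfolding delta_def by (rule INF_lower2[of k]) auto

text \<open>Here uncountability of \<open>lam\<close> is used: a countable set of indices approximating the infimum has an
  upper bound.\<close>

lemma delta_attained:
  assumes "i \<in> I" "j \<in> I" "x \<in> pts (X i)" "y \<in> pts (X j)"
  obtains k where "(i, k) \<in> r" "(j, k) \<in> r" "edist (X k) (b i k x) (b j k y) = delta (i, x) (j, y)"
proof -
  let ?f = "\<lambda>k. edist (X k) (b i k x) (b j k y)"
  let ?K = "{k. (i, k) \<in> r \<and> (j, k) \<in> r}"
  obtain k0 where k0: "k0 \<in> ?K" using upper_bound2[OF assms(1,2)] by auto
  have "\<exists>k\<in>?K. ?f k < ennreal (real_of_rat q)"
    if "delta (i, x) (j, y) < ennreal (real_of_rat q)" for q
    using that unfolding delta_def by (auto simp: INF_less_iff)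
  \<comment> \<open>For rationals not above the infimum the condition is void; \<open>k0\<close> is
    the default that keeps \<open>K q\<close> above \<open>i\<close> and \<open>j\<close> for every
    \<open>q\<close>.\<close>
  then have "\<forall>q. \<exists>k. k \<in> ?K \<and> (delta (i, x) (j, y) < ennreal (real_of_rat q) \<longrightarrow> ?f k < ennreal (real_of_rat q))"
    using k0 by blast
  from choice[OF this] obtain K where K': "\<forall>q. K q \<in> ?K \<and> (delta (i, x) (j, y) < ennreal (real_of_rat q) \<longrightarrow> ?f (K q) < ennreal (real_of_rat q))"
    by blast
  then have K: "K q \<in> ?K" "delta (i, x) (j, y) < ennreal (real_of_rat q) \<Longrightarrow> ?f (K q) < ennreal (real_of_rat q)" for q
    by blast+
  have "range K \<subseteq> I" using K(1) r_I(2) by blast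
  moreover have "|range K| <o lam" by (intro lt_image lt_countable) simp
  ultimately obtain k where k: "k \<in> I" "\<forall>j\<in>range K. (j, k) \<in> r" by (rule upper_bound)
  then have kK: "(K q, k) \<in> r" for q by simp
  have ik: "(i, k) \<in> r" "(j, k) \<in> r"
    using K(1)[of 0] kK[of 0] r_trans[of i "K 0" k] r_trans[of j "K 0" k] by simp_all
  have "?f k \<le> delta (i, x) (j, y)"
  proof (rule ccontr)
    assume "\<not> ?f k \<le> delta (i, x) (j, y)"
    then have "delta (i, x) (j, y) < ?f k" by simp
    then obtain q where q: "delta (i, x) (j, y) < ennreal (real_of_rat q)" "ennreal (real_of_rat q) < ?f k"
      by (rule ennreal_rat_between)
    have "?f k \<le> ?f (K q)" using edist_b_decreasing K(1)[of q] kK[of q] assms by simp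
    also have "\<dots> < ennreal (real_of_rat q)" using K(2) q(1) .
    finally show False using q(2) by simp
  qed
  then show thesis using that[OF ik] delta_le[OF ik, of x y] by (simp add: antisym)
qed

text \<open>Joint surjectivity and the formula for distances determine \<open>Q\<close> up to
  isometry. By \<open>colimit_iff_good\<close> this is equivalent to the universal property, and all
  later arguments about colimits use this form.\<close>

definition good_cocone :: "'u emet \<Rightarrow> ('u \<Rightarrow> 'u \<Rightarrow> 'u) \<Rightarrow> bool" where
  "good_cocone Q q \<longleftrightarrow> Q \<in> Obj Met \<and> (\<forall>i\<in>I. q i \<in> nonexp (X i) Q) \<and>
     (\<forall>i j. (i, j) \<in> r \<longrightarrow> (\<forall>x\<in>pts (X i). q j (b i j x) = q i x)) \<and>
     (\<forall>p\<in>pts Q. \<exists>i\<in>I. \<exists>x\<in>pts (X i). p = q i x) \<and>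
     (\<forall>i\<in>I. \<forall>j\<in>I. \<forall>x\<in>pts (X i). \<forall>y\<in>pts (X j). edist Q (q i x) (q j y) = delta (i, x) (j, y))"

lemma good_coconeD:
  assumes "good_cocone Q q"
  shows "Q \<in> Obj Met" "i \<in> I \<Longrightarrow> q i \<in> nonexp (X i) Q"
    "(i, j) \<in> r \<Longrightarrow> x \<in> pts (X i) \<Longrightarrow> q j (b i j x) = q i x"
    "p \<in> pts Q \<Longrightarrow> \<exists>i\<in>I. \<exists>x\<in>pts (X i). p = q i x"
    "i \<in> I \<Longrightarrow> j \<in> I \<Longrightarrow> x \<in> pts (X i) \<Longrightarrow> y \<in> pts (X j) \<Longrightarrow> edist Q (q i x) (q j y) = delta (i, x) (j, y)"
  using assms unfolding good_cocone_def by blast+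

text \<open>At a stage where the infimum is attained, the map of the cocone is nonexpanding.\<close>

lemma cocone_le_delta:
  assumes g: "\<And>i. i \<in> I \<Longrightarrow> g i \<in> nonexp (X i) Y"
    and compat: "\<And>i j x. (i, j) \<in> r \<Longrightarrow> x \<in> pts (X i) \<Longrightarrow> g j (b i j x) = g i x"
    and "i \<in> I" "j \<in> I" "x \<in> pts (X i)" "y \<in> pts (X j)"
  shows "edist Y (g i x) (g j y) \<le> delta (i, x) (j, y)"
proof -
  obtain k where k: "(i, k) \<in> r" "(j, k) \<in> r" "edist (X k) (b i k x) (b j k y) = delta (i, x) (j, y)"
    using delta_attained[OF assms(3-6)] .
  have "edist Y (g i x) (g j y) = edist Y (g k (b i k x)) (g k (b j k y))" using compat k assms by simp
  also have "\<dots> \<le> delta (i, x) (j, y)"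
    using nonexp_le[OF g] b_in[of i k x] b_in[of j k y] k assms r_I by metis
  finally show ?thesis .
qed

lemma delta_self: "i \<in> I \<Longrightarrow> x \<in> pts (X i) \<Longrightarrow> delta (i, x) (i, x) = 0"
  using delta_le[OF r_refl r_refl, of i x x] by (simp add: b_id X_emet edist_self)

lemma delta_sym: "i \<in> I \<Longrightarrow> j \<in> I \<Longrightarrow> x \<in> pts (X i) \<Longrightarrow> y \<in> pts (X j) \<Longrightarrow> delta (i, x) (j, y) = delta (j, y) (i, x)"
  unfolding delta_def by (rule INF_cong) (auto simp: edist_sym X_emet b_in r_I)

lemma delta_tri:
  assumes "i \<in> I" "j \<in> I" "l \<in> I" "x \<in> pts (X i)" "y \<in> pts (X j)" "z \<in> pts (X l)"
  shows "delta (i, x) (l, z) \<le> delta (i, x) (j, y) + delta (j, y) (l, z)"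
proof -
  obtain k1 where k1: "(i, k1) \<in> r" "(j, k1) \<in> r" "edist (X k1) (b i k1 x) (b j k1 y) = delta (i, x) (j, y)"
    using delta_attained assms by blast
  obtain k2 where k2: "(j, k2) \<in> r" "(l, k2) \<in> r" "edist (X k2) (b j k2 y) (b l k2 z) = delta (j, y) (l, z)"
    using delta_attained assms by blast
  obtain k where k: "k \<in> I" "(k1, k) \<in> r" "(k2, k) \<in> r" using upper_bound2 r_I k1 k2 by metis
  have r: "(i, k) \<in> r" "(j, k) \<in> r" "(l, k) \<in> r" using k k1 k2 r_trans by blast+
  have "delta (i, x) (l, z) \<le> edist (X k) (b i k x) (b l k z)" using r delta_le by blast
  also have "\<dots> \<le> edist (X k) (b i k x) (b j k y) + edist (X k) (b j k y) (b l k z)"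
    using r k assms by (intro edist_tri X_emet b_in)
  also have "\<dots> \<le> delta (i, x) (j, y) + delta (j, y) (l, z)"
    unfolding k1(3)[symmetric] k2(3)[symmetric] using k k1 k2 assms by (intro add_mono edist_b_decreasing) auto
  finally show ?thesis .
qed

lemma good_cocone_exists:
  obtains Q q where "good_cocone Q q"
proof -
  have "small TYPE('u) (Sigma I (\<lambda>i. pts (X i)))"
    by (intro small_Sigma small_I Obj_Met_small X_Obj)
  then obtain Q :: "'u emet" and q where Q: "Q \<in> Obj Met" "q ` (Sigma I (\<lambda>i. pts (X i))) = pts Q"
    "\<And>p p'. p \<in> Sigma I (\<lambda>i. pts (X i)) \<Longrightarrow> p' \<in> Sigma I (\<lambda>i. pts (X i)) \<Longrightarrow> edist Q (q p) (q p') = delta p p'"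
    by (rule pseudometric_quotient[where d = delta]) (auto simp: delta_self delta_tri intro: delta_sym)
  define q' where "q' i = (\<lambda>x\<in>pts (X i). q (i, x))" for i
  have q': "q' i x = q (i, x)" if "x \<in> pts (X i)" for i x using that by (simp add: q'_def)
  have in_Q: "q (i, x) \<in> pts Q" if "i \<in> I" "x \<in> pts (X i)" for i x using that Q(2) by blast
  have dist: "edist Q (q' i x) (q' j y) = delta (i, x) (j, y)"
    if "i \<in> I" "j \<in> I" "x \<in> pts (X i)" "y \<in> pts (X j)" for i j x y
    using that Q(3) by (simp add: q')
  have "q' i \<in> nonexp (X i) Q" if i: "i \<in> I" for i
  proof (rule nonexpI)
    show "edist Q (q' i x) (q' i y) \<le> edist (X i) x y" if "x \<in> pts (X i)" "y \<in> pts (X i)" for x y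
      using dist[OF i i that] delta_le[OF r_refl[OF i] r_refl[OF i], of x y] b_id[OF i] that by simp
  qed (auto simp: q'_def in_Q i)
  moreover have "q' j (b i j x) = q' i x" if ij: "(i, j) \<in> r" and x: "x \<in> pts (X i)" for i j x
  proof -
    have "edist Q (q' j (b i j x)) (q' i x) = delta (j, b i j x) (i, x)"
      using ij x r_I by (intro dist b_in) auto
    also have "\<dots> \<le> edist (X j) (b j j (b i j x)) (b i j x)"
      using ij r_I r_refl by (intro delta_le) auto
    also have "\<dots> = 0" using ij x r_I by (simp add: b_id b_in X_emet edist_self)
    finally have "edist Q (q' j (b i j x)) (q' i x) = 0" by simp
    then show ?thesis using ij x r_I in_Q b_in Q(1) by (intro edist_0[of Q]) (auto simp: q' Obj_Met_emet)
  qed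
  moreover have "\<exists>i\<in>I. \<exists>x\<in>pts (X i). p = q' i x" if "p \<in> pts Q" for p
  proof -
    obtain i x where "i \<in> I" "x \<in> pts (X i)" "p = q (i, x)" using \<open>p \<in> pts Q\<close> unfolding Q(2)[symmetric] by auto
    then show ?thesis using q' by metis
  qed
  ultimately have "good_cocone Q q'" using Q(1) dist unfolding good_cocone_def by auto
  then show thesis by (rule that)
qed

text \<open>Where \<open>Q\<close> identifies two points, \<open>delta\<close> vanishes, and then
  \<open>cocone_le_delta\<close> identifies their images in \<open>Y\<close>; the same inequality
  makes the factorization nonexpanding.\<close>

lemma good_cocone_factor:
  assumes Q: "good_cocone Q q" and g: "\<And>i. i \<in> I \<Longrightarrow> g i \<in> nonexp (X i) Y"
    and compat: "\<And>i j x. (i, j) \<in> r \<Longrightarrow> x \<in> pts (X i) \<Longrightarrow> g j (b i j x) = g i x"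
    and Y: "is_emet Y"
  obtains h where "h \<in> nonexp Q Y" "\<And>i x. i \<in> I \<Longrightarrow> x \<in> pts (X i) \<Longrightarrow> h (q i x) = g i x"
proof -
  note D = good_coconeD[OF Q]
  have wd: "g i x = g j y" if "i \<in> I" "j \<in> I" "x \<in> pts (X i)" "y \<in> pts (X j)" "q i x = q j y" for i j x y
  proof (rule edist_0[OF Y])
    have "edist Y (g i x) (g j y) \<le> delta (i, x) (j, y)" by (rule cocone_le_delta[OF g compat]) (use that in auto)
    also have "\<dots> = 0" using D(5)[OF that(1-4)] that D(1) D(2)[of j]
      by (metis Obj_Met_emet edist_self nonexp_in)
    finally show "edist Y (g i x) (g j y) = 0" by simp
  qed (use that g nonexp_in in \<open>fast+\<close>)
  define h where "h = (\<lambda>p\<in>pts Q. let z = (SOME z. fst z \<in> I \<and> snd z \<in> pts (X (fst z)) \<and> p = q (fst z) (snd z)) in g (fst z) (snd z))"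
  have h: "h (q i x) = g i x" if ix: "i \<in> I" "x \<in> pts (X i)" for i x
  proof -
    let ?P = "\<lambda>z. fst z \<in> I \<and> snd z \<in> pts (X (fst z)) \<and> q i x = q (fst z) (snd z)"
    have "?P (SOME z. ?P z)" by (rule someI[of ?P "(i, x)"]) (use ix in simp)
    moreover have "q i x \<in> pts Q" using D(2) ix nonexp_in by fast
    ultimately show ?thesis using wd[of i "fst (SOME z. ?P z)" x "snd (SOME z. ?P z)"] ix
      unfolding h_def by (simp add: Let_def)
  qed
  have "h \<in> nonexp Q Y"
  proof (rule nonexpI)
    show "h p \<in> pts Y" if "p \<in> pts Q" for p using D(4)[OF that] h g nonexp_in by fastforce
    show "edist Y (h p) (h p') \<le> edist Q p p'" if p: "p \<in> pts Q" and p': "p' \<in> pts Q" for p p'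
    proof -
      obtain i x j y where *: "i \<in> I" "x \<in> pts (X i)" "p = q i x" "j \<in> I" "y \<in> pts (X j)" "p' = q j y"
        using D(4)[OF p] D(4)[OF p'] by blast
      then show ?thesis using h D(5) cocone_le_delta[of g Y, OF g compat] by simp
    qed
  qed (simp add: h_def)
  then show thesis using h by (rule that)
qed

text \<open>Fewer than \<open>lam\<close> points have fewer than \<open>lam\<close> pairs. A stage
  above those at which the distances of the pairs are attained lifts the whole family isometrically,
  which reduces operations and equations in the colimit to a single stage.\<close>

lemma good_cocone_lift:
  assumes Q: "good_cocone Q q" and N: "|N| <o lam" and a: "\<And>x. x \<in> N \<Longrightarrow> a x \<in> pts Q"
  obtains k a' where "k \<in> I" "a' \<in> N \<rightarrow>\<^sub>E pts (X k)" "\<And>x. x \<in> N \<Longrightarrow> q k (a' x) = a x"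
    "\<And>x y. x \<in> N \<Longrightarrow> y \<in> N \<Longrightarrow> edist (X k) (a' x) (a' y) = edist Q (a x) (a y)"
proof -
  note D = good_coconeD[OF Q]
  have "\<forall>x\<in>N. \<exists>i z. i \<in> I \<and> z \<in> pts (X i) \<and> a x = q i z" using a D(4) by blast
  then obtain i z where iz: "\<And>x. x \<in> N \<Longrightarrow> i x \<in> I" "\<And>x. x \<in> N \<Longrightarrow> z x \<in> pts (X (i x))"
    "\<And>x. x \<in> N \<Longrightarrow> a x = q (i x) (z x)" by metis
  have "\<forall>x\<in>N. \<forall>y\<in>N. \<exists>k. (i x, k) \<in> r \<and> (i y, k) \<in> r \<and> edist (X k) (b (i x) k (z x)) (b (i y) k (z y)) = edist Q (a x) (a y)"
  proof (intro ballI)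
    fix x y assume "x \<in> N" "y \<in> N"
    then show "\<exists>k. (i x, k) \<in> r \<and> (i y, k) \<in> r \<and> edist (X k) (b (i x) k (z x)) (b (i y) k (z y)) = edist Q (a x) (a y)"
      using delta_attained[of "i x" "i y" "z x" "z y"] iz D(5) by metis
  qed
  then obtain K where K: "\<And>x y. x \<in> N \<Longrightarrow> y \<in> N \<Longrightarrow> (i x, K x y) \<in> r \<and> (i y, K x y) \<in> r \<and>
     edist (X (K x y)) (b (i x) (K x y) (z x)) (b (i y) (K x y) (z y)) = edist Q (a x) (a y)" by metis
  have "(\<lambda>(x, y). K x y) ` (N \<times> N) \<subseteq> I" using K r_I(2) by fast
  moreover have "|(\<lambda>(x, y). K x y) ` (N \<times> N)| <o lam" by (intro lt_image lt_Sigma N)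
  ultimately obtain k where k': "k \<in> I" "\<forall>j\<in>(\<lambda>(x, y). K x y) ` (N \<times> N). (j, k) \<in> r"
    by (rule upper_bound)
  have k: "k \<in> I" "\<And>x y. x \<in> N \<Longrightarrow> y \<in> N \<Longrightarrow> (K x y, k) \<in> r"
    using k' by auto
  have ik: "(i x, k) \<in> r" if "x \<in> N" for x using K[OF that that] k(2)[OF that that] r_trans by blast
  let ?a = "\<lambda>x\<in>N. b (i x) k (z x)"
  show thesis
  proof (rule that[OF k(1)])
    show "?a \<in> N \<rightarrow>\<^sub>E pts (X k)" using ik iz b_in by auto
    show "q k (?a x) = a x" if "x \<in> N" for x using that ik iz D(3) by simp
    show "edist (X k) (?a x) (?a y) = edist Q (a x) (a y)" if x: "x \<in> N" and y: "y \<in> N" for x y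
    proof (rule antisym)
      show "edist (X k) (?a x) (?a y) \<le> edist Q (a x) (a y)"
        using K[OF x y] edist_b_decreasing[of "i x" "K x y" "i y" k "z x" "z y"] k(2)[OF x y] iz x y by simp
      have "q k (?a x) = a x" "q k (?a y) = a y" using x y ik iz D(3) by simp_all
      then show "edist Q (a x) (a y) \<le> edist (X k) (?a x) (?a y)"
        using nonexp_le[OF D(2)[OF k(1)], of "?a x" "?a y"] b_in ik iz x y by simp
    qed
  qed
qed

lemma poset_cat_simps: "Obj (poset_cat I r) = I" "Mor (poset_cat I r) i j = (if (i, j) \<in> r then {()} else {})"
  by (simp_all add: poset_cat_def)

text \<open>That a good cocone is universal follows from \<open>good_cocone_factor\<close>.
  Conversely, a given colimit is compared with a constructed good cocone: the mediating maps are
  nonexpanding in both directions, so the distances agree.\<close>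

lemma colimit_iff_good:
  assumes D: "\<And>i. i \<in> I \<Longrightarrow> fo D i = X i" "\<And>i j. (i, j) \<in> r \<Longrightarrow> fm D i j () = b i j"
  shows "is_colimit (poset_cat I r) Met D Q q \<longleftrightarrow> good_cocone Q q"
proof -
  have cocone: "is_cocone (poset_cat I r) Met D Q q \<longleftrightarrow> Q \<in> Obj Met \<and> (\<forall>i\<in>I. q i \<in> nonexp (X i) Q) \<and>
     (\<forall>i j. (i, j) \<in> r \<longrightarrow> (\<forall>x\<in>pts (X i). q j (b i j x) = q i x))" for Q q
  proof -
    have "compose (pts (X i)) (q j) (b i j) = q i \<longleftrightarrow> (\<forall>x\<in>pts (X i). q j (b i j x) = q i x)"
      if "\<forall>i\<in>I. q i \<in> nonexp (X i) Q" "(i, j) \<in> r" for i j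
    proof
      assume "compose (pts (X i)) (q j) (b i j) = q i"
      then show "\<forall>x\<in>pts (X i). q j (b i j x) = q i x" by (metis compose_eq)
    next
      assume *: "\<forall>x\<in>pts (X i). q j (b i j x) = q i x"
      show "compose (pts (X i)) (q j) (b i j) = q i"
        by (rule nonexp_eqI[OF nonexp_compose[OF b_nonexp]]) (use that r_I * in \<open>auto simp: compose_eq\<close>)
    qed
    then show ?thesis unfolding is_cocone_def poset_cat_simps by (auto simp: D r_I)
  qed
  show ?thesis
  proof
    assume Q: "good_cocone Q q"
    note G = good_coconeD[OF Q]
    show "is_colimit (poset_cat I r) Met D Q q"
      unfolding is_colimit_def
    proof (intro conjI allI impI)
      show "is_cocone (poset_cat I r) Met D Q q" using cocone G by blast
      fix Y g assume "is_cocone (poset_cat I r) Met D Y g"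
      then have Y: "Y \<in> Obj Met" "\<And>i. i \<in> I \<Longrightarrow> g i \<in> nonexp (X i) Y"
        "\<And>i j x. (i, j) \<in> r \<Longrightarrow> x \<in> pts (X i) \<Longrightarrow> g j (b i j x) = g i x" unfolding cocone by blast+
      obtain h where h: "h \<in> nonexp Q Y" "\<And>i x. i \<in> I \<Longrightarrow> x \<in> pts (X i) \<Longrightarrow> h (q i x) = g i x"
        using good_cocone_factor[OF Q Y(2,3) Obj_Met_emet[OF Y(1)]] by blast
      show "\<exists>!h. h \<in> Mor Met Q Y \<and> (\<forall>i\<in>Obj (poset_cat I r). Comp Met (fo D i) Q Y h (q i) = g i)"
      proof (intro ex1I[of _ h] conjI ballI)
        show "h \<in> Mor Met Q Y" using h by simp
        show "Comp Met (fo D i) Q Y h (q i) = g i" if "i \<in> Obj (poset_cat I r)" for i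
        proof -
          have "compose (pts (X i)) h (q i) = g i"
            by (rule nonexp_eqI[OF nonexp_compose[OF G(2) h(1)] Y(2)])
              (use that h in \<open>auto simp: poset_cat_simps compose_eq\<close>)
          then show ?thesis using that D by (simp add: poset_cat_simps)
        qed
        fix h' assume h': "h' \<in> Mor Met Q Y \<and> (\<forall>i\<in>Obj (poset_cat I r). Comp Met (fo D i) Q Y h' (q i) = g i)"
        show "h' = h"
        proof (rule nonexp_eqI)
          fix p assume "p \<in> pts Q"
          then obtain i x where ix: "i \<in> I" "x \<in> pts (X i)" "p = q i x" using G(4) by blast
          then have "compose (pts (X i)) h' (q i) x = g i x" using h' D by (auto simp: poset_cat_simps)
          then show "h' p = h p" using ix h by (simp add: compose_eq)
        qed (use h' h in auto)
      qed
    qed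
  next
    assume c: "is_colimit (poset_cat I r) Met D Q q"
    then have Q: "Q \<in> Obj Met" "\<And>i. i \<in> I \<Longrightarrow> q i \<in> nonexp (X i) Q"
        "\<And>i j x. (i, j) \<in> r \<Longrightarrow> x \<in> pts (X i) \<Longrightarrow> q j (b i j x) = q i x"
      unfolding is_colimit_def cocone by blast+
    obtain P p where P: "good_cocone P p" by (rule good_cocone_exists)
    note G = good_coconeD[OF P]
    obtain h where h: "h \<in> nonexp P Q" "\<And>i x. i \<in> I \<Longrightarrow> x \<in> pts (X i) \<Longrightarrow> h (p i x) = q i x"
      using good_cocone_factor[OF P Q(2,3) Obj_Met_emet[OF Q(1)]] by blast
    have "is_cocone (poset_cat I r) Met D P p" using cocone G by blast
    then obtain k where k: "k \<in> nonexp Q P" "\<forall>i\<in>I. compose (pts (X i)) k (q i) = p i"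
      using c D unfolding is_colimit_def by (auto simp: poset_cat_simps) metis
    have kq: "k (q i x) = p i x" if "i \<in> I" "x \<in> pts (X i)" for i x
      using k(2) that by (metis compose_eq)
    \<comment> \<open>The identity and \<open>h\<close> after \<open>k\<close> both mediate from
      \<open>Q\<close> to itself, so uniqueness identifies them.\<close>
    have "\<exists>!h. h \<in> nonexp Q Q \<and> (\<forall>i\<in>I. compose (pts (X i)) h (q i) = q i)"
      using c D unfolding is_colimit_def by (auto simp: poset_cat_simps)
    moreover have "(\<lambda>x\<in>pts Q. x) \<in> nonexp Q Q \<and> (\<forall>i\<in>I. compose (pts (X i)) (\<lambda>x\<in>pts Q. x) (q i) = q i)"
      using Q by (auto simp: nonexp_ident intro!: compose_ident_left nonexp_PiE)
    moreover have "compose (pts Q) h k \<in> nonexp Q Q \<and> (\<forall>i\<in>I. compose (pts (X i)) (compose (pts Q) h k) (q i) = q i)"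
    proof (intro conjI ballI nonexp_compose[OF k(1) h(1)])
      fix i assume i: "i \<in> I"
      show "compose (pts (X i)) (compose (pts Q) h k) (q i) = q i"
        by (rule nonexp_eqI[OF nonexp_compose[OF Q(2) nonexp_compose[OF k(1) h(1)]] Q(2)])
          (use i in \<open>auto simp: compose_eq nonexp_in[OF Q(2)] kq h\<close>)
    qed
    ultimately have id: "compose (pts Q) h k = (\<lambda>x\<in>pts Q. x)" by metis
    have hk: "h (k z) = z" if "z \<in> pts Q" for z using fun_cong[OF id, of z] that by (simp add: compose_eq)
    show "good_cocone Q q"
      unfolding good_cocone_def
    proof (intro conjI ballI allI impI)
      fix z assume z: "z \<in> pts Q"
      then have "k z \<in> pts P" using k nonexp_in by fast
      then show "\<exists>i\<in>I. \<exists>x\<in>pts (X i). z = q i x" using G(4)[of "k z"] h(2) hk[OF z] by metis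
    next
      fix i j x y assume *: "i \<in> I" "j \<in> I" "x \<in> pts (X i)" "y \<in> pts (X j)"
      show "edist Q (q i x) (q j y) = delta (i, x) (j, y)"
      proof (rule antisym)
        show "edist Q (q i x) (q j y) \<le> delta (i, x) (j, y)" by (rule cocone_le_delta[OF Q(2,3)]) (use * in auto)
        show "delta (i, x) (j, y) \<le> edist Q (q i x) (q j y)"
          using nonexp_le[OF k(1), of "q i x" "q j y"] kq G(5) * nonexp_in[OF Q(2)] by simp
      qed
    qed (use Q in auto)
  qed
qed

end

subsection \<open>Functors and equivalences\<close>

lemma mk_func_simps [simp]:
  "A \<in> Obj C \<Longrightarrow> fo (mk_func C F1 F2) A = F1 A"
  "A \<in> Obj C \<Longrightarrow> B \<in> Obj C \<Longrightarrow> f \<in> Mor C A B \<Longrightarrow> fm (mk_func C F1 F2) A B f = F2 A B f"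
  by (simp_all add: mk_func_def)

lemma mk_func_cong:
  assumes "\<And>A. A \<in> Obj C \<Longrightarrow> F1 A = G1 A"
    and "\<And>A B f. A \<in> Obj C \<Longrightarrow> B \<in> Obj C \<Longrightarrow> f \<in> Mor C A B \<Longrightarrow> F2 A B f = G2 A B f"
  shows "mk_func C F1 F2 = mk_func C G1 G2"
  using assms by (auto simp: mk_func_def fun_eq_iff restrict_def)

lemma mk_func_idem: "mk_func C (fo (mk_func C F1 F2)) (fm (mk_func C F1 F2)) = mk_func C F1 F2"
  by (rule mk_func_cong) simp_all

lemma is_functor_mk_funcI:
  assumes "\<And>A. A \<in> Obj C \<Longrightarrow> F1 A \<in> Obj D"
    and "\<And>A B f. A \<in> Obj C \<Longrightarrow> B \<in> Obj C \<Longrightarrow> f \<in> Mor C A B \<Longrightarrow> F2 A B f \<in> Mor D (F1 A) (F1 B)"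
    and "\<And>A. A \<in> Obj C \<Longrightarrow> Ident C A \<in> Mor C A A"
    and "\<And>A. A \<in> Obj C \<Longrightarrow> F2 A A (Ident C A) = Ident D (F1 A)"
    and "\<And>A B E f g. A \<in> Obj C \<Longrightarrow> B \<in> Obj C \<Longrightarrow> E \<in> Obj C \<Longrightarrow> f \<in> Mor C A B \<Longrightarrow> g \<in> Mor C B E \<Longrightarrow>
      Comp C A B E g f \<in> Mor C A E"
    and "\<And>A B E f g. A \<in> Obj C \<Longrightarrow> B \<in> Obj C \<Longrightarrow> E \<in> Obj C \<Longrightarrow> f \<in> Mor C A B \<Longrightarrow> g \<in> Mor C B E \<Longrightarrow>
      F2 A E (Comp C A B E g f) = Comp D (F1 A) (F1 B) (F1 E) (F2 B E g) (F2 A B f)"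
  shows "is_functor C D (mk_func C F1 F2)"
  unfolding is_functor_def using assms by (simp add: mk_func_idem)

lemma is_functor_eq: "is_functor C D F \<Longrightarrow> F = mk_func C (fo F) (fm F)"
  by (simp add: is_functor_def)

lemma functor_eqI:
  assumes "is_functor C D F" "is_functor C E G" "\<And>A. A \<in> Obj C \<Longrightarrow> fo F A = fo G A"
    and "\<And>A B f. A \<in> Obj C \<Longrightarrow> B \<in> Obj C \<Longrightarrow> f \<in> Mor C A B \<Longrightarrow> fm F A B f = fm G A B f"
  shows "F = G"
  using assms is_functor_eq[OF assms(1)] is_functor_eq[OF assms(2)] mk_func_cong[of C "fo F" "fo G" "fm F" "fm G"] by simp

lemma is_functorD:
  assumes "is_functor C D F"
  shows "A \<in> Obj C \<Longrightarrow> fo F A \<in> Obj D"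
    "A \<in> Obj C \<Longrightarrow> B \<in> Obj C \<Longrightarrow> f \<in> Mor C A B \<Longrightarrow> fm F A B f \<in> Mor D (fo F A) (fo F B)"
    "A \<in> Obj C \<Longrightarrow> fm F A A (Ident C A) = Ident D (fo F A)"
    "A \<in> Obj C \<Longrightarrow> B \<in> Obj C \<Longrightarrow> E \<in> Obj C \<Longrightarrow> f \<in> Mor C A B \<Longrightarrow> g \<in> Mor C B E \<Longrightarrow>
      fm F A E (Comp C A B E g f) = Comp D (fo F A) (fo F B) (fo F E) (fm F B E g) (fm F A B f)"
  using assms unfolding is_functor_def by blast+

lemma is_categoryD:
  assumes "is_category C"
  shows "A \<in> Obj C \<Longrightarrow> Ident C A \<in> Mor C A A"
    "A \<in> Obj C \<Longrightarrow> B \<in> Obj C \<Longrightarrow> D \<in> Obj C \<Longrightarrow> f \<in> Mor C A B \<Longrightarrow> g \<in> Mor C B D \<Longrightarrow> Comp C A B D g f \<in> Mor C A D"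
    "A \<in> Obj C \<Longrightarrow> B \<in> Obj C \<Longrightarrow> f \<in> Mor C A B \<Longrightarrow> Comp C A A B f (Ident C A) = f"
    "A \<in> Obj C \<Longrightarrow> B \<in> Obj C \<Longrightarrow> f \<in> Mor C A B \<Longrightarrow> Comp C A B B (Ident C B) f = f"
    "A \<in> Obj C \<Longrightarrow> B \<in> Obj C \<Longrightarrow> D \<in> Obj C \<Longrightarrow> E \<in> Obj C \<Longrightarrow> f \<in> Mor C A B \<Longrightarrow> g \<in> Mor C B D \<Longrightarrow> h \<in> Mor C D E \<Longrightarrow>
      Comp C A D E h (Comp C A B D g f) = Comp C A B E (Comp C B D E h g) f"
  using assms unfolding is_category_def by blast+

lemma op_cat_simps [simp]:
  "Obj (op_cat C) = Obj C" "Mor (op_cat C) A B = Mor C B A" "Ident (op_cat C) = Ident C"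
  "Comp (op_cat C) A B D g f = Comp C D B A f g"
  by (simp_all add: op_cat_def)

lemma is_category_op_cat: "is_category C \<Longrightarrow> is_category (op_cat C)"
  unfolding is_category_def by simp

text \<open>The quasi-inverse chooses for each \<open>X\<close> an object \<open>g X\<close> with an
  isomorphism \<open>\<epsilon> X\<close> from its image to \<open>X\<close>. It acts on a morphism
  by conjugating with these isomorphisms, which gives \<open>m\<close>, and lifting the result along
  the bijection \<open>ff\<close>. Equations between morphisms of \<open>C\<close> are verified
  after applying the faithful \<open>F\<close>.\<close>

lemma fully_faithful_essentially_surjective_equivalence:
  assumes C: "is_category C" and D: "is_category D" and F: "is_functor C D F"
    and ff: "\<And>A B. A \<in> Obj C \<Longrightarrow> B \<in> Obj C \<Longrightarrow> bij_betw (fm F A B) (Mor C A B) (Mor D (fo F A) (fo F B))"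
    and es: "\<And>X. X \<in> Obj D \<Longrightarrow> \<exists>A\<in>Obj C. \<exists>f. is_iso D (fo F A) X f"
  shows "equivalent_categories C D"
proof -
  note C' = is_categoryD[OF C] and D' = is_categoryD[OF D] and F' = is_functorD[OF F]
  have "\<exists>A e e'. A \<in> Obj C \<and> e \<in> Mor D (fo F A) X \<and> e' \<in> Mor D X (fo F A) \<and>
      Comp D (fo F A) X (fo F A) e' e = Ident D (fo F A) \<and> Comp D X (fo F A) X e e' = Ident D X" if "X \<in> Obj D" for X
    using es[OF that] unfolding is_iso_def by blast
  then obtain g \<epsilon> \<epsilon>' where g: "\<And>X. X \<in> Obj D \<Longrightarrow> g X \<in> Obj C"
    and e: "\<And>X. X \<in> Obj D \<Longrightarrow> \<epsilon> X \<in> Mor D (fo F (g X)) X" "\<And>X. X \<in> Obj D \<Longrightarrow> \<epsilon>' X \<in> Mor D X (fo F (g X))"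
    and ee: "\<And>X. X \<in> Obj D \<Longrightarrow> Comp D (fo F (g X)) X (fo F (g X)) (\<epsilon>' X) (\<epsilon> X) = Ident D (fo F (g X))"
      "\<And>X. X \<in> Obj D \<Longrightarrow> Comp D X (fo F (g X)) X (\<epsilon> X) (\<epsilon>' X) = Ident D X" by metis
  define lift where "lift A B h = inv_into (Mor C A B) (fm F A B) h" for A B h
  have lift: "lift A B h \<in> Mor C A B" "fm F A B (lift A B h) = h"
    if "A \<in> Obj C" "B \<in> Obj C" "h \<in> Mor D (fo F A) (fo F B)" for A B h
    using ff[OF that(1,2)] that(3) unfolding lift_def bij_betw_def by (auto intro: inv_into_into f_inv_into_f)
  have faithful: "h = k" if "A \<in> Obj C" "B \<in> Obj C" "h \<in> Mor C A B" "k \<in> Mor C A B" "fm F A B h = fm F A B k" for A B h k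
    using ff[OF that(1,2)] that(3-) unfolding bij_betw_def inj_on_def by blast
  have Fg: "fo F (g X) \<in> Obj D" if "X \<in> Obj D" for X using that g F' by blast
  define m where "m X Y h = Comp D (fo F (g X)) X (fo F (g Y)) (Comp D X Y (fo F (g Y)) (\<epsilon>' Y) h) (\<epsilon> X)" for X Y h
  have m: "m X Y h \<in> Mor D (fo F (g X)) (fo F (g Y))" if "X \<in> Obj D" "Y \<in> Obj D" "h \<in> Mor D X Y" for X Y h
    unfolding m_def using that e Fg by (intro D'(2)) auto
  have em: "Comp D (fo F (g X)) (fo F (g Y)) Y (\<epsilon> Y) (m X Y h) = Comp D (fo F (g X)) X Y h (\<epsilon> X)"
    if [simp]: "X \<in> Obj D" "Y \<in> Obj D" "h \<in> Mor D X Y" for X Y h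
  proof -
    have k: "Comp D X Y (fo F (g Y)) (\<epsilon>' Y) h \<in> Mor D X (fo F (g Y))" by (intro D'(2)) (auto simp: e Fg)
    have "Comp D (fo F (g X)) (fo F (g Y)) Y (\<epsilon> Y) (m X Y h) =
       Comp D (fo F (g X)) X Y (Comp D X (fo F (g Y)) Y (\<epsilon> Y) (Comp D X Y (fo F (g Y)) (\<epsilon>' Y) h)) (\<epsilon> X)"
      unfolding m_def by (rule D'(5)) (auto simp: e Fg k)
    also have "Comp D X (fo F (g Y)) Y (\<epsilon> Y) (Comp D X Y (fo F (g Y)) (\<epsilon>' Y) h) = Comp D X Y Y (Comp D Y (fo F (g Y)) Y (\<epsilon> Y) (\<epsilon>' Y)) h"
      by (rule D'(5)) (auto simp: e Fg)
    also have "\<dots> = h" by (simp add: ee D')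
    finally show ?thesis .
  qed
  \<comment> \<open>\<open>\<epsilon> X\<close> is monic because \<open>\<epsilon>' X\<close>
    inverts it. With \<open>em\<close>, which says that \<open>\<epsilon>\<close> is natural, this
    gives functoriality of \<open>m\<close>.\<close>
  have cancel: "k = k'" if [simp]: "X \<in> Obj D" "Y \<in> Obj D" and k: "k \<in> Mor D Y (fo F (g X))" "k' \<in> Mor D Y (fo F (g X))"
    and eq: "Comp D Y (fo F (g X)) X (\<epsilon> X) k = Comp D Y (fo F (g X)) X (\<epsilon> X) k'" for X Y k k'
  proof -
    have *: "k = Comp D Y X (fo F (g X)) (\<epsilon>' X) (Comp D Y (fo F (g X)) X (\<epsilon> X) k)" if "k \<in> Mor D Y (fo F (g X))" for k
    proof -
      have "Comp D Y X (fo F (g X)) (\<epsilon>' X) (Comp D Y (fo F (g X)) X (\<epsilon> X) k) =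
         Comp D Y (fo F (g X)) (fo F (g X)) (Comp D (fo F (g X)) X (fo F (g X)) (\<epsilon>' X) (\<epsilon> X)) k"
        by (rule D'(5)) (auto simp: e Fg that)
      then show ?thesis by (simp add: ee D' Fg that)
    qed
    from *[OF k(1)] *[OF k(2)] eq show ?thesis by simp
  qed
  define G where "G = mk_func D g (\<lambda>X Y h. lift (g X) (g Y) (m X Y h))"
  have G: "fo G X = g X" if "X \<in> Obj D" for X using that by (simp add: G_def)
  have Gm: "fm G X Y h = lift (g X) (g Y) (m X Y h)" if "X \<in> Obj D" "Y \<in> Obj D" "h \<in> Mor D X Y" for X Y h
    using that by (simp add: G_def)
  have FG: "fm F (g X) (g Y) (lift (g X) (g Y) (m X Y h)) = m X Y h"
    if "X \<in> Obj D" "Y \<in> Obj D" "h \<in> Mor D X Y" for X Y h using lift m that g by blast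
  have Gfun: "is_functor D C G"
    unfolding G_def
  proof (rule is_functor_mk_funcI)
    fix X assume X: "X \<in> Obj D"
    have I: "Ident D X \<in> Mor D X X" using X by (rule D'(1))
    show "lift (g X) (g X) (m X X (Ident D X)) = Ident C (g X)"
    proof (rule faithful[OF g[OF X] g[OF X] lift(1)[OF g[OF X] g[OF X] m[OF X X I]] C'(1)[OF g[OF X]]])
      show "fm F (g X) (g X) (lift (g X) (g X) (m X X (Ident D X))) = fm F (g X) (g X) (Ident C (g X))"
        using X g D'(3)[OF X Fg[OF X] e(2)[OF X]] by (simp add: FG D' F') (simp add: m_def ee)
    qed
  next
    fix X Y Z h k assume a [simp]: "X \<in> Obj D" "Y \<in> Obj D" "Z \<in> Obj D" and h: "h \<in> Mor D X Y" "k \<in> Mor D Y Z"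
    have hk: "Comp D X Y Z k h \<in> Mor D X Z" using h by (intro D'(2)) auto
    show "lift (g X) (g Z) (m X Z (Comp D X Y Z k h)) =
       Comp C (g X) (g Y) (g Z) (lift (g Y) (g Z) (m Y Z k)) (lift (g X) (g Y) (m X Y h))"
    proof (rule faithful)
      have mm: "Comp D (fo F (g X)) (fo F (g Y)) (fo F (g Z)) (m Y Z k) (m X Y h) \<in> Mor D (fo F (g X)) (fo F (g Z))"
        using h by (intro D'(2) m) (auto simp: Fg)
      have eq1: "m X Z (Comp D X Y Z k h) = Comp D (fo F (g X)) (fo F (g Y)) (fo F (g Z)) (m Y Z k) (m X Y h)"
      proof (rule cancel[OF a(3) Fg[OF a(1)] m[OF a(1,3) hk] mm])
        have "Comp D (fo F (g X)) (fo F (g Z)) Z (\<epsilon> Z) (Comp D (fo F (g X)) (fo F (g Y)) (fo F (g Z)) (m Y Z k) (m X Y h)) =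
          Comp D (fo F (g X)) (fo F (g Y)) Z (Comp D (fo F (g Y)) (fo F (g Z)) Z (\<epsilon> Z) (m Y Z k)) (m X Y h)"
          using h by (intro D'(5)) (auto simp: Fg m e)
        also have "\<dots> = Comp D (fo F (g X)) (fo F (g Y)) Z (Comp D (fo F (g Y)) Y Z k (\<epsilon> Y)) (m X Y h)"
          using h by (simp add: em)
        also have "\<dots> = Comp D (fo F (g X)) Y Z k (Comp D (fo F (g X)) (fo F (g Y)) Y (\<epsilon> Y) (m X Y h))"
          using h by (intro D'(5)[symmetric]) (auto simp: Fg m e)
        also have "\<dots> = Comp D (fo F (g X)) Y Z k (Comp D (fo F (g X)) X Y h (\<epsilon> X))" using h by (simp add: em)
        also have "\<dots> = Comp D (fo F (g X)) X Z (Comp D X Y Z k h) (\<epsilon> X)"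
          using h by (intro D'(5)) (auto simp: Fg e)
        finally show "Comp D (fo F (g X)) (fo F (g Z)) Z (\<epsilon> Z) (m X Z (Comp D X Y Z k h)) =
           Comp D (fo F (g X)) (fo F (g Z)) Z (\<epsilon> Z) (Comp D (fo F (g X)) (fo F (g Y)) (fo F (g Z)) (m Y Z k) (m X Y h))"
          using em[OF a(1,3) hk] by simp
      qed
      have eq2: "fm F (g X) (g Z) (Comp C (g X) (g Y) (g Z) (lift (g Y) (g Z) (m Y Z k)) (lift (g X) (g Y) (m X Y h))) =
         Comp D (fo F (g X)) (fo F (g Y)) (fo F (g Z)) (m Y Z k) (m X Y h)"
        using h lift(1) m g by (subst F'(4)) (auto simp: FG)
      show "fm F (g X) (g Z) (lift (g X) (g Z) (m X Z (Comp D X Y Z k h))) =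
         fm F (g X) (g Z) (Comp C (g X) (g Y) (g Z) (lift (g Y) (g Z) (m Y Z k)) (lift (g X) (g Y) (m X Y h)))"
        unfolding FG[OF a(1,3) hk] unfolding eq1 eq2 ..
      show "Comp C (g X) (g Y) (g Z) (lift (g Y) (g Z) (m Y Z k)) (lift (g X) (g Y) (m X Y h)) \<in> Mor C (g X) (g Z)"
        using h lift(1) m g by (intro C'(2)) auto
    qed (use hk h g lift(1) m in auto)
  qed (use g lift(1) m D' in auto)
  have FG_iso: "naturally_isomorphic D D (comp_func D F G) (id_func D)"
    unfolding naturally_isomorphic_def
  proof (intro bexI ballI)
    show "(\<lambda>X\<in>Obj D. \<epsilon> X) \<in> nat_trans D D (comp_func D F G) (id_func D)"
      unfolding nat_trans_def by (auto simp: comp_func_def id_func_def G Gm FG em e)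
    fix X assume "X \<in> Obj D"
    then show "is_iso D (fo (comp_func D F G) X) (fo (id_func D) X) ((\<lambda>X\<in>Obj D. \<epsilon> X) X)"
      unfolding is_iso_def using e ee by (auto simp: comp_func_def id_func_def G intro!: bexI[of _ "\<epsilon>' X"])
  qed
  \<comment> \<open>The component at \<open>A\<close> of the isomorphism from the composite on
    \<open>C\<close> to the identity is the morphism that \<open>F\<close> sends to
    \<open>\<epsilon>\<close> at the image of \<open>A\<close>.\<close>
  define \<eta> where "\<eta> = (\<lambda>A\<in>Obj C. lift (g (fo F A)) A (\<epsilon> (fo F A)))"
  have eta: "\<eta> A \<in> Mor C (g (fo F A)) A" "fm F (g (fo F A)) A (\<eta> A) = \<epsilon> (fo F A)" if "A \<in> Obj C" for A
    using that by (auto simp: \<eta>_def lift e F' g)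
  have GF_iso: "naturally_isomorphic C C (comp_func C G F) (id_func C)"
    unfolding naturally_isomorphic_def
  proof (intro bexI[of _ \<eta>] ballI)
    have "Comp C (g (fo F A)) (g (fo F B)) B (\<eta> B) (lift (g (fo F A)) (g (fo F B)) (m (fo F A) (fo F B) (fm F A B f))) =
       Comp C (g (fo F A)) A B f (\<eta> A)" if [simp]: "A \<in> Obj C" "B \<in> Obj C" and f: "f \<in> Mor C A B" for A B f
    proof -
      have Ff: "fm F A B f \<in> Mor D (fo F A) (fo F B)" "fo F A \<in> Obj D" "fo F B \<in> Obj D" using f F' by auto
      have l: "lift (g (fo F A)) (g (fo F B)) (m (fo F A) (fo F B) (fm F A B f)) \<in> Mor C (g (fo F A)) (g (fo F B))"
        using Ff by (intro lift m g)
      show ?thesis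
      proof (rule faithful)
        have "fm F (g (fo F A)) B (Comp C (g (fo F A)) (g (fo F B)) B (\<eta> B) (lift (g (fo F A)) (g (fo F B)) (m (fo F A) (fo F B) (fm F A B f))))
          = Comp D (fo F (g (fo F A))) (fo F (g (fo F B))) (fo F B) (\<epsilon> (fo F B)) (m (fo F A) (fo F B) (fm F A B f))"
          using Ff l eta by (subst F'(4)) (auto simp: FG g)
        also have "\<dots> = Comp D (fo F (g (fo F A))) (fo F A) (fo F B) (fm F A B f) (\<epsilon> (fo F A))"
          using Ff by (simp add: em)
        also have "\<dots> = fm F (g (fo F A)) B (Comp C (g (fo F A)) A B f (\<eta> A))"
          using Ff eta f by (subst F'(4)) (auto simp: g)
        finally show "fm F (g (fo F A)) B (Comp C (g (fo F A)) (g (fo F B)) B (\<eta> B) (lift (g (fo F A)) (g (fo F B)) (m (fo F A) (fo F B) (fm F A B f))))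
          = fm F (g (fo F A)) B (Comp C (g (fo F A)) A B f (\<eta> A))" .
      qed (use Ff f l eta g C'(2) in auto)
    qed
    then show "\<eta> \<in> nat_trans C C (comp_func C G F) (id_func C)"
      unfolding nat_trans_def by (auto simp: comp_func_def id_func_def G Gm F' eta) (simp add: \<eta>_def)
    fix A assume A [simp]: "A \<in> Obj C"
    have FA [simp]: "fo F A \<in> Obj D" "fo F (g (fo F A)) \<in> Obj D" "g (fo F A) \<in> Obj C" by (auto simp: F' g)
    define k where "k = lift A (g (fo F A)) (\<epsilon>' (fo F A))"
    have k: "k \<in> Mor C A (g (fo F A))" "fm F A (g (fo F A)) k = \<epsilon>' (fo F A)" by (auto simp: k_def lift e)
    have "Comp C (g (fo F A)) A (g (fo F A)) k (\<eta> A) = Ident C (g (fo F A))"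
    proof (rule faithful)
      have "fm F (g (fo F A)) (g (fo F A)) (Comp C (g (fo F A)) A (g (fo F A)) k (\<eta> A)) = Ident D (fo F (g (fo F A)))"
        using k eta by (subst F'(4)) (auto simp: ee)
      then show "fm F (g (fo F A)) (g (fo F A)) (Comp C (g (fo F A)) A (g (fo F A)) k (\<eta> A)) = fm F (g (fo F A)) (g (fo F A)) (Ident C (g (fo F A)))"
        by (simp add: F')
    qed (use k eta C' in auto)
    moreover have "Comp C A (g (fo F A)) A (\<eta> A) k = Ident C A"
    proof (rule faithful)
      have "fm F A A (Comp C A (g (fo F A)) A (\<eta> A) k) = Ident D (fo F A)"
        using k eta by (subst F'(4)) (auto simp: ee)
      then show "fm F A A (Comp C A (g (fo F A)) A (\<eta> A) k) = fm F A A (Ident C A)" by (simp add: F')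
    qed (use k eta C' in auto)
    ultimately show "is_iso C (fo (comp_func C G F) A) (fo (id_func C) A) (\<eta> A)"
      unfolding is_iso_def using k eta by (auto simp: comp_func_def id_func_def G)
  qed
  show ?thesis unfolding equivalent_categories_def using C D F Gfun FG_iso GF_iso by blast
qed

subsection \<open>Free algebras in a variety\<close>

lemma qalg_interp_in:
  assumes "is_qalg lam S A" "\<sigma> \<in> syms S" "a \<in> args lam S \<sigma> \<rightarrow>\<^sub>E pts (qspace A)"
  shows "interp A \<sigma> a \<in> pts (qspace A)"
proof -
  have "interp A \<sigma> \<in> nonexp (power_space (args lam S \<sigma>) (qspace A)) (qspace A)"
    using assms(1,2) by (simp add: is_qalg_def)
  then show ?thesis using assms(3) by (intro nonexp_in[of "interp A \<sigma>"]) (auto simp: power_space_def)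
qed

lemma qalg_interp_le:
  assumes "is_qalg lam S A" "\<sigma> \<in> syms S"
    and "a \<in> args lam S \<sigma> \<rightarrow>\<^sub>E pts (qspace A)" "b \<in> args lam S \<sigma> \<rightarrow>\<^sub>E pts (qspace A)"
  shows "edist (qspace A) (interp A \<sigma> a) (interp A \<sigma> b) \<le> (SUP i\<in>args lam S \<sigma>. edist (qspace A) (a i) (b i))"
proof -
  have "interp A \<sigma> \<in> nonexp (power_space (args lam S \<sigma>) (qspace A)) (qspace A)"
    using assms(1,2) by (simp add: is_qalg_def)
  from nonexp_le[OF this, of a b] assms(3,4) show ?thesis by (simp add: power_space_def)
qed

lemma is_qalgI:
  assumes "is_emet Q"
    and "\<And>\<sigma> a. \<sigma> \<in> syms S \<Longrightarrow> a \<in> args lam S \<sigma> \<rightarrow>\<^sub>E pts Q \<Longrightarrow> g \<sigma> a \<in> pts Q"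
    and "\<And>\<sigma> a b. \<sigma> \<in> syms S \<Longrightarrow> a \<in> args lam S \<sigma> \<rightarrow>\<^sub>E pts Q \<Longrightarrow> b \<in> args lam S \<sigma> \<rightarrow>\<^sub>E pts Q \<Longrightarrow>
      edist Q (g \<sigma> a) (g \<sigma> b) \<le> (SUP i\<in>args lam S \<sigma>. edist Q (a i) (b i))"
  shows "is_qalg lam S \<lparr>qspace = Q, interp = (\<lambda>\<sigma>\<in>syms S. \<lambda>a\<in>args lam S \<sigma> \<rightarrow>\<^sub>E pts Q. g \<sigma> a)\<rparr>"
  unfolding is_qalg_def
proof (intro conjI ballI)
  fix \<sigma> assume \<sigma>: "\<sigma> \<in> syms S"
  have "(\<lambda>a\<in>args lam S \<sigma> \<rightarrow>\<^sub>E pts Q. g \<sigma> a) \<in> nonexp (power_space (args lam S \<sigma>) Q) Q"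
    using assms(2,3)[OF \<sigma>] by (intro nonexpI) (simp_all add: power_space_def)
  with \<sigma> show "interp \<lparr>qspace = Q, interp = (\<lambda>\<sigma>\<in>syms S. \<lambda>a\<in>args lam S \<sigma> \<rightarrow>\<^sub>E pts Q. g \<sigma> a)\<rparr> \<sigma>
    \<in> nonexp (power_space (args lam S \<sigma>) (qspace \<lparr>qspace = Q, interp = (\<lambda>\<sigma>\<in>syms S. \<lambda>a\<in>args lam S \<sigma> \<rightarrow>\<^sub>E pts Q. g \<sigma> a)\<rparr>))
      (qspace \<lparr>qspace = Q, interp = (\<lambda>\<sigma>\<in>syms S. \<lambda>a\<in>args lam S \<sigma> \<rightarrow>\<^sub>E pts Q. g \<sigma> a)\<rparr>)"
    by simp
qed (simp_all add: assms(1))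

lemma qalg_eqI:
  assumes A: "is_qalg lam S A" and B: "is_qalg lam S B" and "qspace A = qspace B"
    and "\<And>\<sigma> a. \<sigma> \<in> syms S \<Longrightarrow> a \<in> args lam S \<sigma> \<rightarrow>\<^sub>E pts (qspace A) \<Longrightarrow> interp A \<sigma> a = interp B \<sigma> a"
  shows "A = B"
proof -
  have "interp A \<sigma> = interp B \<sigma>" if \<sigma>: "\<sigma> \<in> syms S" for \<sigma>
  proof (rule nonexp_eqI)
    show "interp A \<sigma> \<in> nonexp (power_space (args lam S \<sigma>) (qspace A)) (qspace A)"
      "interp B \<sigma> \<in> nonexp (power_space (args lam S \<sigma>) (qspace A)) (qspace B)"
      using A B \<sigma> assms(3) by (simp_all add: is_qalg_def)
  qed (use assms(4) \<sigma> in \<open>simp add: power_space_def\<close>)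
  then have "interp A = interp B"
    using A B by (intro extensionalityI[of _ "syms S"]) (simp_all add: is_qalg_def)
  with assms(3) show ?thesis by simp
qed

lemma qalg_homI:
  assumes "f \<in> nonexp (qspace A) (qspace B)"
    and "\<And>\<sigma> a. \<sigma> \<in> syms S \<Longrightarrow> a \<in> args lam S \<sigma> \<rightarrow>\<^sub>E pts (qspace A) \<Longrightarrow>
       f (interp A \<sigma> a) = interp B \<sigma> (\<lambda>i\<in>args lam S \<sigma>. f (a i))"
  shows "f \<in> qalg_hom lam S A B"
  using assms by (simp add: qalg_hom_def)

lemma qalg_hom_nonexp: "f \<in> qalg_hom lam S A B \<Longrightarrow> f \<in> nonexp (qspace A) (qspace B)"
  by (simp add: qalg_hom_def)

lemma qalg_hom_interp:
  "f \<in> qalg_hom lam S A B \<Longrightarrow> \<sigma> \<in> syms S \<Longrightarrow> a \<in> args lam S \<sigma> \<rightarrow>\<^sub>E pts (qspace A) \<Longrightarrow>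
    f (interp A \<sigma> a) = interp B \<sigma> (\<lambda>i\<in>args lam S \<sigma>. f (a i))"
  by (simp add: qalg_hom_def)

lemma qalg_hom_in: "f \<in> qalg_hom lam S A B \<Longrightarrow> x \<in> pts (qspace A) \<Longrightarrow> f x \<in> pts (qspace B)"
  by (meson qalg_hom_nonexp nonexp_in)

lemma qalg_hom_compose:
  assumes f: "f \<in> qalg_hom lam S A B" and g: "g \<in> qalg_hom lam S B C" and A: "is_qalg lam S A"
  shows "compose (pts (qspace A)) g f \<in> qalg_hom lam S A C"
proof (rule qalg_homI)
  show "compose (pts (qspace A)) g f \<in> nonexp (qspace A) (qspace C)"
    using f g by (meson nonexp_compose qalg_hom_nonexp)
  fix \<sigma> a assume \<sigma>: "\<sigma> \<in> syms S" and a: "a \<in> args lam S \<sigma> \<rightarrow>\<^sub>E pts (qspace A)"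
  have "(\<lambda>i\<in>args lam S \<sigma>. f (a i)) \<in> args lam S \<sigma> \<rightarrow>\<^sub>E pts (qspace B)"
    using a qalg_hom_in[OF f] by auto
  then have "g (f (interp A \<sigma> a)) = interp C \<sigma> (\<lambda>i\<in>args lam S \<sigma>. g ((\<lambda>i\<in>args lam S \<sigma>. f (a i)) i))"
    using qalg_hom_interp[OF f \<sigma> a] qalg_hom_interp[OF g \<sigma>] by simp
  also have "(\<lambda>i\<in>args lam S \<sigma>. g ((\<lambda>i\<in>args lam S \<sigma>. f (a i)) i)) = (\<lambda>i\<in>args lam S \<sigma>. compose (pts (qspace A)) g f (a i))"
    by (intro restrict_ext) (simp add: compose_eq PiE_mem[OF a])
  finally show "compose (pts (qspace A)) g f (interp A \<sigma> a) = interp C \<sigma> (\<lambda>i\<in>args lam S \<sigma>. compose (pts (qspace A)) g f (a i))"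
    unfolding compose_eq[OF qalg_interp_in[OF A \<sigma> a]] .
qed

lemma qalg_hom_ident: "is_qalg lam S A \<Longrightarrow> (\<lambda>x\<in>pts (qspace A). x) \<in> qalg_hom lam S A A"
proof (rule qalg_homI[OF nonexp_ident])
  fix \<sigma> a assume A: "is_qalg lam S A" and \<sigma>: "\<sigma> \<in> syms S" and a: "a \<in> args lam S \<sigma> \<rightarrow>\<^sub>E pts (qspace A)"
  have "(\<lambda>i\<in>args lam S \<sigma>. (\<lambda>x\<in>pts (qspace A). x) (a i)) = a"
    using a by (intro extensionalityI[of _ "args lam S \<sigma>"]) (auto simp: PiE_def)
  then show "(\<lambda>x\<in>pts (qspace A). x) (interp A \<sigma> a) = interp A \<sigma> (\<lambda>i\<in>args lam S \<sigma>. (\<lambda>x\<in>pts (qspace A). x) (a i))"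
    using qalg_interp_in[OF A \<sigma> a] by simp
qed

lemma term_ext_cong: "(\<And>x. x \<in> X \<Longrightarrow> f x = g x) \<Longrightarrow> t \<in> terms lam S X \<Longrightarrow> term_ext lam S A f t = term_ext lam S A g t"
proof (induction t rule: trm.induct)
  case (Var x) then show ?case by (auto elim: terms.cases)
next
  case (Op \<sigma> t)
  from Op.prems(2) have "t i \<in> terms lam S X" if "i \<in> args lam S \<sigma>" for i using that by cases auto
  then have "term_ext lam S A f (t i) = term_ext lam S A g (t i)" if "i \<in> args lam S \<sigma>" for i
    using that Op by blast
  then have "(\<lambda>i\<in>args lam S \<sigma>. term_ext lam S A f (t i)) = (\<lambda>i\<in>args lam S \<sigma>. term_ext lam S A g (t i))"
    by (intro restrict_ext) simp
  then show ?case unfolding term_ext.simps by simp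
qed

lemma term_ext_in:
  assumes A: "is_qalg lam S A" and f: "\<And>x. x \<in> X \<Longrightarrow> f x \<in> pts (qspace A)" and "t \<in> terms lam S X"
  shows "term_ext lam S A f t \<in> pts (qspace A)"
  using assms(3)
proof induction
  case (Var x) then show ?case using f by simp
next
  case (Op \<sigma> t)
  then have "(\<lambda>i\<in>args lam S \<sigma>. term_ext lam S A f (t i)) \<in> args lam S \<sigma> \<rightarrow>\<^sub>E pts (qspace A)" by auto
  then show ?case unfolding term_ext.simps using A Op.hyps(1) by (intro qalg_interp_in)
qed

lemma hom_term_ext:
  assumes h: "h \<in> qalg_hom lam S A B" and A: "is_qalg lam S A" and f: "\<And>x. x \<in> X \<Longrightarrow> f x \<in> pts (qspace A)"
    and "t \<in> terms lam S X"
  shows "h (term_ext lam S A f t) = term_ext lam S B (\<lambda>x. h (f x)) t"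
  using assms(4)
proof induction
  case (Var x) then show ?case by simp
next
  case (Op \<sigma> t)
  have a: "(\<lambda>i\<in>args lam S \<sigma>. term_ext lam S A f (t i)) \<in> args lam S \<sigma> \<rightarrow>\<^sub>E pts (qspace A)"
    using Op.hyps(2) by (auto intro: term_ext_in[OF A, of X] f)
  have "h (term_ext lam S A f (Op \<sigma> t)) = interp B \<sigma> (\<lambda>i\<in>args lam S \<sigma>. h ((\<lambda>i\<in>args lam S \<sigma>. term_ext lam S A f (t i)) i))"
    unfolding term_ext.simps by (rule qalg_hom_interp[OF h Op.hyps(1) a])
  also have "(\<lambda>i\<in>args lam S \<sigma>. h ((\<lambda>i\<in>args lam S \<sigma>. term_ext lam S A f (t i)) i)) = (\<lambda>i\<in>args lam S \<sigma>. term_ext lam S B (\<lambda>x. h (f x)) (t i))"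
    using Op.IH by (intro restrict_ext) simp
  finally show ?case unfolding term_ext.simps .
qed

text \<open>The clause on \<open>P\<close> says that the algebra is generated by the image of the
  unit. It takes the place of uniqueness of extensions, which follows from it in
  \<open>free_on_hom_eq\<close>, and it also supports inductions on elements that concern images and
  distances.\<close>

definition free_on :: "'u rel \<Rightarrow> 'u variety \<Rightarrow> 'u emet \<Rightarrow> ('u, 'u) qalg \<Rightarrow> ('u \<Rightarrow> 'u) \<Rightarrow> bool" where
  "free_on lam V M A \<eta> \<longleftrightarrow> A \<in> algs V \<and> \<eta> \<in> nonexp M (qspace A) \<and>
     (\<forall>P. (\<forall>x\<in>pts M. P (\<eta> x)) \<longrightarrow>
        (\<forall>\<sigma>\<in>syms (sig V). \<forall>a\<in>args lam (sig V) \<sigma> \<rightarrow>\<^sub>E pts (qspace A).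
           (\<forall>i\<in>args lam (sig V) \<sigma>. P (a i)) \<longrightarrow> P (interp A \<sigma> a)) \<longrightarrow> (\<forall>p\<in>pts (qspace A). P p)) \<and>
     (\<forall>B\<in>algs V. \<forall>f\<in>nonexp M (qspace B). \<exists>h\<in>qalg_hom lam (sig V) A B. \<forall>x\<in>pts M. h (\<eta> x) = f x)"

lemma free_onD:
  assumes "free_on lam V M A \<eta>"
  shows "A \<in> algs V" "\<eta> \<in> nonexp M (qspace A)"
    "B \<in> algs V \<Longrightarrow> f \<in> nonexp M (qspace B) \<Longrightarrow> \<exists>h\<in>qalg_hom lam (sig V) A B. \<forall>x\<in>pts M. h (\<eta> x) = f x"
  using assms unfolding free_on_def by simp_all

lemma free_on_induct [consumes 2, case_names gen op]:
  assumes "free_on lam V M A \<eta>" "p \<in> pts (qspace A)" "\<And>x. x \<in> pts M \<Longrightarrow> P (\<eta> x)"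
    "\<And>\<sigma> a. \<sigma> \<in> syms (sig V) \<Longrightarrow> a \<in> args lam (sig V) \<sigma> \<rightarrow>\<^sub>E pts (qspace A) \<Longrightarrow>
      (\<And>i. i \<in> args lam (sig V) \<sigma> \<Longrightarrow> P (a i)) \<Longrightarrow> P (interp A \<sigma> a)"
  shows "P p"
proof -
  have "(\<forall>x\<in>pts M. P (\<eta> x)) \<longrightarrow>
        (\<forall>\<sigma>\<in>syms (sig V). \<forall>a\<in>args lam (sig V) \<sigma> \<rightarrow>\<^sub>E pts (qspace A).
           (\<forall>i\<in>args lam (sig V) \<sigma>. P (a i)) \<longrightarrow> P (interp A \<sigma> a)) \<longrightarrow> (\<forall>p\<in>pts (qspace A). P p)"
    using assms(1) unfolding free_on_def by blast
  then show ?thesis using assms(2-4) by blast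
qed

lemma free_on_hom_eq:
  assumes "free_on lam V M A \<eta>" and h: "h \<in> qalg_hom lam (sig V) A B" and k: "k \<in> qalg_hom lam (sig V) A B"
    and eq: "\<And>x. x \<in> pts M \<Longrightarrow> h (\<eta> x) = k (\<eta> x)" and p: "p \<in> pts (qspace A)"
  shows "h p = k p"
  using assms(1) p
proof (induction p rule: free_on_induct)
  case (op \<sigma> a)
  then have "(\<lambda>i\<in>args lam (sig V) \<sigma>. h (a i)) = (\<lambda>i\<in>args lam (sig V) \<sigma>. k (a i))" by auto
  then show ?case using op qalg_hom_interp[OF h] qalg_hom_interp[OF k] by simp
qed (use eq in auto)

section \<open>Smallness of the terms, membership in a variety, and existence of free
  algebras\<close>

context cardinal_universe
begin

text \<open>By regularity \<open>K\<close> is not cofinal. As cofinality refers to strict upper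
  bounds, its failure bounds \<open>K\<close> only weakly by some \<open>a\<close>; an infinite
  cardinal has no last element, so one can go past \<open>a\<close>.\<close>

lemma lt_bounded:
  assumes "K \<subseteq> Field lam" "|K| <o lam"
  obtains m where "m \<in> Field lam" "K \<subseteq> underS lam m"
proof -
  have "\<not> |K| =o lam" using assms(2) by (meson not_ordLess_ordIso)
  then have "\<not> cofinal K lam" using lam_regularCard assms(1) unfolding regularCard_def by blast
  then obtain a where a: "a \<in> Field lam" "\<And>b. b \<in> K \<Longrightarrow> a = b \<or> (a, b) \<notin> lam" unfolding cofinal_def by blast
  obtain m where m: "m \<in> Field lam" "a \<noteq> m" "(a, m) \<in> lam"
    using infinite_Card_order_limit[OF lam_Card_order lam_infinite a(1)] by blast
  have lin: "refl_on (Field lam) lam" "trans lam" "antisym lam" "total_on (Field lam) lam"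
    using lam_Well_order by (auto simp: order_on_defs)
  have "K \<subseteq> underS lam m"
  proof
    fix b assume b: "b \<in> K"
    then have "b \<in> Field lam" using assms(1) by auto
    then have "(b, a) \<in> lam" using a(1) a(2)[OF b] lin(1,4) unfolding refl_on_def total_on_def by metis
    then have "(b, m) \<in> lam" "b \<noteq> m" using m lin unfolding trans_def antisym_def by blast+
    then show "b \<in> underS lam m" by (simp add: underS_def)
  qed
  with m(1) show thesis by (rule that)
qed

lemma signature_arity_lt: "is_signature lam S \<Longrightarrow> \<sigma> \<in> syms S \<Longrightarrow> |args lam S \<sigma>| <o lam"
  by (simp add: is_signature_def cardinal_below_lt)

text \<open>By regularity, the terms are exhausted by stages \<open>W i\<close> indexed by the elements \<open>i\<close> of \<open>lam\<close>.\<close>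

lemma small_terms:
  fixes X :: "'v set"
  assumes S: "is_signature lam S" and X: "small TYPE('u) X"
  shows "small TYPE('u) (terms lam S X)"
proof -
  define H :: "('u \<Rightarrow> ('u, 'v) trm set) \<Rightarrow> 'u \<Rightarrow> ('u, 'v) trm set" where
    "H W i = Var ` X \<union> (\<Union>\<sigma>\<in>syms S. Op \<sigma> ` (args lam S \<sigma> \<rightarrow>\<^sub>E (\<Union>j\<in>underS lam i. W j)))" for W i
  define W where "W = wfrec (lam - Id) H"
  have wf: "wf (lam - Id)" using lam_Well_order by (simp add: well_order_on_def)
  have W: "W i = H W i" for i
  proof -
    have "(\<Union>j\<in>underS lam i. cut W (lam - Id) i j) = (\<Union>j\<in>underS lam i. W j)"
      by (rule SUP_cong) (auto simp: cut_def underS_def)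
    then show ?thesis using wfrec[OF wf, of H i] unfolding W_def[symmetric] by (simp add: H_def)
  qed
  have "small TYPE('u) (W i)" for i
    using wf
  proof (induction i rule: wf_induct_rule)
    case (less i)
    have "underS lam i \<subseteq> Field lam" by (auto simp: underS_def Field_def)
    then have *: "small TYPE('u) (\<Union>j\<in>underS lam i. W j)"
      using less by (intro small_UN small_subset[OF small_Field_lam]) (auto simp: underS_def)
    have "small TYPE('u) (\<Union>\<sigma>\<in>syms S. Op \<sigma> ` (args lam S \<sigma> \<rightarrow>\<^sub>E (\<Union>j\<in>underS lam i. W j)))"
      using S by (intro small_UN small_image small_PiE * signature_arity_lt[OF S]) (auto simp: is_signature_def)
    then have "small TYPE('u) (Var ` X \<union> (\<Union>\<sigma>\<in>syms S. Op \<sigma> ` (args lam S \<sigma> \<rightarrow>\<^sub>E (\<Union>j\<in>underS lam i. W j))))"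
      by (intro small_Un small_image X)
    then show ?case unfolding W[of i] H_def by simp
  qed
  then have U: "small TYPE('u) (\<Union>i\<in>Field lam. W i)" by (intro small_UN small_Field_lam)
  have "t \<in> (\<Union>i\<in>Field lam. W i)" if "t \<in> terms lam S X" for t
    using that
  proof induction
    case (Var x)
    obtain i where "i \<in> Field lam" using lam_infinite by (metis ex_in_conv finite.emptyI)
    moreover have "Var x \<in> W i" unfolding W[of i] H_def using Var by blast
    ultimately show ?case by blast
  next
    case (Op \<sigma> t)
    then have "\<forall>i\<in>args lam S \<sigma>. \<exists>k. k \<in> Field lam \<and> t i \<in> W k" by blast
    then obtain k where k: "\<And>i. i \<in> args lam S \<sigma> \<Longrightarrow> k i \<in> Field lam \<and> t i \<in> W (k i)" by metis
    have "k ` args lam S \<sigma> \<subseteq> Field lam" using k by blast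
    moreover have "|k ` args lam S \<sigma>| <o lam" by (intro lt_image signature_arity_lt[OF S] Op.hyps(1))
    ultimately obtain m where m: "m \<in> Field lam" "k ` args lam S \<sigma> \<subseteq> underS lam m" by (rule lt_bounded)
    have "t \<in> args lam S \<sigma> \<rightarrow>\<^sub>E (\<Union>j\<in>underS lam m. W j)" using k m(2) Op.hyps(3) by (auto simp: PiE_def)
    then have "Op \<sigma> t \<in> W m" unfolding W[of m] H_def using Op.hyps(1) by blast
    with m(1) show ?case by blast
  qed
  then show ?thesis by (intro small_subset[OF U]) blast
qed

lemma variety_signature: "basic_variety lam V \<Longrightarrow> is_signature lam (sig V)"
  by (simp add: basic_variety_def)

lemma variety_alg:
  assumes "basic_variety lam V" "A \<in> algs V"
  shows "is_qalg lam (sig V) A" "qspace A \<in> Obj Met" "is_emet (qspace A)"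
  using assms by (auto simp: basic_variety_def all_qalgs_def Obj_Met_emet)

text \<open>The defining equations are among the bounds that hold throughout \<open>V\<close>, so an
  algebra that inherits all such bounds is a member. This hides the presenting set of equations from
  the later arguments, where \<epsilon> may be any extended real.\<close>

lemma variety_closed:
  assumes V: "basic_variety lam V" and B: "is_qalg lam (sig V) B" "qspace B \<in> Obj Met"
    and H: "\<And>(N :: 'u emet) l r \<epsilon> f. is_emet N \<Longrightarrow> |pts N| <o lam \<Longrightarrow> l \<in> terms lam (sig V) (pts N) \<Longrightarrow> r \<in> terms lam (sig V) (pts N) \<Longrightarrow>
      (\<And>A g. A \<in> algs V \<Longrightarrow> g \<in> nonexp N (qspace A) \<Longrightarrow>
         edist (qspace A) (term_ext lam (sig V) A g l) (term_ext lam (sig V) A g r) \<le> \<epsilon>) \<Longrightarrow>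
      f \<in> nonexp N (qspace B) \<Longrightarrow>
      edist (qspace B) (term_ext lam (sig V) B f l) (term_ext lam (sig V) B f r) \<le> \<epsilon>"
  shows "B \<in> algs V"
proof -
  obtain E where E: "\<And>e. e \<in> E \<Longrightarrow> is_basic_qeq lam (sig V) e"
    "algs V = {A \<in> all_qalgs lam (sig V). \<forall>e\<in>E. satisfies lam (sig V) A e}"
    using V unfolding basic_variety_def by blast
  have "satisfies lam (sig V) B e" if "e \<in> E" for e
    unfolding satisfies_def
  proof (rule ballI)
    fix f assume f: "f \<in> nonexp (ctxt e) (qspace B)"
    show "edist (qspace B) (term_ext lam (sig V) B f (lhs e)) (term_ext lam (sig V) B f (rhs e)) \<le> ennreal (real_of_rat (eps e))"
    proof (rule H[where N = "ctxt e"])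
      show "f \<in> nonexp (ctxt e) (qspace B)" by (rule f)
      show "is_emet (ctxt e)" "|pts (ctxt e)| <o lam" "lhs e \<in> terms lam (sig V) (pts (ctxt e))"
        "rhs e \<in> terms lam (sig V) (pts (ctxt e))"
        using E(1)[OF that] by (simp_all add: is_basic_qeq_def free_qalg_def)
    qed (use that in \<open>auto simp: E(2) satisfies_def\<close>)
  qed
  then show ?thesis using E(2) B by (simp add: all_qalgs_def)
qed

text \<open>Closure under those images for which small-context assignments lift; it covers both directed colimits
  and retracts in \<open>Met\<close>.\<close>

lemma variety_closed_lift:
  assumes V: "basic_variety lam V" and B: "is_qalg lam (sig V) B" "qspace B \<in> Obj Met"
    and lift: "\<And>(N :: 'u emet) f. is_emet N \<Longrightarrow> |pts N| <o lam \<Longrightarrow> f \<in> nonexp N (qspace B) \<Longrightarrow>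
      \<exists>A\<in>algs V. \<exists>g\<in>qalg_hom lam (sig V) A B. \<exists>f'\<in>nonexp N (qspace A). \<forall>x\<in>pts N. g (f' x) = f x"
  shows "B \<in> algs V"
proof (rule variety_closed[OF V B])
  fix N :: "'u emet" and l r \<epsilon> f
  assume N: "is_emet N" "|pts N| <o lam" and lr: "l \<in> terms lam (sig V) (pts N)" "r \<in> terms lam (sig V) (pts N)"
    and e: "\<And>A g. A \<in> algs V \<Longrightarrow> g \<in> nonexp N (qspace A) \<Longrightarrow>
         edist (qspace A) (term_ext lam (sig V) A g l) (term_ext lam (sig V) A g r) \<le> \<epsilon>"
    and f: "f \<in> nonexp N (qspace B)"
  obtain A g f' where A: "A \<in> algs V" and g: "g \<in> qalg_hom lam (sig V) A B" and f': "f' \<in> nonexp N (qspace A)"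
    "\<And>x. x \<in> pts N \<Longrightarrow> g (f' x) = f x" using lift[OF N f] by blast
  have qA: "is_qalg lam (sig V) A" using variety_alg[OF V A] by simp
  have *: "term_ext lam (sig V) B f t = g (term_ext lam (sig V) A f' t)" if "t \<in> terms lam (sig V) (pts N)" for t
  proof -
    have "g (term_ext lam (sig V) A f' t) = term_ext lam (sig V) B (\<lambda>x. g (f' x)) t"
      using that f' by (intro hom_term_ext[OF g qA, of "pts N"]) (auto intro: nonexp_in)
    also have "\<dots> = term_ext lam (sig V) B f t" using that f'(2) by (rule term_ext_cong[rotated])
    finally show ?thesis by simp
  qed
  have "edist (qspace B) (g (term_ext lam (sig V) A f' l)) (g (term_ext lam (sig V) A f' r)) \<le>
      edist (qspace A) (term_ext lam (sig V) A f' l) (term_ext lam (sig V) A f' r)"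
    by (rule nonexp_le[OF qalg_hom_nonexp[OF g]]) (use term_ext_closed[OF qA f'(1)] lr in blast)+
  also have "\<dots> \<le> \<epsilon>" using e A f' by blast
  finally show "edist (qspace B) (term_ext lam (sig V) B f l) (term_ext lam (sig V) B f r) \<le> \<epsilon>" using * lr by simp
qed

text \<open>Terms are identified by the largest distance that their values have in any algebra of
  \<open>V\<close> under any assignment from \<open>M\<close>. The set \<open>Z\<close> of all these
  interpretations need not be small, but the supremum over it is taken in \<open>ennreal\<close>, so
  that no smaller representative family is required.\<close>

lemma free_exists:
  assumes V: "basic_variety lam V" and M: "M \<in> Obj Met"
  shows "\<exists>A \<eta>. free_on lam V M A \<eta>"
proof -
  let ?S = "sig V"
  let ?T = "terms lam ?S (pts M)"
  define Z where "Z = {p. fst p \<in> algs V \<and> snd p \<in> nonexp M (qspace (fst p))}"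
  define ev where "ev p = term_ext lam ?S (fst p) (snd p)" for p :: "('u, 'u) qalg \<times> ('u \<Rightarrow> 'u)"
  define d where "d s t = (SUP p\<in>Z. edist (qspace (fst p)) (ev p s) (ev p t))" for s t
  have Z: "is_qalg lam ?S (fst p)" "is_emet (qspace (fst p))" "snd p \<in> nonexp M (qspace (fst p))" "fst p \<in> algs V" if "p \<in> Z" for p
    using that variety_alg[OF V] by (auto simp: Z_def)
  have ev: "ev p t \<in> pts (qspace (fst p))" if "p \<in> Z" "t \<in> ?T" for p t
    unfolding ev_def using Z[OF that(1)] that(2) by (intro term_ext_closed)
  have d_ge: "edist (qspace (fst p)) (ev p s) (ev p t) \<le> d s t" if "p \<in> Z" for p s t
    unfolding d_def using that by (rule SUP_upper)
  have d_le: "d s t \<le> c" if "\<And>p. p \<in> Z \<Longrightarrow> edist (qspace (fst p)) (ev p s) (ev p t) \<le> c" for s t c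
    unfolding d_def using that by (rule SUP_least)
  have "small TYPE('u) ?T" using small_terms variety_signature[OF V] Obj_Met_small[OF M] .
  moreover have "d t t = 0" if "t \<in> ?T" for t
    using d_le[of t t 0] ev Z that by (simp add: edist_self)
  moreover have "d s t = d t s" if "s \<in> ?T" "t \<in> ?T" for s t
    unfolding d_def using ev Z that by (intro SUP_cong edist_sym) auto
  moreover have "d s u \<le> d s t + d t u" if "s \<in> ?T" "t \<in> ?T" "u \<in> ?T" for s t u
  proof (rule d_le)
    fix p assume p: "p \<in> Z"
    have "edist (qspace (fst p)) (ev p s) (ev p u) \<le> edist (qspace (fst p)) (ev p s) (ev p t) + edist (qspace (fst p)) (ev p t) (ev p u)"
      using p that ev Z by (intro edist_tri) auto
    also have "\<dots> \<le> d s t + d t u" using p by (intro add_mono d_ge)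
    finally show "edist (qspace (fst p)) (ev p s) (ev p u) \<le> d s t + d t u" .
  qed
  ultimately obtain Q :: "'u emet" and q where Q: "Q \<in> Obj Met" and qT: "q ` ?T = pts Q"
    and qd: "\<And>s t. s \<in> ?T \<Longrightarrow> t \<in> ?T \<Longrightarrow> edist Q (q s) (q t) = d s t"
    by (rule pseudometric_quotient) blast+
  note em = Obj_Met_emet[OF Q]
  define rp where "rp = inv_into ?T q"
  have rp: "rp z \<in> ?T" "q (rp z) = z" if "z \<in> pts Q" for z
    using that unfolding rp_def qT[symmetric] by (auto intro: inv_into_into f_inv_into_f)
  have q_in: "q t \<in> pts Q" if "t \<in> ?T" for t using that qT by blast
  have Op_in: "Op \<sigma> t \<in> ?T" if "\<sigma> \<in> syms ?S" "t \<in> args lam ?S \<sigma> \<rightarrow>\<^sub>E ?T" for \<sigma> t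
    using that by (auto intro!: terms.Op simp: PiE_def)
  \<comment> \<open>This estimate serves twice: it makes the operations independent of
    representatives and it makes them nonexpanding.\<close>
  have op_le: "d (Op \<sigma> s) (Op \<sigma> t) \<le> (SUP i\<in>args lam ?S \<sigma>. d (s i) (t i))"
    if \<sigma>: "\<sigma> \<in> syms ?S" and s: "s \<in> args lam ?S \<sigma> \<rightarrow>\<^sub>E ?T" and t: "t \<in> args lam ?S \<sigma> \<rightarrow>\<^sub>E ?T" for \<sigma> s t
  proof (rule d_le)
    fix p assume p: "p \<in> Z"
    have "edist (qspace (fst p)) (ev p (Op \<sigma> s)) (ev p (Op \<sigma> t)) \<le>
       (SUP i\<in>args lam ?S \<sigma>. edist (qspace (fst p)) ((\<lambda>i\<in>args lam ?S \<sigma>. ev p (s i)) i) ((\<lambda>i\<in>args lam ?S \<sigma>. ev p (t i)) i))"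
      unfolding ev_def term_ext.simps
      by (rule qalg_interp_le[OF Z(1)[OF p] \<sigma>]) (use ev[OF p] s t in \<open>auto simp: ev_def\<close>)
    also have "\<dots> \<le> (SUP i\<in>args lam ?S \<sigma>. d (s i) (t i))"
      using d_ge[OF p] by (intro SUP_mono) auto
    finally show "edist (qspace (fst p)) (ev p (Op \<sigma> s)) (ev p (Op \<sigma> t)) \<le> (SUP i\<in>args lam ?S \<sigma>. d (s i) (t i))" .
  qed
  define A where "A = \<lparr>qspace = Q, interp = (\<lambda>\<sigma>\<in>syms ?S. \<lambda>a\<in>args lam ?S \<sigma> \<rightarrow>\<^sub>E pts Q. q (Op \<sigma> (\<lambda>i\<in>args lam ?S \<sigma>. rp (a i))))\<rparr>"
  have [simp]: "qspace A = Q" by (simp add: A_def)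
  have int: "interp A \<sigma> a = q (Op \<sigma> (\<lambda>i\<in>args lam ?S \<sigma>. rp (a i)))" if "\<sigma> \<in> syms ?S" "a \<in> args lam ?S \<sigma> \<rightarrow>\<^sub>E pts Q" for \<sigma> a
    using that by (simp add: A_def)
  have rpa: "(\<lambda>i\<in>args lam ?S \<sigma>. rp (a i)) \<in> args lam ?S \<sigma> \<rightarrow>\<^sub>E ?T" if "a \<in> args lam ?S \<sigma> \<rightarrow>\<^sub>E pts Q" for a \<sigma>
    using that rp by auto
  have A: "is_qalg lam ?S A"
    unfolding A_def
  proof (rule is_qalgI[OF em])
    fix \<sigma> a assume \<sigma>: "\<sigma> \<in> syms ?S" and a: "a \<in> args lam ?S \<sigma> \<rightarrow>\<^sub>E pts Q"
    show "q (Op \<sigma> (\<lambda>i\<in>args lam ?S \<sigma>. rp (a i))) \<in> pts Q" using \<sigma> a by (intro q_in Op_in rpa)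
    fix b assume b: "b \<in> args lam ?S \<sigma> \<rightarrow>\<^sub>E pts Q"
    have "edist Q (q (Op \<sigma> (\<lambda>i\<in>args lam ?S \<sigma>. rp (a i)))) (q (Op \<sigma> (\<lambda>i\<in>args lam ?S \<sigma>. rp (b i)))) =
       d (Op \<sigma> (\<lambda>i\<in>args lam ?S \<sigma>. rp (a i))) (Op \<sigma> (\<lambda>i\<in>args lam ?S \<sigma>. rp (b i)))"
      using \<sigma> a b by (intro qd Op_in rpa)
    also have "\<dots> \<le> (SUP i\<in>args lam ?S \<sigma>. d ((\<lambda>i\<in>args lam ?S \<sigma>. rp (a i)) i) ((\<lambda>i\<in>args lam ?S \<sigma>. rp (b i)) i))"
      using \<sigma> a b by (intro op_le rpa)
    also have "\<dots> = (SUP i\<in>args lam ?S \<sigma>. edist Q (a i) (b i))"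
    proof (rule SUP_cong[OF refl])
      fix i assume i: "i \<in> args lam ?S \<sigma>"
      then have "a i \<in> pts Q" "b i \<in> pts Q" using a b by auto
      then have "d (rp (a i)) (rp (b i)) = edist Q (a i) (b i)"
        using qd[OF rp(1) rp(1), of "a i" "b i"] by (simp add: rp)
      with i show "d ((\<lambda>i\<in>args lam ?S \<sigma>. rp (a i)) i) ((\<lambda>i\<in>args lam ?S \<sigma>. rp (b i)) i) = edist Q (a i) (b i)" by simp
    qed
    finally show "edist Q (q (Op \<sigma> (\<lambda>i\<in>args lam ?S \<sigma>. rp (a i)))) (q (Op \<sigma> (\<lambda>i\<in>args lam ?S \<sigma>. rp (b i)))) \<le>
      (SUP i\<in>args lam ?S \<sigma>. edist Q (a i) (b i))" .
  qed
  have d0: "d t (rp (q t)) = 0" if "t \<in> ?T" for t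
  proof -
    have "d t (rp (q t)) = edist Q (q t) (q (rp (q t)))" using that by (intro qd[symmetric] rp q_in)
    then show ?thesis using that by (simp add: rp q_in edist_self em)
  qed
  have q_Op: "q (Op \<sigma> t) = interp A \<sigma> (\<lambda>i\<in>args lam ?S \<sigma>. q (t i))"
    if \<sigma>: "\<sigma> \<in> syms ?S" and t: "t \<in> args lam ?S \<sigma> \<rightarrow>\<^sub>E ?T" for \<sigma> t
  proof -
    let ?a = "\<lambda>i\<in>args lam ?S \<sigma>. q (t i)" and ?t = "\<lambda>i\<in>args lam ?S \<sigma>. rp ((\<lambda>i\<in>args lam ?S \<sigma>. q (t i)) i)"
    have a: "?a \<in> args lam ?S \<sigma> \<rightarrow>\<^sub>E pts Q" using t q_in by auto
    have t': "?t \<in> args lam ?S \<sigma> \<rightarrow>\<^sub>E ?T" by (rule rpa[OF a])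
    have "d (Op \<sigma> t) (Op \<sigma> ?t) \<le> (SUP i\<in>args lam ?S \<sigma>. d (t i) (?t i))" by (rule op_le[OF \<sigma> t t'])
    also have "\<dots> \<le> 0" using t d0 by (intro SUP_least) auto
    finally have "edist Q (q (Op \<sigma> t)) (q (Op \<sigma> ?t)) = 0" using qd[OF Op_in[OF \<sigma> t] Op_in[OF \<sigma> t']] by simp
    then have "q (Op \<sigma> t) = q (Op \<sigma> ?t)" using Op_in[OF \<sigma> t] Op_in[OF \<sigma> t'] by (intro edist_0[OF em] q_in)
    then show ?thesis using int[OF \<sigma> a] by simp
  qed
  \<comment> \<open>Evaluation at the interpretation \<open>p\<close>, passed to the quotient. It
    will be the extension of the assignment \<open>snd p\<close>.\<close>
  define hp where "hp p = (\<lambda>z\<in>pts Q. ev p (rp z))" for p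
  have hp_q: "hp p (q t) = ev p t" if p: "p \<in> Z" and t: "t \<in> ?T" for p t
  proof -
    have "edist (qspace (fst p)) (ev p t) (ev p (rp (q t))) \<le> d t (rp (q t))" by (rule d_ge[OF p])
    then have "ev p t = ev p (rp (q t))"
      using d0[OF t] p t by (intro edist_0[OF Z(2)[OF p]] ev rp q_in) auto
    then show ?thesis using q_in[OF t] by (simp add: hp_def)
  qed
  have hp: "hp p \<in> qalg_hom lam ?S A (fst p)" if p: "p \<in> Z" for p
  proof (rule qalg_homI)
    show "hp p \<in> nonexp (qspace A) (qspace (fst p))"
    proof (rule nonexpI)
      fix x y assume "x \<in> pts (qspace A)" "y \<in> pts (qspace A)"
      then have xy: "x \<in> pts Q" "y \<in> pts Q" by simp_all
      have "edist (qspace (fst p)) (ev p (rp x)) (ev p (rp y)) \<le> d (rp x) (rp y)" by (rule d_ge[OF p])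
      also have "\<dots> = edist Q x y" using qd[OF rp(1)[OF xy(1)] rp(1)[OF xy(2)]] xy by (simp add: rp)
      finally show "edist (qspace (fst p)) (hp p x) (hp p y) \<le> edist (qspace A) x y" using xy by (simp add: hp_def)
    qed (use ev[OF p] rp in \<open>auto simp: hp_def\<close>)
    fix \<sigma> a assume \<sigma>: "\<sigma> \<in> syms ?S" and "a \<in> args lam ?S \<sigma> \<rightarrow>\<^sub>E pts (qspace A)"
    then have a: "a \<in> args lam ?S \<sigma> \<rightarrow>\<^sub>E pts Q" by simp
    have "hp p (interp A \<sigma> a) = ev p (Op \<sigma> (\<lambda>i\<in>args lam ?S \<sigma>. rp (a i)))"
      unfolding int[OF \<sigma> a] by (rule hp_q[OF p Op_in[OF \<sigma> rpa[OF a]]])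
    also have "\<dots> = interp (fst p) \<sigma> (\<lambda>i\<in>args lam ?S \<sigma>. ev p ((\<lambda>i\<in>args lam ?S \<sigma>. rp (a i)) i))"
      unfolding ev_def term_ext.simps ..
    also have "(\<lambda>i\<in>args lam ?S \<sigma>. ev p ((\<lambda>i\<in>args lam ?S \<sigma>. rp (a i)) i)) = (\<lambda>i\<in>args lam ?S \<sigma>. hp p (a i))"
      using a by (intro restrict_ext) (auto simp: hp_def)
    finally show "hp p (interp A \<sigma> a) = interp (fst p) \<sigma> (\<lambda>i\<in>args lam ?S \<sigma>. hp p (a i))" .
  qed
  \<comment> \<open>By construction a distance in \<open>A\<close> is the supremum of the distances
    of the images under the homomorphisms \<open>hp p\<close>. A bound valid in all algebras
    \<open>fst p\<close> thus holds in \<open>A\<close>, as for a subalgebra of a product.\<close>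
  have "A \<in> algs V"
  proof (rule variety_closed[OF V A])
    show "qspace A \<in> Obj Met" using Q by simp
    fix N :: "'u emet" and l r \<epsilon> f
    assume N: "is_emet N" "|pts N| <o lam" and lr: "l \<in> terms lam (sig V) (pts N)" "r \<in> terms lam (sig V) (pts N)"
      and e: "\<And>A g. A \<in> algs V \<Longrightarrow> g \<in> nonexp N (qspace A) \<Longrightarrow>
           edist (qspace A) (term_ext lam (sig V) A g l) (term_ext lam (sig V) A g r) \<le> \<epsilon>"
      and f: "f \<in> nonexp N (qspace A)"
    let ?l = "term_ext lam ?S A f l" and ?r = "term_ext lam ?S A f r"
    have lr_in: "?l \<in> pts Q" "?r \<in> pts Q" using term_ext_closed[OF A f] lr by simp_all
    have "edist Q ?l ?r = d (rp ?l) (rp ?r)" using qd[OF rp(1)[OF lr_in(1)] rp(1)[OF lr_in(2)]] lr_in by (simp add: rp)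
    also have "\<dots> \<le> \<epsilon>"
    proof (rule d_le)
      fix p assume p: "p \<in> Z"
      have *: "ev p (rp (term_ext lam ?S A f t)) = term_ext lam ?S (fst p) (compose (pts N) (hp p) f) t" if t: "t \<in> terms lam ?S (pts N)" for t
      proof -
        have "ev p (rp (term_ext lam ?S A f t)) = hp p (term_ext lam ?S A f t)"
          using term_ext_closed[OF A f t] by (simp add: hp_def)
        also have "\<dots> = term_ext lam ?S (fst p) (\<lambda>x. hp p (f x)) t"
          using t f by (intro hom_term_ext[OF hp[OF p] A]) (auto intro: nonexp_in)
        also have "\<dots> = term_ext lam ?S (fst p) (compose (pts N) (hp p) f) t"
          using t by (intro term_ext_cong[of "pts N"]) (auto simp: compose_eq)
        finally show ?thesis .
      qed
      show "edist (qspace (fst p)) (ev p (rp ?l)) (ev p (rp ?r)) \<le> \<epsilon>"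
        unfolding *[OF lr(1)] *[OF lr(2)]
        by (rule e[OF Z(4)[OF p] nonexp_compose[OF f qalg_hom_nonexp[OF hp[OF p]]]])
    qed
    finally show "edist (qspace A) ?l ?r \<le> \<epsilon>" by simp
  qed
  moreover have "(\<lambda>x\<in>pts M. q (Var x)) \<in> nonexp M (qspace A)"
  proof (rule nonexp_restrict)
    fix x y assume xy: "x \<in> pts M" "y \<in> pts M"
    have "edist Q (q (Var x)) (q (Var y)) = d (Var x) (Var y)" using xy by (intro qd terms.Var)
    also have "\<dots> \<le> edist M x y" using xy Z(3) by (intro d_le) (auto simp: ev_def intro: nonexp_le)
    finally show "edist (qspace A) (q (Var x)) (q (Var y)) \<le> edist M x y" by simp
  qed (auto intro: q_in terms.Var)
  moreover have "P p" if P: "\<forall>x\<in>pts M. P ((\<lambda>x\<in>pts M. q (Var x)) x)"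
    "\<forall>\<sigma>\<in>syms ?S. \<forall>a\<in>args lam ?S \<sigma> \<rightarrow>\<^sub>E pts (qspace A). (\<forall>i\<in>args lam ?S \<sigma>. P (a i)) \<longrightarrow> P (interp A \<sigma> a)"
    and p: "p \<in> pts (qspace A)" for P p
  proof -
    have "P (q t)" if "t \<in> ?T" for t
      using that
    proof induction
      case (Var x) then show ?case using P(1) by simp
    next
      case (Op \<sigma> t)
      then have t: "t \<in> args lam ?S \<sigma> \<rightarrow>\<^sub>E ?T" by (auto simp: PiE_def)
      have "(\<lambda>i\<in>args lam ?S \<sigma>. q (t i)) \<in> args lam ?S \<sigma> \<rightarrow>\<^sub>E pts Q" using t q_in by auto
      then show ?case using q_Op[OF Op.hyps(1) t] P(2) Op.hyps(1) Op.IH by simp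
    qed
    moreover have "p \<in> q ` ?T" using p qT by simp
    ultimately show ?thesis by blast
  qed
  moreover have "\<exists>h\<in>qalg_hom lam ?S A B. \<forall>x\<in>pts M. h ((\<lambda>x\<in>pts M. q (Var x)) x) = f x"
    if B: "B \<in> algs V" and f: "f \<in> nonexp M (qspace B)" for B f
  proof -
    have p: "(B, f) \<in> Z" using B f by (simp add: Z_def)
    have "hp (B, f) (q (Var x)) = f x" if "x \<in> pts M" for x
      using hp_q[OF p terms.Var[OF that]] by (simp add: ev_def)
    then show ?thesis using hp[OF p] by auto
  qed
  ultimately have "free_on lam V M A (\<lambda>x\<in>pts M. q (Var x))" unfolding free_on_def by blast
  then show ?thesis by blast
qed

end

subsection \<open>The monad of a variety\<close>

lemma is_functor_poset_diagram:
  assumes "is_functor (poset_cat I r) Met D" and "directed_poset lam I r"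
  shows "i \<in> I \<Longrightarrow> fo D i \<in> Obj Met" "(i, j) \<in> r \<Longrightarrow> fm D i j () \<in> nonexp (fo D i) (fo D j)"
    "i \<in> I \<Longrightarrow> fm D i i () = (\<lambda>x\<in>pts (fo D i). x)"
    "(i, j) \<in> r \<Longrightarrow> (j, k) \<in> r \<Longrightarrow> fm D i k () = compose (pts (fo D i)) (fm D j k ()) (fm D i j ())"
proof -
  have r: "(i, j) \<in> r \<Longrightarrow> i \<in> I \<and> j \<in> I" "i \<in> I \<Longrightarrow> (i, i) \<in> r" for i j
    using assms(2) by (auto simp: directed_poset_def partial_order_on_def preorder_on_def refl_on_def)
  have Obj: "Obj (poset_cat I r) = I" and Mor: "Mor (poset_cat I r) i j = (if (i, j) \<in> r then {()} else {})" for i j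
    by (simp_all add: poset_cat_def)
  note F = is_functorD[OF assms(1), unfolded Obj]
  show "i \<in> I \<Longrightarrow> fo D i \<in> Obj Met" by (rule F(1))
  show "(i, j) \<in> r \<Longrightarrow> fm D i j () \<in> nonexp (fo D i) (fo D j)"
    using F(2)[of i j "()"] r by (simp add: Mor)
  show "i \<in> I \<Longrightarrow> fm D i i () = (\<lambda>x\<in>pts (fo D i). x)"
    using F(3)[of i] by simp
  show "(i, j) \<in> r \<Longrightarrow> (j, k) \<in> r \<Longrightarrow> fm D i k () = compose (pts (fo D i)) (fm D j k ()) (fm D i j ())"
    using F(4)[of i j k "()" "()"] r(1)[of i j] r(1)[of j k] by (simp add: Mor)
qed

lemma (in cardinal_universe) functor_directed_diagram:
  assumes I: "small TYPE('u) I" and D: "is_functor (poset_cat I r) Met D" and r: "directed_poset lam I r"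
  shows "directed_diagram lam I r (fo D) (\<lambda>i j. fm D i j ())"
proof unfold_locales
  note F = is_functor_poset_diagram[OF D r]
  show "fm D i i () x = x" if "i \<in> I" "x \<in> pts (fo D i)" for i x using that by (simp add: F(3))
  show "fm D j k () (fm D i j () x) = fm D i k () x" if "(i, j) \<in> r" "(j, k) \<in> r" "x \<in> pts (fo D i)" for i j k x
    using that by (simp add: F(4)[OF that(1,2)] compose_eq)
qed (use I r is_functor_poset_diagram[OF D r] in auto)

text \<open>An operation has fewer than \<open>lam\<close> arguments and is computed by lifting them
  to one stage. The algebra lies in the variety because an assignment of a small context lifts
  isometrically, hence to a nonexpanding assignment, at some stage.\<close>

lemma (in directed_diagram) colimit_algebra:
  assumes V: "basic_variety lam V" and B: "\<And>i. i \<in> I \<Longrightarrow> B i \<in> algs V" "\<And>i. i \<in> I \<Longrightarrow> qspace (B i) = X i"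
    and hom: "\<And>i j. (i, j) \<in> r \<Longrightarrow> b i j \<in> qalg_hom lam (sig V) (B i) (B j)" and Q: "good_cocone Q q"
  obtains A where "A \<in> algs V" "qspace A = Q" "\<And>i. i \<in> I \<Longrightarrow> q i \<in> qalg_hom lam (sig V) (B i) A"
proof -
  let ?S = "sig V"
  note G = good_coconeD[OF Q]
  have qB: "is_qalg lam ?S (B i)" if "i \<in> I" for i using variety_alg[OF V B(1)[OF that]] by simp
  have lt: "|args lam ?S \<sigma>| <o lam" if "\<sigma> \<in> syms ?S" for \<sigma>
    using signature_arity_lt[OF variety_signature[OF V] that] .
  have int_in: "interp (B i) \<sigma> a \<in> pts (X i)" if "i \<in> I" "\<sigma> \<in> syms ?S" "a \<in> args lam ?S \<sigma> \<rightarrow>\<^sub>E pts (X i)" for i \<sigma> a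
    using qalg_interp_in[OF qB[OF that(1)] that(2)] that(3) by (simp add: B(2)[OF that(1)])
  \<comment> \<open>This yields at once that the value does not depend on the lift and that the
    operation is nonexpanding. It is proved at a stage \<open>z\<close> above \<open>k\<close>,
    \<open>l\<close> and all stages at which the distances of the components are attained.\<close>
  have key: "edist Q (q k (interp (B k) \<sigma> a)) (q l (interp (B l) \<sigma> c)) \<le> (SUP i\<in>args lam ?S \<sigma>. edist Q (q k (a i)) (q l (c i)))"
    if \<sigma>: "\<sigma> \<in> syms ?S" and k: "k \<in> I" and l: "l \<in> I" and a: "a \<in> args lam ?S \<sigma> \<rightarrow>\<^sub>E pts (X k)"
      and c: "c \<in> args lam ?S \<sigma> \<rightarrow>\<^sub>E pts (X l)" for \<sigma> k l a c
  proof -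
    let ?n = "args lam ?S \<sigma>"
    have "\<exists>m. (k, m) \<in> r \<and> (l, m) \<in> r \<and> edist (X m) (b k m (a i)) (b l m (c i)) = edist Q (q k (a i)) (q l (c i))"
      if "i \<in> ?n" for i
      using delta_attained[OF k l PiE_mem[OF a that] PiE_mem[OF c that]] G(5)[OF k l PiE_mem[OF a that] PiE_mem[OF c that]]
      by metis
    then obtain m where m: "\<And>i. i \<in> ?n \<Longrightarrow> (k, m i) \<in> r \<and> (l, m i) \<in> r \<and>
        edist (X (m i)) (b k (m i) (a i)) (b l (m i) (c i)) = edist Q (q k (a i)) (q l (c i))" by metis
    have "m ` ?n \<subseteq> I" using m r_I(2) by blast
    moreover have "|m ` ?n| <o lam" by (intro lt_image lt \<sigma>)
    ultimately obtain z0 where z0: "z0 \<in> I" "\<forall>j\<in>m ` ?n. (j, z0) \<in> r" by (rule upper_bound)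
    obtain z1 where z1: "z1 \<in> I" "(k, z1) \<in> r" "(l, z1) \<in> r" using upper_bound2[OF k l] .
    obtain z where z: "z \<in> I" "(z0, z) \<in> r" "(z1, z) \<in> r" using upper_bound2[OF z0(1) z1(1)] .
    have kz: "(k, z) \<in> r" and lz: "(l, z) \<in> r" and mz: "\<And>i. i \<in> ?n \<Longrightarrow> (m i, z) \<in> r"
      using z z1 z0 r_trans by blast+
    have push: "q j (interp (B j) \<sigma> e) = q z (interp (B z) \<sigma> (\<lambda>i\<in>?n. b j z (e i)))"
      if jz: "(j, z) \<in> r" and e: "e \<in> ?n \<rightarrow>\<^sub>E pts (X j)" for j e
    proof -
      have j: "j \<in> I" using jz r_I by blast
      have "q j (interp (B j) \<sigma> e) = q z (b j z (interp (B j) \<sigma> e))" using G(3)[OF jz int_in[OF j \<sigma> e]] by simp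
      also have "b j z (interp (B j) \<sigma> e) = interp (B z) \<sigma> (\<lambda>i\<in>?n. b j z (e i))"
        using qalg_hom_interp[OF hom[OF jz] \<sigma>] e B(2)[OF j] by simp
      finally show ?thesis .
    qed
    have bz: "(\<lambda>i\<in>?n. b j z (e i)) \<in> ?n \<rightarrow>\<^sub>E pts (X z)" if "(j, z) \<in> r" "e \<in> ?n \<rightarrow>\<^sub>E pts (X j)" for j e
      using that b_in by auto
    have "edist Q (q k (interp (B k) \<sigma> a)) (q l (interp (B l) \<sigma> c)) \<le>
        edist (X z) (interp (B z) \<sigma> (\<lambda>i\<in>?n. b k z (a i))) (interp (B z) \<sigma> (\<lambda>i\<in>?n. b l z (c i)))"
      unfolding push[OF kz a] push[OF lz c]
      by (intro nonexp_le[OF G(2)[OF z(1)]] int_in z(1) \<sigma> bz kz lz a c)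
    also have "\<dots> \<le> (SUP i\<in>?n. edist (X z) ((\<lambda>i\<in>?n. b k z (a i)) i) ((\<lambda>i\<in>?n. b l z (c i)) i))"
      using qalg_interp_le[OF qB[OF z(1)] \<sigma>, of "\<lambda>i\<in>?n. b k z (a i)" "\<lambda>i\<in>?n. b l z (c i)"] bz[OF kz a] bz[OF lz c]
      by (simp only: B(2)[OF z(1)])
    also have "\<dots> \<le> (SUP i\<in>?n. edist Q (q k (a i)) (q l (c i)))"
    proof (intro SUP_mono)
      fix i assume i: "i \<in> ?n"
      have "edist (X z) (b k z (a i)) (b l z (c i)) \<le> edist (X (m i)) (b k (m i) (a i)) (b l (m i) (c i))"
        using m[OF i] mz[OF i] PiE_mem[OF a i] PiE_mem[OF c i] by (intro edist_b_decreasing) auto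
      then show "\<exists>i'\<in>?n. edist (X z) ((\<lambda>i\<in>?n. b k z (a i)) i) ((\<lambda>i\<in>?n. b l z (c i)) i) \<le> edist Q (q k (a i')) (q l (c i'))"
        using i m[OF i] by auto
    qed
    finally show ?thesis .
  qed
  \<comment> \<open>A witness is a stage together with a lift of the tuple \<open>p\<close> to it;
    \<open>w\<close> chooses one, and \<open>key\<close> makes the choice immaterial.\<close>
  define P where "P \<sigma> p z \<longleftrightarrow> fst z \<in> I \<and> snd z \<in> args lam ?S \<sigma> \<rightarrow>\<^sub>E pts (X (fst z)) \<and>
      (\<forall>i\<in>args lam ?S \<sigma>. q (fst z) (snd z i) = p i)" for \<sigma> p z
  define w where "w \<sigma> p = (SOME z. P \<sigma> p z)" for \<sigma> p
  have w: "P \<sigma> p (w \<sigma> p)" if \<sigma>: "\<sigma> \<in> syms ?S" and p: "p \<in> args lam ?S \<sigma> \<rightarrow>\<^sub>E pts Q" for \<sigma> p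
  proof -
    obtain k a' where "k \<in> I" "a' \<in> args lam ?S \<sigma> \<rightarrow>\<^sub>E pts (X k)" "\<And>x. x \<in> args lam ?S \<sigma> \<Longrightarrow> q k (a' x) = p x"
      using good_cocone_lift[OF Q lt[OF \<sigma>], of p] PiE_mem[OF p] by metis
    then have "P \<sigma> p (k, a')" by (simp add: P_def)
    then show ?thesis unfolding w_def by (rule someI)
  qed
  define op where "op \<sigma> p = q (fst (w \<sigma> p)) (interp (B (fst (w \<sigma> p))) \<sigma> (snd (w \<sigma> p)))" for \<sigma> p
  have op_in: "op \<sigma> p \<in> pts Q" if "\<sigma> \<in> syms ?S" "p \<in> args lam ?S \<sigma> \<rightarrow>\<^sub>E pts Q" for \<sigma> p
    unfolding op_def using w[OF that] that(1) by (intro nonexp_in[OF G(2)] int_in) (simp_all add: P_def)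
  have op_le: "edist Q (op \<sigma> p) (op \<sigma> p') \<le> (SUP i\<in>args lam ?S \<sigma>. edist Q (p i) (p' i))"
    if \<sigma>: "\<sigma> \<in> syms ?S" and p: "p \<in> args lam ?S \<sigma> \<rightarrow>\<^sub>E pts Q" "p' \<in> args lam ?S \<sigma> \<rightarrow>\<^sub>E pts Q" for \<sigma> p p'
  proof -
    have "edist Q (op \<sigma> p) (op \<sigma> p') \<le> (SUP i\<in>args lam ?S \<sigma>. edist Q (q (fst (w \<sigma> p)) (snd (w \<sigma> p) i)) (q (fst (w \<sigma> p')) (snd (w \<sigma> p') i)))"
      unfolding op_def using w[OF \<sigma> p(1)] w[OF \<sigma> p(2)] \<sigma> by (intro key) (simp_all add: P_def)
    also have "\<dots> = (SUP i\<in>args lam ?S \<sigma>. edist Q (p i) (p' i))"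
      using w[OF \<sigma> p(1)] w[OF \<sigma> p(2)] by (intro SUP_cong refl) (simp add: P_def)
    finally show ?thesis .
  qed
  define A where "A = \<lparr>qspace = Q, interp = (\<lambda>\<sigma>\<in>syms ?S. \<lambda>p\<in>args lam ?S \<sigma> \<rightarrow>\<^sub>E pts Q. op \<sigma> p)\<rparr>"
  have QA: "qspace A = Q" by (simp add: A_def)
  have A: "is_qalg lam ?S A" unfolding A_def by (rule is_qalgI[OF Obj_Met_emet[OF G(1)] op_in op_le])
  have q_hom: "q k \<in> qalg_hom lam ?S (B k) A" if k: "k \<in> I" for k
  proof (rule qalg_homI)
    show "q k \<in> nonexp (qspace (B k)) (qspace A)" using G(2)[OF k] by (simp add: B(2)[OF k] QA)
    fix \<sigma> a assume \<sigma>: "\<sigma> \<in> syms ?S" and "a \<in> args lam ?S \<sigma> \<rightarrow>\<^sub>E pts (qspace (B k))"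
    then have a: "a \<in> args lam ?S \<sigma> \<rightarrow>\<^sub>E pts (X k)" by (simp add: B(2)[OF k])
    let ?p = "\<lambda>i\<in>args lam ?S \<sigma>. q k (a i)"
    have p: "?p \<in> args lam ?S \<sigma> \<rightarrow>\<^sub>E pts Q" using PiE_mem[OF a] nonexp_in[OF G(2)[OF k]] by auto
    note W = w[OF \<sigma> p, unfolded P_def]
    have "edist Q (q k (interp (B k) \<sigma> a)) (op \<sigma> ?p) \<le> (SUP i\<in>args lam ?S \<sigma>. edist Q (q k (a i)) (q (fst (w \<sigma> ?p)) (snd (w \<sigma> ?p) i)))"
      unfolding op_def using W by (intro key \<sigma> k a) simp_all
    also have "\<dots> \<le> 0"
    proof (rule SUP_least)
      fix i assume i: "i \<in> args lam ?S \<sigma>"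
      then have "q (fst (w \<sigma> ?p)) (snd (w \<sigma> ?p) i) = q k (a i)" using W by simp
      then show "edist Q (q k (a i)) (q (fst (w \<sigma> ?p)) (snd (w \<sigma> ?p) i)) \<le> 0"
        using PiE_mem[OF p i] i by (simp add: edist_self Obj_Met_emet[OF G(1)])
    qed
    finally have "edist Q (q k (interp (B k) \<sigma> a)) (op \<sigma> ?p) = 0" by simp
    then have "q k (interp (B k) \<sigma> a) = op \<sigma> ?p"
      by (rule edist_0[OF Obj_Met_emet[OF G(1)], rotated -1]) (intro nonexp_in[OF G(2)[OF k]] int_in op_in k \<sigma> a p)+
    also have "op \<sigma> ?p = interp A \<sigma> ?p" using \<sigma> p by (simp add: A_def)
    finally show "q k (interp (B k) \<sigma> a) = interp A \<sigma> ?p" .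
  qed
  have "A \<in> algs V"
  proof (rule variety_closed_lift[OF V A])
    show "qspace A \<in> Obj Met" using G(1) by (simp add: QA)
    fix N :: "'u emet" and f assume N: "is_emet N" "|pts N| <o lam" and f: "f \<in> nonexp N (qspace A)"
    have "\<And>x. x \<in> pts N \<Longrightarrow> f x \<in> pts Q" using nonexp_in[OF f] by (simp add: QA)
    then obtain k a' where k: "k \<in> I" "a' \<in> pts N \<rightarrow>\<^sub>E pts (X k)" "\<And>x. x \<in> pts N \<Longrightarrow> q k (a' x) = f x"
      "\<And>x y. x \<in> pts N \<Longrightarrow> y \<in> pts N \<Longrightarrow> edist (X k) (a' x) (a' y) = edist Q (f x) (f y)"
      using good_cocone_lift[OF Q N(2), of f] by metis
    have "a' \<in> nonexp N (qspace (B k))"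
      using k nonexp_le[OF f] by (intro nonexpI) (auto simp: B(2) QA PiE_def)
    then show "\<exists>A'\<in>algs V. \<exists>g\<in>qalg_hom lam ?S A' A. \<exists>f'\<in>nonexp N (qspace A'). \<forall>x\<in>pts N. g (f' x) = f x"
      using B(1)[OF k(1)] q_hom[OF k(1)] k(3) by blast
  qed
  then show thesis using that QA q_hom by blast
qed

section \<open>The free-algebra functor, its unit and its multiplication\<close>

context cardinal_universe
begin

definition free_pair :: "'u variety \<Rightarrow> 'u emet \<Rightarrow> ('u, 'u) qalg \<times> ('u \<Rightarrow> 'u)" where
  "free_pair V M = (SOME p. free_on lam V M (fst p) (snd p))"

definition FA :: "'u variety \<Rightarrow> 'u emet \<Rightarrow> ('u, 'u) qalg" where "FA V M = fst (free_pair V M)"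

definition unit_map :: "'u variety \<Rightarrow> 'u emet \<Rightarrow> 'u \<Rightarrow> 'u" where "unit_map V M = snd (free_pair V M)"

definition TV :: "'u variety \<Rightarrow> 'u emet \<Rightarrow> 'u emet" where "TV V M = qspace (FA V M)"

definition fext :: "'u variety \<Rightarrow> 'u emet \<Rightarrow> ('u, 'u) qalg \<Rightarrow> ('u \<Rightarrow> 'u) \<Rightarrow> 'u \<Rightarrow> 'u" where
  "fext V M A f = (SOME h. h \<in> qalg_hom lam (sig V) (FA V M) A \<and> (\<forall>x\<in>pts M. h (unit_map V M x) = f x))"

definition fmap :: "'u variety \<Rightarrow> 'u emet \<Rightarrow> 'u emet \<Rightarrow> ('u \<Rightarrow> 'u) \<Rightarrow> 'u \<Rightarrow> 'u" where
  "fmap V M N f = fext V M (FA V N) (compose (pts M) (unit_map V N) f)"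

definition mult_map :: "'u variety \<Rightarrow> 'u emet \<Rightarrow> 'u \<Rightarrow> 'u" where
  "mult_map V M = fext V (TV V M) (FA V M) (\<lambda>x\<in>pts (TV V M). x)"

lemma free_on_FA: "basic_variety lam V \<Longrightarrow> M \<in> Obj Met \<Longrightarrow> free_on lam V M (FA V M) (unit_map V M)"
proof -
  assume "basic_variety lam V" "M \<in> Obj Met"
  then obtain A \<eta> where "free_on lam V M A \<eta>" using free_exists by blast
  then have "\<exists>p. free_on lam V M (fst p) (snd p)" by (intro exI[of _ "(A, \<eta>)"]) simp
  then show ?thesis unfolding FA_def unit_map_def free_pair_def by (rule someI_ex)
qed

lemma FA_alg: "basic_variety lam V \<Longrightarrow> M \<in> Obj Met \<Longrightarrow> FA V M \<in> algs V"
  using free_onD(1) free_on_FA by blast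

lemma FA_qalg: "basic_variety lam V \<Longrightarrow> M \<in> Obj Met \<Longrightarrow> is_qalg lam (sig V) (FA V M)"
  using FA_alg variety_alg by blast

lemma TV_Obj: "basic_variety lam V \<Longrightarrow> M \<in> Obj Met \<Longrightarrow> TV V M \<in> Obj Met"
  using FA_alg variety_alg unfolding TV_def by blast

lemma unit_map_nonexp: "basic_variety lam V \<Longrightarrow> M \<in> Obj Met \<Longrightarrow> unit_map V M \<in> nonexp M (TV V M)"
  unfolding TV_def using free_onD(2)[OF free_on_FA] .

lemma unit_map_in: "basic_variety lam V \<Longrightarrow> M \<in> Obj Met \<Longrightarrow> x \<in> pts M \<Longrightarrow> unit_map V M x \<in> pts (TV V M)"
  by (rule nonexp_in[OF unit_map_nonexp])

lemma fext:
  assumes "basic_variety lam V" "M \<in> Obj Met" "A \<in> algs V" "f \<in> nonexp M (qspace A)"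
  shows fext_hom: "fext V M A f \<in> qalg_hom lam (sig V) (FA V M) A"
    and fext_unit: "x \<in> pts M \<Longrightarrow> fext V M A f (unit_map V M x) = f x"
proof -
  have "\<exists>h. h \<in> qalg_hom lam (sig V) (FA V M) A \<and> (\<forall>x\<in>pts M. h (unit_map V M x) = f x)"
    using free_onD(3)[OF free_on_FA[OF assms(1,2)] assms(3,4)] by blast
  then have "fext V M A f \<in> qalg_hom lam (sig V) (FA V M) A \<and> (\<forall>x\<in>pts M. fext V M A f (unit_map V M x) = f x)"
    unfolding fext_def by (rule someI_ex)
  then show "fext V M A f \<in> qalg_hom lam (sig V) (FA V M) A"
    "x \<in> pts M \<Longrightarrow> fext V M A f (unit_map V M x) = f x" by blast+
qed

text \<open>Diagrams of maps out of a free algebra are verified through this lemma: both composites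
  are homomorphisms, so it remains to compare them on generators.\<close>

lemma FA_hom_eqI:
  assumes "basic_variety lam V" "M \<in> Obj Met"
    and h: "h \<in> qalg_hom lam (sig V) (FA V M) A" and k: "k \<in> qalg_hom lam (sig V) (FA V M) A"
    and "\<And>x. x \<in> pts M \<Longrightarrow> h (unit_map V M x) = k (unit_map V M x)"
  shows "h = k"
  using free_on_hom_eq[OF free_on_FA[OF assms(1,2)] h k] assms(5)
  by (intro nonexp_eqI[OF qalg_hom_nonexp[OF h] qalg_hom_nonexp[OF k]]) blast

lemma FA_induct [consumes 3, case_names gen op]:
  assumes "basic_variety lam V" "M \<in> Obj Met" "p \<in> pts (TV V M)"
    and "\<And>x. x \<in> pts M \<Longrightarrow> P (unit_map V M x)"
    and "\<And>\<sigma> a. \<sigma> \<in> syms (sig V) \<Longrightarrow> a \<in> args lam (sig V) \<sigma> \<rightarrow>\<^sub>E pts (TV V M) \<Longrightarrow>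
      (\<And>i. i \<in> args lam (sig V) \<sigma> \<Longrightarrow> P (a i)) \<Longrightarrow> P (interp (FA V M) \<sigma> a)"
  shows "P p"
proof (rule free_on_induct[OF free_on_FA[OF assms(1,2)] assms(3)[unfolded TV_def], where P = P])
  show "P (unit_map V M x)" if "x \<in> pts M" for x using that by (rule assms(4))
  show "P (interp (FA V M) \<sigma> a)" if "\<sigma> \<in> syms (sig V)" "a \<in> args lam (sig V) \<sigma> \<rightarrow>\<^sub>E pts (qspace (FA V M))"
    "\<And>i. i \<in> args lam (sig V) \<sigma> \<Longrightarrow> P (a i)" for \<sigma> a
    using that by (rule assms(5)[unfolded TV_def])
qed

lemma fmap:
  assumes "basic_variety lam V" "M \<in> Obj Met" "N \<in> Obj Met" "f \<in> nonexp M N"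
  shows fmap_hom: "fmap V M N f \<in> qalg_hom lam (sig V) (FA V M) (FA V N)"
    and fmap_nonexp: "fmap V M N f \<in> nonexp (TV V M) (TV V N)"
    and fmap_unit: "x \<in> pts M \<Longrightarrow> fmap V M N f (unit_map V M x) = unit_map V N (f x)"
proof -
  have c: "compose (pts M) (unit_map V N) f \<in> nonexp M (qspace (FA V N))"
    using nonexp_compose[OF assms(4) unit_map_nonexp[OF assms(1,3)]] by (simp add: TV_def)
  show h: "fmap V M N f \<in> qalg_hom lam (sig V) (FA V M) (FA V N)"
    unfolding fmap_def by (rule fext_hom[OF assms(1,2) FA_alg[OF assms(1,3)] c])
  then show "fmap V M N f \<in> nonexp (TV V M) (TV V N)" unfolding TV_def by (rule qalg_hom_nonexp)
  show "x \<in> pts M \<Longrightarrow> fmap V M N f (unit_map V M x) = unit_map V N (f x)"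
    unfolding fmap_def using fext_unit[OF assms(1,2) FA_alg[OF assms(1,3)] c] by (simp add: compose_eq)
qed

lemma fmap_in: "basic_variety lam V \<Longrightarrow> M \<in> Obj Met \<Longrightarrow> N \<in> Obj Met \<Longrightarrow> f \<in> nonexp M N \<Longrightarrow> p \<in> pts (TV V M) \<Longrightarrow>
    fmap V M N f p \<in> pts (TV V N)"
  by (rule nonexp_in[OF fmap_nonexp])

lemma mult_map:
  assumes "basic_variety lam V" "M \<in> Obj Met"
  shows mult_map_hom: "mult_map V M \<in> qalg_hom lam (sig V) (FA V (TV V M)) (FA V M)"
    and mult_map_nonexp: "mult_map V M \<in> nonexp (TV V (TV V M)) (TV V M)"
    and mult_map_unit: "x \<in> pts (TV V M) \<Longrightarrow> mult_map V M (unit_map V (TV V M) x) = x"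
proof -
  have i: "(\<lambda>x\<in>pts (TV V M). x) \<in> nonexp (TV V M) (qspace (FA V M))" using nonexp_ident by (simp add: TV_def)
  note f = fext[OF assms(1) TV_Obj[OF assms] FA_alg[OF assms] i]
  show "mult_map V M \<in> qalg_hom lam (sig V) (FA V (TV V M)) (FA V M)" unfolding mult_map_def by (rule f(1))
  then show "mult_map V M \<in> nonexp (TV V (TV V M)) (TV V M)" unfolding TV_def by (rule qalg_hom_nonexp)
  show "x \<in> pts (TV V M) \<Longrightarrow> mult_map V M (unit_map V (TV V M) x) = x" unfolding mult_map_def using f(2)[of x] by simp
qed

lemma mult_map_in: "basic_variety lam V \<Longrightarrow> M \<in> Obj Met \<Longrightarrow> p \<in> pts (TV V (TV V M)) \<Longrightarrow> mult_map V M p \<in> pts (TV V M)"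
  by (rule nonexp_in[OF mult_map_nonexp])

lemma FA_hom_compose:
  assumes "basic_variety lam V" "M \<in> Obj Met" "f \<in> qalg_hom lam (sig V) (FA V M) B" "g \<in> qalg_hom lam (sig V) B C"
  shows "compose (pts (TV V M)) g f \<in> qalg_hom lam (sig V) (FA V M) C"
  using qalg_hom_compose[OF assms(3,4) FA_qalg[OF assms(1,2)]] by (simp add: TV_def)

lemma fmap_ident: "basic_variety lam V \<Longrightarrow> M \<in> Obj Met \<Longrightarrow> fmap V M M (\<lambda>x\<in>pts M. x) = (\<lambda>x\<in>pts (TV V M). x)"
proof -
  assume V: "basic_variety lam V" and M: "M \<in> Obj Met"
  have "(\<lambda>x\<in>pts (TV V M). x) \<in> qalg_hom lam (sig V) (FA V M) (FA V M)"
    using qalg_hom_ident[OF FA_qalg[OF V M]] by (simp add: TV_def)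
  then show ?thesis
    by (intro FA_hom_eqI[OF V M fmap_hom[OF V M M nonexp_ident]])
      (simp_all add: fmap_unit[OF V M M nonexp_ident] unit_map_in[OF V M])
qed

lemma fmap_compose:
  assumes V: "basic_variety lam V" and M: "M \<in> Obj Met" and N: "N \<in> Obj Met" and P: "P \<in> Obj Met"
    and f: "f \<in> nonexp M N" and g: "g \<in> nonexp N P"
  shows "fmap V M P (compose (pts M) g f) = compose (pts (TV V M)) (fmap V N P g) (fmap V M N f)"
  by (rule FA_hom_eqI[OF V M fmap_hom[OF V M P nonexp_compose[OF f g]] FA_hom_compose[OF V M fmap_hom[OF V M N f] fmap_hom[OF V N P g]]])
    (simp add: fmap_unit[OF V M P nonexp_compose[OF f g]] fmap_unit[OF V M N f] fmap_unit[OF V N P g]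
      unit_map_in[OF V M] compose_eq nonexp_in[OF f])

text \<open>The image contains the generators of the target, as \<open>f\<close> is onto, and it is
  closed under the operations.\<close>

lemma fmap_surj:
  assumes V: "basic_variety lam V" and M: "M \<in> Obj Met" and N: "N \<in> Obj Met" and f: "f \<in> nonexp M N"
    and surj: "f ` pts M = pts N"
  shows "fmap V M N f ` pts (TV V M) = pts (TV V N)"
proof
  show "fmap V M N f ` pts (TV V M) \<subseteq> pts (TV V N)" using fmap_in[OF V M N f] by blast
  show "pts (TV V N) \<subseteq> fmap V M N f ` pts (TV V M)"
  proof
    fix p assume "p \<in> pts (TV V N)"
    with V N show "p \<in> fmap V M N f ` pts (TV V M)"
    proof (induction rule: FA_induct)
      case (gen y)
      then obtain x where x: "x \<in> pts M" "y = f x" using surj by blast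
      then show ?case using fmap_unit[OF V M N f x(1)] unit_map_in[OF V M x(1)] by (metis image_eqI)
    next
      case (op \<sigma> a)
      then have "\<forall>i\<in>args lam (sig V) \<sigma>. \<exists>c. c \<in> pts (TV V M) \<and> a i = fmap V M N f c" by blast
      then obtain c where c: "\<And>i. i \<in> args lam (sig V) \<sigma> \<Longrightarrow> c i \<in> pts (TV V M) \<and> a i = fmap V M N f (c i)" by metis
      let ?c = "\<lambda>i\<in>args lam (sig V) \<sigma>. c i"
      have c': "?c \<in> args lam (sig V) \<sigma> \<rightarrow>\<^sub>E pts (qspace (FA V M))" using c by (auto simp: TV_def)
      have "(\<lambda>i\<in>args lam (sig V) \<sigma>. fmap V M N f (?c i)) = a"
        using c op.hyps(2) by (intro extensionalityI[of _ "args lam (sig V) \<sigma>"]) (auto simp: PiE_def)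
      then have "interp (FA V N) \<sigma> a = fmap V M N f (interp (FA V M) \<sigma> ?c)"
        using qalg_hom_interp[OF fmap_hom[OF V M N f] op.hyps(1) c'] by simp
      moreover have "interp (FA V M) \<sigma> ?c \<in> pts (TV V M)"
        unfolding TV_def by (rule qalg_interp_in[OF FA_qalg[OF V M] op.hyps(1) c'])
      ultimately show ?case by blast
    qed
  qed
qed

text \<open>The elements that satisfy the bound include the generators and are closed under the
  operations, because these are nonexpanding for the supremum metric on tuples.\<close>

lemma fmap_enriched:
  assumes V: "basic_variety lam V" and M: "M \<in> Obj Met" and N: "N \<in> Obj Met"
    and f: "f \<in> nonexp M N" and g: "g \<in> nonexp M N"
  shows "sup_dist (TV V M) (TV V N) (fmap V M N f) (fmap V M N g) \<le> sup_dist M N f g"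
  unfolding sup_dist_def[of "TV V M"]
proof (rule SUP_least)
  fix p assume "p \<in> pts (TV V M)"
  with V M show "edist (TV V N) (fmap V M N f p) (fmap V M N g p) \<le> sup_dist M N f g"
  proof (induction rule: FA_induct)
    case (gen x)
    have "edist (TV V N) (unit_map V N (f x)) (unit_map V N (g x)) \<le> edist N (f x) (g x)"
      using gen f g by (intro nonexp_le[OF unit_map_nonexp[OF V N]]) (auto intro: nonexp_in)
    also have "\<dots> \<le> sup_dist M N f g" unfolding sup_dist_def using gen by (rule SUP_upper)
    finally show ?case using gen by (simp add: fmap_unit[OF V M N] f g)
  next
    case (op \<sigma> a)
    have a: "a \<in> args lam (sig V) \<sigma> \<rightarrow>\<^sub>E pts (qspace (FA V M))" using op.hyps by (simp add: TV_def)
    have "edist (TV V N) (fmap V M N f (interp (FA V M) \<sigma> a)) (fmap V M N g (interp (FA V M) \<sigma> a)) \<le>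
      (SUP i\<in>args lam (sig V) \<sigma>. edist (TV V N) ((\<lambda>i\<in>args lam (sig V) \<sigma>. fmap V M N f (a i)) i) ((\<lambda>i\<in>args lam (sig V) \<sigma>. fmap V M N g (a i)) i))"
      unfolding qalg_hom_interp[OF fmap_hom[OF V M N f] op.hyps(1) a] qalg_hom_interp[OF fmap_hom[OF V M N g] op.hyps(1) a] TV_def
      by (rule qalg_interp_le[OF FA_qalg[OF V N] op.hyps(1)])
        (use fmap_in[OF V M N f] fmap_in[OF V M N g] op.hyps(2) in \<open>auto simp: TV_def\<close>)
    also have "\<dots> \<le> sup_dist M N f g" using op.IH by (intro SUP_least) simp
    finally show ?case .
  qed
qed

definition var_monad :: "'u variety \<Rightarrow> ('u emet, 'u \<Rightarrow> 'u) monad" where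
  "var_monad V = \<lparr>Fun = mk_func Met (TV V) (fmap V), munit = (\<lambda>M\<in>Obj Met. unit_map V M),
     mmult = (\<lambda>M\<in>Obj Met. mult_map V M)\<rparr>"

lemma var_monad_simps [simp]:
  "M \<in> Obj Met \<Longrightarrow> fo (Fun (var_monad V)) M = TV V M"
  "M \<in> Obj Met \<Longrightarrow> N \<in> Obj Met \<Longrightarrow> f \<in> nonexp M N \<Longrightarrow> fm (Fun (var_monad V)) M N f = fmap V M N f"
  "M \<in> Obj Met \<Longrightarrow> munit (var_monad V) M = unit_map V M"
  "M \<in> Obj Met \<Longrightarrow> mmult (var_monad V) M = mult_map V M"
  by (simp_all add: var_monad_def)

lemma is_functor_var_monad: "basic_variety lam V \<Longrightarrow> is_functor Met Met (Fun (var_monad V))"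
  unfolding var_monad_def monad.simps
  by (rule is_functor_mk_funcI)
    (simp_all add: TV_Obj fmap_nonexp nonexp_ident fmap_ident nonexp_compose fmap_compose)

lemma is_monad_var_monad:
  assumes V: "basic_variety lam V"
  shows "is_monad Met (var_monad V)"
  unfolding is_monad_def Let_def
proof (intro conjI ballI)
  show "is_functor Met Met (Fun (var_monad V))" by (rule is_functor_var_monad[OF V])
  have nat1: "compose (pts M) (unit_map V N) f = compose (pts M) (fmap V M N f) (unit_map V M)"
    if "M \<in> Obj Met" "N \<in> Obj Met" "f \<in> nonexp M N" for M N f
    using fmap_unit[OF V that] by (intro extensionalityI[of _ "pts M"]) (auto simp: compose_eq)
  then show "munit (var_monad V) \<in> nat_trans Met Met (id_func Met) (Fun (var_monad V))"
    unfolding nat_trans_def by (auto simp: id_func_def unit_map_nonexp[OF V]) (simp add: var_monad_def)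
  have nat2: "compose (pts (TV V (TV V M))) (mult_map V N) (fmap V (TV V M) (TV V N) (fmap V M N f)) =
      compose (pts (TV V (TV V M))) (fmap V M N f) (mult_map V M)"
    if M: "M \<in> Obj Met" and N: "N \<in> Obj Met" and f: "f \<in> nonexp M N" for M N f
  proof -
    note TM = TV_Obj[OF V M] and TN = TV_Obj[OF V N] and Tf = fmap_nonexp[OF V M N f]
    show ?thesis
      by (rule FA_hom_eqI[OF V TM FA_hom_compose[OF V TM fmap_hom[OF V TM TN Tf] mult_map_hom[OF V N]]
            FA_hom_compose[OF V TM mult_map_hom[OF V M] fmap_hom[OF V M N f]]])
        (simp add: compose_eq unit_map_in[OF V TM] fmap_unit[OF V TM TN Tf] mult_map_unit[OF V M] mult_map_unit[OF V N]
          nonexp_in[OF Tf])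
  qed
  then show "mmult (var_monad V) \<in> nat_trans Met Met (comp_func Met (Fun (var_monad V)) (Fun (var_monad V))) (Fun (var_monad V))"
    unfolding nat_trans_def
    by (auto simp: comp_func_def TV_Obj[OF V] fmap_nonexp[OF V] mult_map_nonexp[OF V]) (simp add: var_monad_def)
  fix M assume M: "M \<in> Obj (Met :: ('u emet, _) mcat)"
  note TM = TV_Obj[OF V M] and TTM = TV_Obj[OF V TV_Obj[OF V M]] and u = unit_map_nonexp[OF V M]
  note mu = mult_map_nonexp[OF V M]
  let ?F = "fo (Fun (var_monad V))"
  have "compose (pts (TV V M)) (mult_map V M) (unit_map V (TV V M)) = (\<lambda>x\<in>pts (TV V M). x)"
    by (rule extensionalityI[of _ "pts (TV V M)"]) (auto simp: compose_eq mult_map_unit[OF V M])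
  then show "Comp Met (?F M) (?F (?F M)) (?F M) (mmult (var_monad V) M) (munit (var_monad V) (?F M)) = Ident Met (?F M)"
    using M TM by simp
  have "compose (pts (TV V M)) (mult_map V M) (fmap V M (TV V M) (unit_map V M)) = (\<lambda>x\<in>pts (TV V M). x)"
    by (rule FA_hom_eqI[OF V M FA_hom_compose[OF V M fmap_hom[OF V M TM u] mult_map_hom[OF V M]]
          qalg_hom_ident[OF FA_qalg[OF V M], folded TV_def]])
      (simp add: compose_eq unit_map_in[OF V M] fmap_unit[OF V M TM u] mult_map_unit[OF V M])
  then show "Comp Met (?F M) (?F (?F M)) (?F M) (mmult (var_monad V) M) (fm (Fun (var_monad V)) M (?F M) (munit (var_monad V) M)) = Ident Met (?F M)"
    using M TM u by simp
  have "compose (pts (TV V (TV V (TV V M)))) (mult_map V M) (mult_map V (TV V M)) =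
      compose (pts (TV V (TV V (TV V M)))) (mult_map V M) (fmap V (TV V (TV V M)) (TV V M) (mult_map V M))"
    by (rule FA_hom_eqI[OF V TTM FA_hom_compose[OF V TTM mult_map_hom[OF V TM] mult_map_hom[OF V M]]
         FA_hom_compose[OF V TTM fmap_hom[OF V TTM TM mu] mult_map_hom[OF V M]]])
      (simp add: compose_eq unit_map_in[OF V TTM] fmap_unit[OF V TTM TM mu] mult_map_unit[OF V TM] mult_map_unit[OF V M]
         mult_map_in[OF V M])
  then show "Comp Met (?F (?F (?F M))) (?F (?F M)) (?F M) (mmult (var_monad V) M) (mmult (var_monad V) (?F M)) =
      Comp Met (?F (?F (?F M))) (?F (?F M)) (?F M) (mmult (var_monad V) M) (fm (Fun (var_monad V)) (?F (?F M)) (?F M) (mmult (var_monad V) M))"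
    using M TM TTM mu by simp
qed

section \<open>Accessibility of the monad of a variety\<close>

lemma TV_directed_diagram:
  assumes V: "basic_variety lam V" and D: "directed_diagram lam I r X b"
  shows "directed_diagram lam I r (\<lambda>i. TV V (X i)) (\<lambda>i j. fmap V (X i) (X j) (b i j))"
proof -
  interpret directed_diagram lam I r X b by (rule D)
  show ?thesis
  proof unfold_locales
    show "TV V (X i) \<in> Obj Met" if "i \<in> I" for i using that by (intro TV_Obj[OF V] X_Obj)
    show "fmap V (X i) (X j) (b i j) \<in> nonexp (TV V (X i)) (TV V (X j))" if "(i, j) \<in> r" for i j
      using that r_I by (intro fmap_nonexp[OF V] X_Obj b_nonexp)
    show "fmap V (X i) (X i) (b i i) p = p" if i: "i \<in> I" and p: "p \<in> pts (TV V (X i))" for i p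
    proof -
      have "b i i = (\<lambda>x\<in>pts (X i). x)"
        by (rule nonexp_eqI[OF b_nonexp[OF r_refl[OF i]] nonexp_ident]) (simp add: b_id[OF i])
      then show ?thesis using fmap_ident[OF V X_Obj[OF i]] p by simp
    qed
    show "fmap V (X j) (X k) (b j k) (fmap V (X i) (X j) (b i j) p) = fmap V (X i) (X k) (b i k) p"
      if ij: "(i, j) \<in> r" and jk: "(j, k) \<in> r" and p: "p \<in> pts (TV V (X i))" for i j k p
    proof -
      have "b i k = compose (pts (X i)) (b j k) (b i j)"
        by (rule nonexp_eqI[OF b_nonexp[OF r_trans[OF ij jk]] nonexp_compose[OF b_nonexp[OF ij] b_nonexp[OF jk]]])
          (simp add: compose_eq b_comp[OF ij jk])
      then show ?thesis
        using fmap_compose[OF V X_Obj X_Obj X_Obj b_nonexp[OF ij] b_nonexp[OF jk]] p r_I[OF ij] r_I[OF jk]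
        by (simp add: compose_eq)
    qed
  qed (use small_I directed in auto)
qed

text \<open>The free algebra on \<open>M\<close> is compared with the colimit algebra
  \<open>A\<close> of the free algebras on the stages. The images of the maps \<open>?g i\<close>
  together contain the generators and are closed under the operations, so they exhaust it; the
  homomorphism \<open>k\<close> into \<open>A\<close> shows that its distances are not smaller than
  those of the colimit.\<close>

lemma TV_good_cocone:
  assumes V: "basic_variety lam V" and D: "directed_diagram lam I r X b"
    and c: "directed_diagram.good_cocone I r X b M \<gamma>"
  shows "directed_diagram.good_cocone I r (\<lambda>i. TV V (X i)) (\<lambda>i j. fmap V (X i) (X j) (b i j)) (TV V M)
    (\<lambda>i. fmap V (X i) M (\<gamma> i))"
proof -
  interpret X: directed_diagram lam I r X b by (rule D)
  interpret T: directed_diagram lam I r "\<lambda>i. TV V (X i)" "\<lambda>i j. fmap V (X i) (X j) (b i j)"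
    by (rule TV_directed_diagram[OF V D])
  note G = X.good_coconeD[OF c]
  note M = G(1)
  let ?b = "\<lambda>i j. fmap V (X i) (X j) (b i j)" and ?g = "\<lambda>i. fmap V (X i) M (\<gamma> i)"
  have hom_b: "?b i j \<in> qalg_hom lam (sig V) (FA V (X i)) (FA V (X j))" if "(i, j) \<in> r" for i j
    using that X.r_I by (intro fmap_hom[OF V] X.X_Obj X.b_nonexp)
  have hom_g: "?g i \<in> qalg_hom lam (sig V) (FA V (X i)) (FA V M)" if "i \<in> I" for i
    using that by (intro fmap_hom[OF V] X.X_Obj G)
  have g: "?g i \<in> nonexp (TV V (X i)) (TV V M)" if "i \<in> I" for i
    using that by (intro fmap_nonexp[OF V] X.X_Obj G)
  have compat: "?g j (?b i j p) = ?g i p" if ij: "(i, j) \<in> r" and p: "p \<in> pts (TV V (X i))" for i j p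
  proof -
    have "compose (pts (X i)) (\<gamma> j) (b i j) = \<gamma> i"
      by (rule nonexp_eqI[OF nonexp_compose[OF X.b_nonexp[OF ij] G(2)] G(2)]) (use G(3)[OF ij] X.r_I[OF ij] in \<open>simp_all add: compose_eq\<close>)
    then show ?thesis
      using fmap_compose[OF V X.X_Obj X.X_Obj M X.b_nonexp[OF ij] G(2)] p X.r_I[OF ij] by (metis compose_eq)
  qed
  obtain Q q where Q: "T.good_cocone Q q" by (rule T.good_cocone_exists)
  obtain A where A: "A \<in> algs V" "qspace A = Q" and q_hom: "\<And>i. i \<in> I \<Longrightarrow> q i \<in> qalg_hom lam (sig V) (FA V (X i)) A"
    using T.colimit_algebra[OF V FA_alg[OF V X.X_Obj] TV_def[symmetric] hom_b Q] by blast
  note GQ = T.good_coconeD[OF Q]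
  \<comment> \<open>The units of the stages assemble to a map on \<open>M\<close>, which then
    extends to the free algebra as \<open>k\<close>.\<close>
  obtain h where h: "h \<in> nonexp M Q" "\<And>i x. i \<in> I \<Longrightarrow> x \<in> pts (X i) \<Longrightarrow> h (\<gamma> i x) = compose (pts (X i)) (q i) (unit_map V (X i)) x"
  proof (rule X.good_cocone_factor[OF c])
    show "compose (pts (X i)) (q i) (unit_map V (X i)) \<in> nonexp (X i) Q" if "i \<in> I" for i
      using that by (intro nonexp_compose[OF unit_map_nonexp[OF V X.X_Obj] GQ(2)])
    show "compose (pts (X j)) (q j) (unit_map V (X j)) (b i j x) = compose (pts (X i)) (q i) (unit_map V (X i)) x"
      if ij: "(i, j) \<in> r" and x: "x \<in> pts (X i)" for i j x
      using GQ(3)[OF ij unit_map_in[OF V X.X_Obj[OF X.r_I(1)[OF ij]] x]]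
        fmap_unit[OF V X.X_Obj[OF X.r_I(1)[OF ij]] X.X_Obj[OF X.r_I(2)[OF ij]] X.b_nonexp[OF ij] x] x X.b_in[OF ij x]
      by (simp add: compose_eq)
    show "is_emet Q" using GQ(1) by (rule Obj_Met_emet)
  qed blast
  have h': "h \<in> nonexp M (qspace A)" using h(1) A(2) by simp
  define k where "k = fext V M A h"
  note k = fext[OF V M A(1) h', folded k_def]
  have kg: "k (?g i p) = q i p" if i: "i \<in> I" and p: "p \<in> pts (TV V (X i))" for i p
  proof -
    note Xi = X.X_Obj[OF i]
    have "compose (pts (TV V (X i))) k (?g i) = q i"
    proof (rule FA_hom_eqI[OF V Xi FA_hom_compose[OF V Xi hom_g[OF i] k(1)] q_hom[OF i]])
      fix x assume x: "x \<in> pts (X i)"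
      then show "compose (pts (TV V (X i))) k (?g i) (unit_map V (X i) x) = q i (unit_map V (X i) x)"
        using k(2)[OF nonexp_in[OF G(2)[OF i] x]] h(2)[OF i x]
        by (simp add: compose_eq unit_map_in[OF V Xi] fmap_unit[OF V Xi M G(2)[OF i]])
    qed
    then show ?thesis using p by (metis compose_eq)
  qed
  show ?thesis
    unfolding T.good_cocone_def
  proof (intro conjI ballI allI impI)
    show "TV V M \<in> Obj Met" by (rule TV_Obj[OF V M])
  next
    fix p assume "p \<in> pts (TV V M)"
    with V M show "\<exists>i\<in>I. \<exists>x\<in>pts (TV V (X i)). p = ?g i x"
    proof (induction rule: FA_induct)
      case (gen x)
      then obtain i y where "i \<in> I" "y \<in> pts (X i)" "x = \<gamma> i y" using G(4) by blast
      then show ?case using fmap_unit[OF V X.X_Obj M G(2)] unit_map_in[OF V X.X_Obj] by metis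
    next
      case (op \<sigma> a)
      let ?n = "args lam (sig V) \<sigma>"
      have "\<forall>j\<in>?n. \<exists>i p. i \<in> I \<and> p \<in> pts (TV V (X i)) \<and> a j = ?g i p" using op.IH by blast
      then obtain i p where ip: "\<And>j. j \<in> ?n \<Longrightarrow> i j \<in> I" "\<And>j. j \<in> ?n \<Longrightarrow> p j \<in> pts (TV V (X (i j)))"
        "\<And>j. j \<in> ?n \<Longrightarrow> a j = ?g (i j) (p j)" by metis
      have "i ` ?n \<subseteq> I" using ip by blast
      moreover have "|i ` ?n| <o lam" by (intro lt_image signature_arity_lt[OF variety_signature[OF V] op.hyps(1)])
      ultimately obtain z where z: "z \<in> I" "\<forall>j\<in>i ` ?n. (j, z) \<in> r" by (rule X.upper_bound)
      let ?c = "\<lambda>j\<in>?n. ?b (i j) z (p j)"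
      have c: "?c \<in> ?n \<rightarrow>\<^sub>E pts (qspace (FA V (X z)))" using T.b_in ip z by (auto simp: TV_def)
      have "(\<lambda>j\<in>?n. ?g z (?c j)) = a"
        using op.hyps(2) z ip compat by (intro extensionalityI[of _ ?n]) (auto simp: PiE_def)
      then have "interp (FA V M) \<sigma> a = ?g z (interp (FA V (X z)) \<sigma> ?c)"
        using qalg_hom_interp[OF hom_g[OF z(1)] op.hyps(1) c] by simp
      moreover have "interp (FA V (X z)) \<sigma> ?c \<in> pts (TV V (X z))"
        unfolding TV_def by (rule qalg_interp_in[OF FA_qalg[OF V X.X_Obj[OF z(1)]] op.hyps(1) c])
      ultimately show ?case using z(1) by blast
    qed
  next
    fix i j p p' assume *: "i \<in> I" "j \<in> I" "p \<in> pts (TV V (X i))" "p' \<in> pts (TV V (X j))"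
    show "edist (TV V M) (?g i p) (?g j p') = T.delta (i, p) (j, p')"
    proof (rule antisym)
      show "edist (TV V M) (?g i p) (?g j p') \<le> T.delta (i, p) (j, p')"
        by (rule T.cocone_le_delta[of ?g]) (use g compat * in blast)+
      have "T.delta (i, p) (j, p') = edist Q (k (?g i p)) (k (?g j p'))"
        using GQ(5)[OF *] kg[OF *(1,3)] kg[OF *(2,4)] by simp
      also have "\<dots> \<le> edist (TV V M) (?g i p) (?g j p')"
        using nonexp_le[OF qalg_hom_nonexp[OF k(1)], of "?g i p" "?g j p'"] nonexp_in[OF g[OF *(1)] *(3)] nonexp_in[OF g[OF *(2)] *(4)]
        by (simp add: A(2) TV_def)
      finally show "T.delta (i, p) (j, p') \<le> edist (TV V M) (?g i p) (?g j p')" .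
    qed
  qed (use g compat in auto)
qed

lemma basic_monad_var_monad:
  assumes V: "basic_variety lam V"
  shows "basic_monad lam (var_monad V)"
  unfolding basic_monad_def
proof (intro conjI ballI impI)
  show "is_monad Met (var_monad V)" by (rule is_monad_var_monad[OF V])
  show "enriched_functor Met Met (Fun (var_monad V))"
    unfolding enriched_functor_def by (auto simp: is_functor_var_monad[OF V] fmap_enriched[OF V])
  show "fm (Fun (var_monad V)) A B f ` pts (fo (Fun (var_monad V)) A) = pts (fo (Fun (var_monad V)) B)"
    if "A \<in> Obj Met" "B \<in> Obj Met" "f \<in> Mor Met A B" "f ` pts A = pts B" for A B f
    using that fmap_surj[OF V] by simp
  show "accessible lam Met Met (Fun (var_monad V))"
    unfolding accessible_def
  proof (intro allI impI)
    fix I :: "'u set" and r and D :: "('u, unit, 'u emet, 'u \<Rightarrow> 'u) func" and c \<gamma>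
    assume *: "small TYPE('u) I \<and> directed_poset lam I r \<and> is_functor (poset_cat I r) Met D \<and> is_colimit (poset_cat I r) Met D c \<gamma>"
    then have dd: "directed_diagram lam I r (fo D) (\<lambda>i j. fm D i j ())" by (intro functor_directed_diagram) auto
    interpret X: directed_diagram lam I r "fo D" "\<lambda>i j. fm D i j ()" by (rule dd)
    interpret T: directed_diagram lam I r "\<lambda>i. TV V (fo D i)" "\<lambda>i j. fmap V (fo D i) (fo D j) (fm D i j ())"
      by (rule TV_directed_diagram[OF V dd])
    have good: "X.good_cocone c \<gamma>" using * X.colimit_iff_good[of D] by simp
    note c = X.good_coconeD(1)[OF good] and \<gamma> = X.good_coconeD(2)[OF good]
    have "T.good_cocone (TV V c) (\<lambda>i. fmap V (fo D i) c (\<gamma> i))" by (rule TV_good_cocone[OF V dd good])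
    then have "T.good_cocone (TV V c) (\<lambda>i. fm (Fun (var_monad V)) (fo D i) c (\<gamma> i))"
      unfolding T.good_cocone_def using X.X_Obj c \<gamma> by (simp add: X.r_I cong: ball_cong)
    then have "is_colimit (poset_cat I r) Met (comp_func (poset_cat I r) (Fun (var_monad V)) D) (TV V c)
        (\<lambda>i. fm (Fun (var_monad V)) (fo D i) c (\<gamma> i))"
      by (subst T.colimit_iff_good) (simp_all add: comp_func_def X.poset_cat_simps X.X_Obj X.r_I X.b_nonexp)
    then show "is_colimit (poset_cat I r) Met (comp_func (poset_cat I r) (Fun (var_monad V)) D) (fo (Fun (var_monad V)) c)
        (\<lambda>i. fm (Fun (var_monad V)) (fo D i) c (\<gamma> i))" using c by simp
  qed
qed

end

subsection \<open>Concrete functors and monad morphisms\<close>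

lemma var_cat_simps [simp]:
  "Obj (var_cat lam V) = algs V" "Mor (var_cat lam V) = qalg_hom lam (sig V)"
  "Ident (var_cat lam V) A = (\<lambda>x\<in>pts (qspace A). x)"
  "Comp (var_cat lam V) A B C g f = compose (pts (qspace A)) g f"
  "hdist (var_cat lam V) A B = sup_dist (qspace A) (qspace B)"
  by (simp_all add: alg_cat_def)

text \<open>The forgetful functors leave maps as they are, so evaluating the equation of functors
  shows that \<open>F\<close> fixes underlying spaces and maps. A concrete functor is therefore
  known once its values on algebras are.\<close>

lemma concrete_functorD:
  assumes "concrete_functor lam V W F"
  shows "A \<in> algs V \<Longrightarrow> fo F A \<in> algs W" "A \<in> algs V \<Longrightarrow> qspace (fo F A) = qspace A"
    "A \<in> algs V \<Longrightarrow> B \<in> algs V \<Longrightarrow> f \<in> qalg_hom lam (sig V) A B \<Longrightarrow> fm F A B f = f"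
    "A \<in> algs V \<Longrightarrow> B \<in> algs V \<Longrightarrow> f \<in> qalg_hom lam (sig V) A B \<Longrightarrow> f \<in> qalg_hom lam (sig W) (fo F A) (fo F B)"
    "is_functor (var_cat lam V) (var_cat lam W) F"
proof -
  show F: "is_functor (var_cat lam V) (var_cat lam W) F"
    using assms by (simp add: concrete_functor_def enriched_functor_def)
  have eq: "comp_func (var_cat lam V) (forget lam W) F = forget lam V"
    using assms by (simp add: concrete_functor_def)
  show o: "fo F A \<in> algs W" if "A \<in> algs V" for A using is_functorD(1)[OF F] that by simp
  show "A \<in> algs V \<Longrightarrow> qspace (fo F A) = qspace A"
    using arg_cong[OF eq, of "\<lambda>G. fo G A"] o[of A] by (simp add: comp_func_def forget_def)
  assume AB: "A \<in> algs V" "B \<in> algs V" "f \<in> qalg_hom lam (sig V) A B"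
  have m: "fm F A B f \<in> qalg_hom lam (sig W) (fo F A) (fo F B)" using is_functorD(2)[OF F, of A B f] AB by simp
  show "fm F A B f = f"
    using arg_cong[OF eq, of "\<lambda>G. fm G A B f"] o AB m by (simp add: comp_func_def forget_def)
  with m show "f \<in> qalg_hom lam (sig W) (fo F A) (fo F B)" by simp
qed

lemma concrete_functor_eqI:
  assumes F: "concrete_functor lam V W F" and G: "concrete_functor lam V W G" and "\<And>A. A \<in> algs V \<Longrightarrow> fo F A = fo G A"
  shows "F = G"
  by (rule functor_eqI[OF concrete_functorD(5)[OF F] concrete_functorD(5)[OF G]])
    (simp_all add: assms(3) concrete_functorD(3)[OF F] concrete_functorD(3)[OF G])

section \<open>The category of varieties and concrete functors\<close>

context cardinal_universe
begin

lemma concrete_functorI: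
  assumes V: "basic_variety lam V"
    and "\<And>A. A \<in> algs V \<Longrightarrow> Fo A \<in> algs W" "\<And>A. A \<in> algs V \<Longrightarrow> qspace (Fo A) = qspace A"
    and "\<And>A B f. A \<in> algs V \<Longrightarrow> B \<in> algs V \<Longrightarrow> f \<in> qalg_hom lam (sig V) A B \<Longrightarrow> f \<in> qalg_hom lam (sig W) (Fo A) (Fo B)"
  shows "concrete_functor lam V W (mk_func (var_cat lam V) Fo (\<lambda>A B f. f))"
proof -
  have "is_functor (var_cat lam V) (var_cat lam W) (mk_func (var_cat lam V) Fo (\<lambda>A B f. f))"
    by (rule is_functor_mk_funcI) (use assms variety_alg[OF V] in \<open>auto intro: qalg_hom_ident qalg_hom_compose\<close>)
  moreover have "comp_func (var_cat lam V) (forget lam W) (mk_func (var_cat lam V) Fo (\<lambda>A B f. f)) = forget lam V"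
    unfolding comp_func_def forget_def by (rule mk_func_cong) (simp_all add: assms)
  ultimately show ?thesis by (simp add: concrete_functor_def enriched_functor_def assms)
qed

lemma id_func_concrete:
  assumes V: "basic_variety lam V"
  shows "concrete_functor lam V V (id_func (var_cat lam V))"
  unfolding id_func_def by (rule concrete_functorI[OF V]) simp_all

lemma comp_func_concrete:
  assumes V: "basic_variety lam V" and F: "concrete_functor lam V W F" and G: "concrete_functor lam W X G"
  shows "concrete_functor lam V X (comp_func (var_cat lam V) G F)"
proof -
  note F' = concrete_functorD[OF F] and G' = concrete_functorD[OF G]
  have "comp_func (var_cat lam V) G F = mk_func (var_cat lam V) (\<lambda>A. fo G (fo F A)) (\<lambda>A B f. f)"
    unfolding comp_func_def by (rule mk_func_cong) (simp_all add: F' G')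
  then show ?thesis using concrete_functorI[OF V, of "\<lambda>A. fo G (fo F A)" X] F' G' by simp
qed

lemma basic_varieties_cat_simps [simp]:
  "Obj (basic_varieties_cat lam) = {V. basic_variety lam V}"
  "Mor (basic_varieties_cat lam) V W = {F. concrete_functor lam V W F}"
  "Ident (basic_varieties_cat lam) V = id_func (var_cat lam V)"
  "Comp (basic_varieties_cat lam) V W X G F = comp_func (var_cat lam V) G F"
  by (simp_all add: basic_varieties_cat_def)

lemma is_category_basic_varieties: "is_category (basic_varieties_cat lam)"
  unfolding is_category_def
proof (intro conjI ballI)
  fix V W X Y F G H
  assume V: "V \<in> Obj (basic_varieties_cat lam)" and W: "W \<in> Obj (basic_varieties_cat lam)"
  then have V': "basic_variety lam V" and W': "basic_variety lam W" by simp_all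
  show "Ident (basic_varieties_cat lam) V \<in> Mor (basic_varieties_cat lam) V V" using id_func_concrete[OF V'] by simp
  assume "F \<in> Mor (basic_varieties_cat lam) V W"
  then have F: "concrete_functor lam V W F" by simp
  show "Comp (basic_varieties_cat lam) V V W F (Ident (basic_varieties_cat lam) V) = F"
    unfolding basic_varieties_cat_simps
    by (rule concrete_functor_eqI[OF comp_func_concrete[OF V' id_func_concrete[OF V'] F] F])
      (simp add: comp_func_def id_func_def)
  show "Comp (basic_varieties_cat lam) V W W (Ident (basic_varieties_cat lam) W) F = F"
    unfolding basic_varieties_cat_simps
    by (rule concrete_functor_eqI[OF comp_func_concrete[OF V' F id_func_concrete[OF W']] F])
      (simp add: comp_func_def id_func_def concrete_functorD(1)[OF F])
  assume X: "X \<in> Obj (basic_varieties_cat lam)" "G \<in> Mor (basic_varieties_cat lam) W X"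
  then have G: "concrete_functor lam W X G" by simp
  show "Comp (basic_varieties_cat lam) V W X G F \<in> Mor (basic_varieties_cat lam) V X"
    using comp_func_concrete[OF V' F G] by simp
  assume Y: "Y \<in> Obj (basic_varieties_cat lam)" "H \<in> Mor (basic_varieties_cat lam) X Y"
  then have H: "concrete_functor lam X Y H" by simp
  show "Comp (basic_varieties_cat lam) V X Y H (Comp (basic_varieties_cat lam) V W X G F) =
      Comp (basic_varieties_cat lam) V W Y (Comp (basic_varieties_cat lam) W X Y H G) F"
    unfolding basic_varieties_cat_simps
    by (rule concrete_functor_eqI[OF comp_func_concrete[OF V' comp_func_concrete[OF V' F G] H]
          comp_func_concrete[OF V' F comp_func_concrete[OF W' G H]]])
      (simp add: comp_func_def concrete_functorD(1)[OF F])
qed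

end

section \<open>Laws of monads and monad morphisms, read at points\<close>

lemma compose_apply_eq: "compose X g f = compose X k h \<Longrightarrow> x \<in> X \<Longrightarrow> g (f x) = k (h x)"
  by (metis compose_eq)

lemma is_monad_MetD:
  assumes "is_monad Met T"
  shows monad_functor: "is_functor Met Met (Fun T)"
    and monad_Obj: "A \<in> Obj Met \<Longrightarrow> fo (Fun T) A \<in> Obj Met"
    and monad_map: "A \<in> Obj Met \<Longrightarrow> B \<in> Obj Met \<Longrightarrow> f \<in> nonexp A B \<Longrightarrow> fm (Fun T) A B f \<in> nonexp (fo (Fun T) A) (fo (Fun T) B)"
    and monad_ident: "A \<in> Obj Met \<Longrightarrow> fm (Fun T) A A (\<lambda>x\<in>pts A. x) = (\<lambda>x\<in>pts (fo (Fun T) A). x)"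
    and monad_comp: "A \<in> Obj Met \<Longrightarrow> B \<in> Obj Met \<Longrightarrow> C \<in> Obj Met \<Longrightarrow> f \<in> nonexp A B \<Longrightarrow> g \<in> nonexp B C \<Longrightarrow>
      p \<in> pts (fo (Fun T) A) \<Longrightarrow> fm (Fun T) A C (compose (pts A) g f) p = fm (Fun T) B C g (fm (Fun T) A B f p)"
    and monad_unit: "A \<in> Obj Met \<Longrightarrow> munit T A \<in> nonexp A (fo (Fun T) A)"
    and monad_unit_nat: "A \<in> Obj Met \<Longrightarrow> B \<in> Obj Met \<Longrightarrow> f \<in> nonexp A B \<Longrightarrow> x \<in> pts A \<Longrightarrow>
      fm (Fun T) A B f (munit T A x) = munit T B (f x)"
    and monad_mult: "A \<in> Obj Met \<Longrightarrow> mmult T A \<in> nonexp (fo (Fun T) (fo (Fun T) A)) (fo (Fun T) A)"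
    and monad_mult_nat: "A \<in> Obj Met \<Longrightarrow> B \<in> Obj Met \<Longrightarrow> f \<in> nonexp A B \<Longrightarrow> p \<in> pts (fo (Fun T) (fo (Fun T) A)) \<Longrightarrow>
      mmult T B (fm (Fun T) (fo (Fun T) A) (fo (Fun T) B) (fm (Fun T) A B f) p) = fm (Fun T) A B f (mmult T A p)"
    and monad_left: "A \<in> Obj Met \<Longrightarrow> p \<in> pts (fo (Fun T) A) \<Longrightarrow> mmult T A (munit T (fo (Fun T) A) p) = p"
    and monad_right: "A \<in> Obj Met \<Longrightarrow> p \<in> pts (fo (Fun T) A) \<Longrightarrow>
      mmult T A (fm (Fun T) A (fo (Fun T) A) (munit T A) p) = p"
    and monad_assoc: "A \<in> Obj Met \<Longrightarrow> p \<in> pts (fo (Fun T) (fo (Fun T) (fo (Fun T) A))) \<Longrightarrow>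
      mmult T A (mmult T (fo (Fun T) A) p) = mmult T A (fm (Fun T) (fo (Fun T) (fo (Fun T) A)) (fo (Fun T) A) (mmult T A) p)"
proof -
  show F: "is_functor Met Met (Fun T)" using assms by (simp add: is_monad_def Let_def)
  note F' = is_functorD[OF F]
  show O: "A \<in> Obj Met \<Longrightarrow> fo (Fun T) A \<in> Obj Met" for A by (rule F'(1))
  show m: "A \<in> Obj Met \<Longrightarrow> B \<in> Obj Met \<Longrightarrow> f \<in> nonexp A B \<Longrightarrow> fm (Fun T) A B f \<in> nonexp (fo (Fun T) A) (fo (Fun T) B)" for A B f
    using F'(2)[of A B f] by simp
  show "A \<in> Obj Met \<Longrightarrow> fm (Fun T) A A (\<lambda>x\<in>pts A. x) = (\<lambda>x\<in>pts (fo (Fun T) A). x)" using F'(3)[of A] by simp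
  show "A \<in> Obj Met \<Longrightarrow> B \<in> Obj Met \<Longrightarrow> C \<in> Obj Met \<Longrightarrow> f \<in> nonexp A B \<Longrightarrow> g \<in> nonexp B C \<Longrightarrow>
      p \<in> pts (fo (Fun T) A) \<Longrightarrow> fm (Fun T) A C (compose (pts A) g f) p = fm (Fun T) B C g (fm (Fun T) A B f p)"
    using F'(4)[of A B C f g] by (simp add: compose_eq)
  have u: "munit T \<in> nat_trans Met Met (id_func Met) (Fun T)" using assms by (simp add: is_monad_def Let_def)
  then show "A \<in> Obj Met \<Longrightarrow> munit T A \<in> nonexp A (fo (Fun T) A)" by (simp add: nat_trans_def id_func_def)
  have "A \<in> Obj Met \<Longrightarrow> B \<in> Obj Met \<Longrightarrow> f \<in> nonexp A B \<Longrightarrow>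
      compose (pts A) (fm (Fun T) A B f) (munit T A) = compose (pts A) (munit T B) f"
    using u by (simp add: nat_trans_def id_func_def)
  then show "A \<in> Obj Met \<Longrightarrow> B \<in> Obj Met \<Longrightarrow> f \<in> nonexp A B \<Longrightarrow> x \<in> pts A \<Longrightarrow>
      fm (Fun T) A B f (munit T A x) = munit T B (f x)"
    by (blast intro: compose_apply_eq)
  have u: "mmult T \<in> nat_trans Met Met (comp_func Met (Fun T) (Fun T)) (Fun T)" using assms by (simp add: is_monad_def Let_def)
  then show "A \<in> Obj Met \<Longrightarrow> mmult T A \<in> nonexp (fo (Fun T) (fo (Fun T) A)) (fo (Fun T) A)" by (simp add: nat_trans_def comp_func_def)
  have "A \<in> Obj Met \<Longrightarrow> B \<in> Obj Met \<Longrightarrow> f \<in> nonexp A B \<Longrightarrow>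
      compose (pts (fo (Fun T) (fo (Fun T) A))) (mmult T B) (fm (Fun T) (fo (Fun T) A) (fo (Fun T) B) (fm (Fun T) A B f)) =
      compose (pts (fo (Fun T) (fo (Fun T) A))) (fm (Fun T) A B f) (mmult T A)"
    using u by (simp add: nat_trans_def comp_func_def)
  then show "A \<in> Obj Met \<Longrightarrow> B \<in> Obj Met \<Longrightarrow> f \<in> nonexp A B \<Longrightarrow> p \<in> pts (fo (Fun T) (fo (Fun T) A)) \<Longrightarrow>
      mmult T B (fm (Fun T) (fo (Fun T) A) (fo (Fun T) B) (fm (Fun T) A B f) p) = fm (Fun T) A B f (mmult T A p)"
    by (blast intro: compose_apply_eq)
  assume A: "A \<in> Obj Met"
  have L: "compose (pts (fo (Fun T) A)) (mmult T A) (munit T (fo (Fun T) A)) = (\<lambda>x\<in>pts (fo (Fun T) A). x)"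
    "compose (pts (fo (Fun T) A)) (mmult T A) (fm (Fun T) A (fo (Fun T) A) (munit T A)) = (\<lambda>x\<in>pts (fo (Fun T) A). x)"
    "compose (pts (fo (Fun T) (fo (Fun T) (fo (Fun T) A)))) (mmult T A) (mmult T (fo (Fun T) A)) =
     compose (pts (fo (Fun T) (fo (Fun T) (fo (Fun T) A)))) (mmult T A) (fm (Fun T) (fo (Fun T) (fo (Fun T) A)) (fo (Fun T) A) (mmult T A))"
    using assms A by (simp_all add: is_monad_def Let_def)
  show "p \<in> pts (fo (Fun T) A) \<Longrightarrow> mmult T A (munit T (fo (Fun T) A) p) = p"
    using fun_cong[OF L(1), of p] by (simp add: compose_eq)
  show "p \<in> pts (fo (Fun T) A) \<Longrightarrow> mmult T A (fm (Fun T) A (fo (Fun T) A) (munit T A) p) = p"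
    using fun_cong[OF L(2), of p] by (simp add: compose_eq)
  show "p \<in> pts (fo (Fun T) (fo (Fun T) (fo (Fun T) A))) \<Longrightarrow>
      mmult T A (mmult T (fo (Fun T) A) p) = mmult T A (fm (Fun T) (fo (Fun T) (fo (Fun T) A)) (fo (Fun T) A) (mmult T A) p)"
    by (rule compose_apply_eq[OF L(3)])
qed

lemma monad_morD:
  assumes "\<alpha> \<in> monad_mor Met S T"
  shows monad_mor_extensional: "\<alpha> \<in> extensional (Obj Met)"
    and monad_mor_nonexp: "A \<in> Obj Met \<Longrightarrow> \<alpha> A \<in> nonexp (fo (Fun S) A) (fo (Fun T) A)"
    and monad_mor_nat: "A \<in> Obj Met \<Longrightarrow> B \<in> Obj Met \<Longrightarrow> f \<in> nonexp A B \<Longrightarrow> p \<in> pts (fo (Fun S) A) \<Longrightarrow>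
      \<alpha> B (fm (Fun S) A B f p) = fm (Fun T) A B f (\<alpha> A p)"
    and monad_mor_unit: "A \<in> Obj Met \<Longrightarrow> x \<in> pts A \<Longrightarrow> \<alpha> A (munit S A x) = munit T A x"
    and monad_mor_mult: "A \<in> Obj Met \<Longrightarrow> p \<in> pts (fo (Fun S) (fo (Fun S) A)) \<Longrightarrow>
      \<alpha> A (mmult S A p) = mmult T A (fm (Fun T) (fo (Fun S) A) (fo (Fun T) A) (\<alpha> A) (\<alpha> (fo (Fun S) A) p))"
proof -
  have n: "\<alpha> \<in> nat_trans Met Met (Fun S) (Fun T)" using assms by (simp add: monad_mor_def Let_def)
  then show "\<alpha> \<in> extensional (Obj Met)" "A \<in> Obj Met \<Longrightarrow> \<alpha> A \<in> nonexp (fo (Fun S) A) (fo (Fun T) A)"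
    by (simp_all add: nat_trans_def)
  have "A \<in> Obj Met \<Longrightarrow> B \<in> Obj Met \<Longrightarrow> f \<in> nonexp A B \<Longrightarrow>
     compose (pts (fo (Fun S) A)) (\<alpha> B) (fm (Fun S) A B f) = compose (pts (fo (Fun S) A)) (fm (Fun T) A B f) (\<alpha> A)"
    using n by (simp add: nat_trans_def)
  then show "A \<in> Obj Met \<Longrightarrow> B \<in> Obj Met \<Longrightarrow> f \<in> nonexp A B \<Longrightarrow> p \<in> pts (fo (Fun S) A) \<Longrightarrow>
      \<alpha> B (fm (Fun S) A B f p) = fm (Fun T) A B f (\<alpha> A p)" by (blast intro: compose_apply_eq)
  have L: "A \<in> Obj Met \<Longrightarrow> compose (pts A) (\<alpha> A) (munit S A) = munit T A"
    "A \<in> Obj Met \<Longrightarrow> compose (pts (fo (Fun S) (fo (Fun S) A))) (\<alpha> A) (mmult S A) =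
      compose (pts (fo (Fun S) (fo (Fun S) A))) (mmult T A) (compose (pts (fo (Fun S) (fo (Fun S) A)))
        (fm (Fun T) (fo (Fun S) A) (fo (Fun T) A) (\<alpha> A)) (\<alpha> (fo (Fun S) A)))"
    using assms by (simp_all add: monad_mor_def Let_def)
  show "A \<in> Obj Met \<Longrightarrow> x \<in> pts A \<Longrightarrow> \<alpha> A (munit S A x) = munit T A x"
    using fun_cong[OF L(1), of x] by (simp add: compose_eq)
  show "A \<in> Obj Met \<Longrightarrow> p \<in> pts (fo (Fun S) (fo (Fun S) A)) \<Longrightarrow>
      \<alpha> A (mmult S A p) = mmult T A (fm (Fun T) (fo (Fun S) A) (fo (Fun T) A) (\<alpha> A) (\<alpha> (fo (Fun S) A) p))"
    using fun_cong[OF L(2), of p] by (simp add: compose_eq)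
qed

lemma monad_morI:
  assumes T: "is_monad Met T" and "\<alpha> \<in> extensional (Obj Met)"
    and "\<And>A. A \<in> Obj Met \<Longrightarrow> \<alpha> A \<in> nonexp (fo (Fun S) A) (fo (Fun T) A)"
    and "\<And>A B f p. A \<in> Obj Met \<Longrightarrow> B \<in> Obj Met \<Longrightarrow> f \<in> nonexp A B \<Longrightarrow> p \<in> pts (fo (Fun S) A) \<Longrightarrow>
      \<alpha> B (fm (Fun S) A B f p) = fm (Fun T) A B f (\<alpha> A p)"
    and "\<And>A x. A \<in> Obj Met \<Longrightarrow> x \<in> pts A \<Longrightarrow> \<alpha> A (munit S A x) = munit T A x"
    and "\<And>A p. A \<in> Obj Met \<Longrightarrow> p \<in> pts (fo (Fun S) (fo (Fun S) A)) \<Longrightarrow>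
      \<alpha> A (mmult S A p) = mmult T A (fm (Fun T) (fo (Fun S) A) (fo (Fun T) A) (\<alpha> A) (\<alpha> (fo (Fun S) A) p))"
  shows "\<alpha> \<in> monad_mor Met S T"
proof -
  have "compose (pts (fo (Fun S) A)) (\<alpha> B) (fm (Fun S) A B f) = compose (pts (fo (Fun S) A)) (fm (Fun T) A B f) (\<alpha> A)"
    if "A \<in> Obj Met" "B \<in> Obj Met" "f \<in> nonexp A B" for A B f
    using assms(4)[OF that] by (intro extensionalityI[of _ "pts (fo (Fun S) A)"]) (auto simp: compose_eq)
  moreover have "compose (pts A) (\<alpha> A) (munit S A) = munit T A" if "A \<in> Obj Met" for A
    using assms(5)[OF that] nonexp_extensional[OF monad_unit[OF T that]]
    by (intro extensionalityI[of _ "pts A"]) (auto simp: compose_eq)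
  moreover have "compose (pts (fo (Fun S) (fo (Fun S) A))) (\<alpha> A) (mmult S A) =
      compose (pts (fo (Fun S) (fo (Fun S) A))) (mmult T A) (compose (pts (fo (Fun S) (fo (Fun S) A)))
        (fm (Fun T) (fo (Fun S) A) (fo (Fun T) A) (\<alpha> A)) (\<alpha> (fo (Fun S) A)))" if "A \<in> Obj Met" for A
    using assms(6)[OF that] by (intro extensionalityI[of _ "pts (fo (Fun S) (fo (Fun S) A))"]) (auto simp: compose_eq)
  ultimately show ?thesis using assms(2,3) by (simp add: monad_mor_def Let_def nat_trans_def)
qed

lemma monad_mor_in: "\<alpha> \<in> monad_mor Met S T \<Longrightarrow> A \<in> Obj Met \<Longrightarrow> p \<in> pts (fo (Fun S) A) \<Longrightarrow> \<alpha> A p \<in> pts (fo (Fun T) A)"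
  by (rule nonexp_in[OF monad_mor_nonexp])

lemma monad_mor_ident:
  assumes T: "is_monad Met T"
  shows "(\<lambda>A\<in>Obj Met. \<lambda>x\<in>pts (fo (Fun T) A). x) \<in> monad_mor Met T T"
proof (rule monad_morI[OF T])
  fix A p assume A: "A \<in> Obj Met" and p: "p \<in> pts (fo (Fun T) (fo (Fun T) A))"
  note TA = monad_Obj[OF T A]
  show "(\<lambda>A\<in>Obj Met. \<lambda>x\<in>pts (fo (Fun T) A). x) A (mmult T A p) = mmult T A (fm (Fun T) (fo (Fun T) A) (fo (Fun T) A)
     ((\<lambda>A\<in>Obj Met. \<lambda>x\<in>pts (fo (Fun T) A). x) A) ((\<lambda>A\<in>Obj Met. \<lambda>x\<in>pts (fo (Fun T) A). x) (fo (Fun T) A) p))"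
    using nonexp_in[OF monad_mult[OF T A] p] A TA p by (simp add: monad_ident[OF T TA])
next
  show "(\<lambda>A\<in>Obj Met. \<lambda>x\<in>pts (fo (Fun T) A). x) B (fm (Fun T) A B f p) = fm (Fun T) A B f ((\<lambda>A\<in>Obj Met. \<lambda>x\<in>pts (fo (Fun T) A). x) A p)"
    if "A \<in> Obj Met" "B \<in> Obj Met" "f \<in> nonexp A B" "p \<in> pts (fo (Fun T) A)" for A B f p
    using that nonexp_in[OF monad_map[OF T that(1-3)]] by simp
  show "(\<lambda>A\<in>Obj Met. \<lambda>x\<in>pts (fo (Fun T) A). x) A (munit T A x) = munit T A x"
    if "A \<in> Obj Met" "x \<in> pts A" for A x using that nonexp_in[OF monad_unit[OF T that(1)]] by simp
qed (auto simp: nonexp_ident)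

lemma monad_mor_compose:
  assumes R: "is_monad Met R" and S: "is_monad Met S" and T: "is_monad Met T"
    and a: "\<alpha> \<in> monad_mor Met R S" and b: "\<beta> \<in> monad_mor Met S T"
  shows "(\<lambda>A\<in>Obj Met. compose (pts (fo (Fun R) A)) (\<beta> A) (\<alpha> A)) \<in> monad_mor Met R T" (is "?c \<in> _")
proof (rule monad_morI[OF T])
  show n: "?c A \<in> nonexp (fo (Fun R) A) (fo (Fun T) A)" if "A \<in> Obj Met" for A
    using that nonexp_compose[OF monad_mor_nonexp[OF a that] monad_mor_nonexp[OF b that]] by simp
  show "?c B (fm (Fun R) A B f p) = fm (Fun T) A B f (?c A p)"
    if "A \<in> Obj Met" "B \<in> Obj Met" "f \<in> nonexp A B" "p \<in> pts (fo (Fun R) A)" for A B f p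
    using that nonexp_in[OF monad_map[OF R that(1-3)] that(4)] monad_mor_in[OF a that(1,4)]
    by (simp add: compose_eq monad_mor_nat[OF a] monad_mor_nat[OF b])
  show "?c A (munit R A x) = munit T A x" if "A \<in> Obj Met" "x \<in> pts A" for A x
    using that nonexp_in[OF monad_unit[OF R that(1)] that(2)]
    by (simp add: compose_eq monad_mor_unit[OF a] monad_mor_unit[OF b])
  fix A p assume A: "A \<in> Obj Met" and p: "p \<in> pts (fo (Fun R) (fo (Fun R) A))"
  note RA = monad_Obj[OF R A] and SA = monad_Obj[OF S A] and TA = monad_Obj[OF T A]
  note aA = monad_mor_nonexp[OF a A] and bA = monad_mor_nonexp[OF b A]
  have ap: "\<alpha> (fo (Fun R) A) p \<in> pts (fo (Fun S) (fo (Fun R) A))" by (rule monad_mor_in[OF a RA p])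
  have "\<beta> A (\<alpha> A (mmult R A p)) = \<beta> A (mmult S A (fm (Fun S) (fo (Fun R) A) (fo (Fun S) A) (\<alpha> A) (\<alpha> (fo (Fun R) A) p)))"
    by (simp add: monad_mor_mult[OF a A p])
  also have "\<dots> = mmult T A (fm (Fun T) (fo (Fun S) A) (fo (Fun T) A) (\<beta> A) (\<beta> (fo (Fun S) A) (fm (Fun S) (fo (Fun R) A) (fo (Fun S) A) (\<alpha> A) (\<alpha> (fo (Fun R) A) p))))"
    by (rule monad_mor_mult[OF b A nonexp_in[OF monad_map[OF S RA SA aA] ap]])
  also have "\<beta> (fo (Fun S) A) (fm (Fun S) (fo (Fun R) A) (fo (Fun S) A) (\<alpha> A) (\<alpha> (fo (Fun R) A) p)) =
     fm (Fun T) (fo (Fun R) A) (fo (Fun S) A) (\<alpha> A) (\<beta> (fo (Fun R) A) (\<alpha> (fo (Fun R) A) p))"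
    by (rule monad_mor_nat[OF b RA SA aA ap])
  also have "fm (Fun T) (fo (Fun S) A) (fo (Fun T) A) (\<beta> A) \<dots> = fm (Fun T) (fo (Fun R) A) (fo (Fun T) A) (compose (pts (fo (Fun R) A)) (\<beta> A) (\<alpha> A)) (\<beta> (fo (Fun R) A) (\<alpha> (fo (Fun R) A) p))"
    by (rule monad_comp[OF T RA SA TA aA bA monad_mor_in[OF b RA ap], symmetric])
  finally show "?c A (mmult R A p) = mmult T A (fm (Fun T) (fo (Fun R) A) (fo (Fun T) A) (?c A) (?c (fo (Fun R) A) p))"
    using A RA p nonexp_in[OF monad_mult[OF R A] p] by (simp add: compose_eq)
qed simp

lemma monad_mor_eqI:
  assumes "\<alpha> \<in> monad_mor Met S T" "\<beta> \<in> monad_mor Met S T'"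
    and "\<And>A p. A \<in> Obj Met \<Longrightarrow> p \<in> pts (fo (Fun S) A) \<Longrightarrow> \<alpha> A p = \<beta> A p"
  shows "\<alpha> = \<beta>"
  by (rule extensionalityI[OF monad_mor_extensional[OF assms(1)] monad_mor_extensional[OF assms(2)]])
    (rule nonexp_eqI[OF monad_mor_nonexp[OF assms(1)] monad_mor_nonexp[OF assms(2)]]; simp add: assms(3))

lemma basic_monad_is_monad: "basic_monad lam T \<Longrightarrow> is_monad Met T"
  by (simp add: basic_monad_def)

lemma basic_monads_cat_simps [simp]:
  "Obj (basic_monads_cat lam) = {T. basic_monad lam T}"
  "Mor (basic_monads_cat lam) = monad_mor Met"
  "Ident (basic_monads_cat lam) T = (\<lambda>A\<in>Obj Met. \<lambda>x\<in>pts (fo (Fun T) A). x)"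
  "Comp (basic_monads_cat lam) R S T \<beta> \<alpha> = (\<lambda>A\<in>Obj Met. compose (pts (fo (Fun R) A)) (\<beta> A) (\<alpha> A))"
  by (simp_all add: basic_monads_cat_def)

lemma is_category_basic_monads: "is_category (basic_monads_cat lam)"
  unfolding is_category_def
proof (intro conjI ballI)
  fix R S T U \<alpha> \<beta> \<gamma>
  assume "R \<in> Obj (basic_monads_cat lam)" "S \<in> Obj (basic_monads_cat lam)"
  then have R: "is_monad Met R" and S: "is_monad Met S" by (simp_all add: basic_monad_is_monad)
  show "Ident (basic_monads_cat lam) R \<in> Mor (basic_monads_cat lam) R R" using monad_mor_ident[OF R] by simp
  assume "\<alpha> \<in> Mor (basic_monads_cat lam) R S"
  then have a: "\<alpha> \<in> monad_mor Met R S" by simp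
  show "Comp (basic_monads_cat lam) R R S \<alpha> (Ident (basic_monads_cat lam) R) = \<alpha>"
    unfolding basic_monads_cat_simps
    by (rule monad_mor_eqI[OF monad_mor_compose[OF R R S monad_mor_ident[OF R] a] a]) (simp add: compose_eq)
  show "Comp (basic_monads_cat lam) R S S (Ident (basic_monads_cat lam) S) \<alpha> = \<alpha>"
    unfolding basic_monads_cat_simps
    by (rule monad_mor_eqI[OF monad_mor_compose[OF R S S a monad_mor_ident[OF S]] a]) (simp add: compose_eq monad_mor_in[OF a])
  assume "T \<in> Obj (basic_monads_cat lam)" "\<beta> \<in> Mor (basic_monads_cat lam) S T"
  then have T: "is_monad Met T" and b: "\<beta> \<in> monad_mor Met S T" by (simp_all add: basic_monad_is_monad)
  show "Comp (basic_monads_cat lam) R S T \<beta> \<alpha> \<in> Mor (basic_monads_cat lam) R T"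
    using monad_mor_compose[OF R S T a b] by simp
  assume "U \<in> Obj (basic_monads_cat lam)" "\<gamma> \<in> Mor (basic_monads_cat lam) T U"
  then have U: "is_monad Met U" and c: "\<gamma> \<in> monad_mor Met T U" by (simp_all add: basic_monad_is_monad)
  show "Comp (basic_monads_cat lam) R T U \<gamma> (Comp (basic_monads_cat lam) R S T \<beta> \<alpha>) =
      Comp (basic_monads_cat lam) R S U (Comp (basic_monads_cat lam) S T U \<gamma> \<beta>) \<alpha>"
    unfolding basic_monads_cat_simps
    by (rule monad_mor_eqI[OF monad_mor_compose[OF R T U monad_mor_compose[OF R S T a b] c]
        monad_mor_compose[OF R S U a monad_mor_compose[OF S T U b c]]])
      (simp add: compose_eq monad_mor_in[OF a])
qed

section \<open>From concrete functors to monad morphisms\<close>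

context cardinal_universe
begin

text \<open>The functor \<open>F\<close> keeps the space \<open>TV W M\<close>, so
  \<open>fo F (FA W M)\<close> is an algebra of \<open>V\<close> on it, with \<open>M\<close> mapped
  in by the unit of \<open>W\<close>. The homomorphism from the free algebra of \<open>V\<close> is
  the component at \<open>M\<close> of the monad morphism, whose direction is thus opposite to that
  of \<open>F\<close>.\<close>

definition ind_map :: "'u variety \<Rightarrow> 'u variety \<Rightarrow> (('u, 'u) qalg, 'u \<Rightarrow> 'u, ('u, 'u) qalg, 'u \<Rightarrow> 'u) func \<Rightarrow>
    'u emet \<Rightarrow> 'u \<Rightarrow> 'u" where
  "ind_map V W F M = fext V M (fo F (FA W M)) (unit_map W M)"

definition ind_mor :: "'u variety \<Rightarrow> 'u variety \<Rightarrow> (('u, 'u) qalg, 'u \<Rightarrow> 'u, ('u, 'u) qalg, 'u \<Rightarrow> 'u) func \<Rightarrow>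
    'u emet \<Rightarrow> 'u \<Rightarrow> 'u" where
  "ind_mor V W F = (\<lambda>M\<in>Obj Met. ind_map V W F M)"

lemma ind_map:
  assumes V: "basic_variety lam V" and W: "basic_variety lam W" and F: "concrete_functor lam W V F" and M: "M \<in> Obj Met"
  shows ind_map_hom: "ind_map V W F M \<in> qalg_hom lam (sig V) (FA V M) (fo F (FA W M))"
    and ind_map_nonexp: "ind_map V W F M \<in> nonexp (TV V M) (TV W M)"
    and ind_map_unit: "x \<in> pts M \<Longrightarrow> ind_map V W F M (unit_map V M x) = unit_map W M x"
proof -
  note F' = concrete_functorD[OF F]
  have u: "unit_map W M \<in> nonexp M (qspace (fo F (FA W M)))"
    using unit_map_nonexp[OF W M] F'(2)[OF FA_alg[OF W M]] by (simp add: TV_def)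
  note f = fext[OF V M F'(1)[OF FA_alg[OF W M]] u, folded ind_map_def]
  show "ind_map V W F M \<in> qalg_hom lam (sig V) (FA V M) (fo F (FA W M))" by (rule f)
  then show "ind_map V W F M \<in> nonexp (TV V M) (TV W M)"
    using qalg_hom_nonexp[OF f(1)] F'(2)[OF FA_alg[OF W M]] by (simp add: TV_def)
  show "x \<in> pts M \<Longrightarrow> ind_map V W F M (unit_map V M x) = unit_map W M x" by (rule f)
qed

text \<open>\<open>F\<close> turns homomorphisms of \<open>W\<close>, such as \<open>fmap W\<close>
  and the multiplication of \<open>W\<close>, into homomorphisms of \<open>V\<close>. All maps in
  the required diagrams are then homomorphisms out of free algebras of \<open>V\<close>, and
  generators decide.\<close>

lemma ind_mor_monad_mor:
  assumes V: "basic_variety lam V" and W: "basic_variety lam W" and F: "concrete_functor lam W V F"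
  shows "ind_mor V W F \<in> monad_mor Met (var_monad V) (var_monad W)"
proof (rule monad_morI[OF is_monad_var_monad[OF W]])
  note I = ind_map[OF V W F] and FD = concrete_functorD[OF F]
  show "ind_mor V W F A \<in> nonexp (fo (Fun (var_monad V)) A) (fo (Fun (var_monad W)) A)" if "A \<in> Obj Met" for A
    using that I(2) by (simp add: ind_mor_def)
  show "ind_mor V W F A (munit (var_monad V) A x) = munit (var_monad W) A x" if "A \<in> Obj Met" "x \<in> pts A" for A x
    using that I(3) by (simp add: ind_mor_def)
  show "ind_mor V W F B (fm (Fun (var_monad V)) A B f p) = fm (Fun (var_monad W)) A B f (ind_mor V W F A p)"
    if A: "A \<in> Obj Met" and B: "B \<in> Obj Met" and f: "f \<in> nonexp A B" and p: "p \<in> pts (fo (Fun (var_monad V)) A)" for A B f p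
  proof -
    have "compose (pts (TV V A)) (ind_map V W F B) (fmap V A B f) = compose (pts (TV V A)) (fmap W A B f) (ind_map V W F A)"
      by (rule FA_hom_eqI[OF V A FA_hom_compose[OF V A fmap_hom[OF V A B f] I(1)[OF B]]
            FA_hom_compose[OF V A I(1)[OF A] FD(4)[OF FA_alg[OF W A] FA_alg[OF W B] fmap_hom[OF W A B f]]]])
        (simp add: compose_eq unit_map_in[OF V A] fmap_unit[OF V A B f] fmap_unit[OF W A B f] I(3) A B nonexp_in[OF f])
    from compose_apply_eq[OF this] show ?thesis using A B f p by (simp add: ind_mor_def)
  qed
  fix A p assume A: "A \<in> Obj (Met :: ('u emet, _) mcat)" and p: "p \<in> pts (fo (Fun (var_monad V)) (fo (Fun (var_monad V)) A))"
  note VA = TV_Obj[OF V A] and WA = TV_Obj[OF W A] and IA = I(2)[OF A]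
  have p': "p \<in> pts (TV V (TV V A))" using p A VA by simp
  have "compose (pts (TV V (TV V A))) (ind_map V W F A) (mult_map V A) =
     compose (pts (TV V (TV V A))) (mult_map W A) (compose (pts (TV V (TV V A))) (fmap W (TV V A) (TV W A) (ind_map V W F A)) (ind_map V W F (TV V A)))"
    by (rule FA_hom_eqI[OF V VA FA_hom_compose[OF V VA mult_map_hom[OF V A] I(1)[OF A]]
      FA_hom_compose[OF V VA FA_hom_compose[OF V VA I(1)[OF VA]
          FD(4)[OF FA_alg[OF W VA] FA_alg[OF W WA] fmap_hom[OF W VA WA IA]]]
        FD(4)[OF FA_alg[OF W WA] FA_alg[OF W A] mult_map_hom[OF W A]]]])
      (simp add: compose_eq unit_map_in[OF V VA] mult_map_unit[OF V A] I(3)[OF VA] fmap_unit[OF W VA WA IA]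
        mult_map_unit[OF W A] nonexp_in[OF IA])
  from fun_cong[OF this, of p] show "ind_mor V W F A (mmult (var_monad V) A p) = mmult (var_monad W) A
      (fm (Fun (var_monad W)) (fo (Fun (var_monad V)) A) (fo (Fun (var_monad W)) A) (ind_mor V W F A) (ind_mor V W F (fo (Fun (var_monad V)) A) p))"
    using A VA WA IA p' by (simp add: ind_mor_def compose_eq)
qed (simp add: ind_mor_def)

lemma ind_map_ident:
  assumes V: "basic_variety lam V" and M: "M \<in> Obj Met"
  shows "ind_map V V (id_func (var_cat lam V)) M = (\<lambda>x\<in>pts (TV V M). x)"
proof -
  note I = ind_map[OF V V id_func_concrete[OF V] M]
  have "fo (id_func (var_cat lam V)) (FA V M) = FA V M" using FA_alg[OF V M] by (simp add: id_func_def)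
  with I(1) have "ind_map V V (id_func (var_cat lam V)) M \<in> qalg_hom lam (sig V) (FA V M) (FA V M)" by simp
  then show ?thesis
    by (rule FA_hom_eqI[OF V M _ qalg_hom_ident[OF FA_qalg[OF V M], folded TV_def]])
      (simp add: I(3) unit_map_in[OF V M])
qed

lemma ind_map_compose:
  assumes V: "basic_variety lam V" and W: "basic_variety lam W" and X: "basic_variety lam X"
    and F: "concrete_functor lam W V F" and G: "concrete_functor lam X W G" and M: "M \<in> Obj Met"
  shows "ind_map V X (comp_func (var_cat lam X) F G) M = compose (pts (TV V M)) (ind_map W X G M) (ind_map V W F M)"
proof -
  have "fo (comp_func (var_cat lam X) F G) (FA X M) = fo F (fo G (FA X M))"
    using FA_alg[OF X M] by (simp add: comp_func_def)
  then have h: "ind_map V X (comp_func (var_cat lam X) F G) M \<in> qalg_hom lam (sig V) (FA V M) (fo F (fo G (FA X M)))"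
    using ind_map_hom[OF V X comp_func_concrete[OF X G F] M] by simp
  show ?thesis
    by (rule FA_hom_eqI[OF V M h FA_hom_compose[OF V M ind_map_hom[OF V W F M]
          concrete_functorD(4)[OF F FA_alg[OF W M] concrete_functorD(1)[OF G FA_alg[OF X M]] ind_map_hom[OF W X G M]]]])
      (simp add: compose_eq unit_map_in[OF V M] ind_map_unit[OF V X comp_func_concrete[OF X G F] M]
        ind_map_unit[OF V W F M] ind_map_unit[OF W X G M])
qed

section \<open>Eilenberg-Moore algebras as members of the variety\<close>

text \<open>An operation on points of \<open>X\<close> is performed formally in the free algebra and
  then evaluated by the structure map \<open>e\<close>.\<close>

definition EM_alg :: "'u variety \<Rightarrow> 'u emet \<Rightarrow> ('u \<Rightarrow> 'u) \<Rightarrow> ('u, 'u) qalg" where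
  "EM_alg V X e = \<lparr>qspace = X, interp = (\<lambda>\<sigma>\<in>syms (sig V). \<lambda>a\<in>args lam (sig V) \<sigma> \<rightarrow>\<^sub>E pts X.
     e (interp (FA V X) \<sigma> (\<lambda>i\<in>args lam (sig V) \<sigma>. unit_map V X (a i))))\<rparr>"

lemma EM_alg_interp:
  "\<sigma> \<in> syms (sig V) \<Longrightarrow> a \<in> args lam (sig V) \<sigma> \<rightarrow>\<^sub>E pts X \<Longrightarrow>
    interp (EM_alg V X e) \<sigma> a = e (interp (FA V X) \<sigma> (\<lambda>i\<in>args lam (sig V) \<sigma>. unit_map V X (a i)))"
  by (simp add: EM_alg_def)

lemma EM_alg:
  assumes V: "basic_variety lam V" and X: "X \<in> Obj Met" and e: "e \<in> nonexp (TV V X) X"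
    and eu: "\<And>x. x \<in> pts X \<Longrightarrow> e (unit_map V X x) = x"
    and em: "\<And>p. p \<in> pts (TV V (TV V X)) \<Longrightarrow> e (mult_map V X p) = e (fmap V (TV V X) X e p)"
  shows EM_alg_in: "EM_alg V X e \<in> algs V" and EM_alg_hom: "e \<in> qalg_hom lam (sig V) (FA V X) (EM_alg V X e)"
proof -
  let ?S = "sig V"
  note TX = TV_Obj[OF V X] and q = FA_qalg[OF V X] and qT = FA_qalg[OF V TV_Obj[OF V X]]
  have ua: "(\<lambda>i\<in>args lam ?S \<sigma>. unit_map V X (a i)) \<in> args lam ?S \<sigma> \<rightarrow>\<^sub>E pts (qspace (FA V X))"
    if "a \<in> args lam ?S \<sigma> \<rightarrow>\<^sub>E pts X" for a \<sigma>
    using PiE_mem[OF that] unit_map_in[OF V X] by (simp add: TV_def)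
  have E: "is_qalg lam ?S (EM_alg V X e)"
    unfolding EM_alg_def
  proof (rule is_qalgI[OF Obj_Met_emet[OF X]])
    fix \<sigma> a assume \<sigma>: "\<sigma> \<in> syms ?S" and a: "a \<in> args lam ?S \<sigma> \<rightarrow>\<^sub>E pts X"
    show "e (interp (FA V X) \<sigma> (\<lambda>i\<in>args lam ?S \<sigma>. unit_map V X (a i))) \<in> pts X"
      using qalg_interp_in[OF q \<sigma> ua[OF a]] by (intro nonexp_in[OF e]) (simp add: TV_def)
    fix b assume b: "b \<in> args lam ?S \<sigma> \<rightarrow>\<^sub>E pts X"
    have "edist X (e (interp (FA V X) \<sigma> (\<lambda>i\<in>args lam ?S \<sigma>. unit_map V X (a i)))) (e (interp (FA V X) \<sigma> (\<lambda>i\<in>args lam ?S \<sigma>. unit_map V X (b i)))) \<le>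
      edist (TV V X) (interp (FA V X) \<sigma> (\<lambda>i\<in>args lam ?S \<sigma>. unit_map V X (a i))) (interp (FA V X) \<sigma> (\<lambda>i\<in>args lam ?S \<sigma>. unit_map V X (b i)))"
      using qalg_interp_in[OF q \<sigma> ua[OF a]] qalg_interp_in[OF q \<sigma> ua[OF b]] by (intro nonexp_le[OF e]) (simp_all add: TV_def)
    also have "\<dots> \<le> (SUP i\<in>args lam ?S \<sigma>. edist (TV V X) ((\<lambda>i\<in>args lam ?S \<sigma>. unit_map V X (a i)) i) ((\<lambda>i\<in>args lam ?S \<sigma>. unit_map V X (b i)) i))"
      unfolding TV_def by (rule qalg_interp_le[OF q \<sigma> ua[OF a] ua[OF b]])
    also have "\<dots> \<le> (SUP i\<in>args lam ?S \<sigma>. edist X (a i) (b i))"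
    proof (rule SUP_mono)
      fix i assume i: "i \<in> args lam ?S \<sigma>"
      have "edist (TV V X) (unit_map V X (a i)) (unit_map V X (b i)) \<le> edist X (a i) (b i)"
        by (rule nonexp_le[OF unit_map_nonexp[OF V X] PiE_mem[OF a i] PiE_mem[OF b i]])
      with i show "\<exists>j\<in>args lam ?S \<sigma>. edist (TV V X) ((\<lambda>i\<in>args lam ?S \<sigma>. unit_map V X (a i)) i) ((\<lambda>i\<in>args lam ?S \<sigma>. unit_map V X (b i)) i) \<le> edist X (a j) (b j)"
        by auto
    qed
    finally show "edist X (e (interp (FA V X) \<sigma> (\<lambda>i\<in>args lam ?S \<sigma>. unit_map V X (a i)))) (e (interp (FA V X) \<sigma> (\<lambda>i\<in>args lam ?S \<sigma>. unit_map V X (b i)))) \<le>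
      (SUP i\<in>args lam ?S \<sigma>. edist X (a i) (b i))" .
  qed
  have Q: "qspace (EM_alg V X e) = X" by (simp add: EM_alg_def)
  show hom: "e \<in> qalg_hom lam ?S (FA V X) (EM_alg V X e)"
  proof (rule qalg_homI)
    show "e \<in> nonexp (qspace (FA V X)) (qspace (EM_alg V X e))" using e by (simp add: Q TV_def)
    fix \<sigma> t assume \<sigma>: "\<sigma> \<in> syms ?S" and t: "t \<in> args lam ?S \<sigma> \<rightarrow>\<^sub>E pts (qspace (FA V X))"
    let ?n = "args lam ?S \<sigma>"
    have t': "t i \<in> pts (TV V X)" if "i \<in> ?n" for i using PiE_mem[OF t that] by (simp add: TV_def)
    \<comment> \<open>The multiplication takes the tuple \<open>?u\<close> back to \<open>t\<close>.
      So the operation applied to \<open>t\<close> is the multiplication of an element of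
      \<open>TV V (TV V X)\<close>, to which the associativity law \<open>em\<close>
      applies.\<close>
    let ?u = "\<lambda>i\<in>?n. unit_map V (TV V X) (t i)"
    have u: "?u \<in> ?n \<rightarrow>\<^sub>E pts (qspace (FA V (TV V X)))" using t' unit_map_in[OF V TX] by (simp add: TV_def)
    have "(\<lambda>i\<in>?n. mult_map V X (?u i)) = t"
      using t t' mult_map_unit[OF V X] by (intro extensionalityI[of _ ?n]) (auto simp: PiE_def)
    then have "interp (FA V X) \<sigma> t = mult_map V X (interp (FA V (TV V X)) \<sigma> ?u)"
      using qalg_hom_interp[OF mult_map_hom[OF V X] \<sigma> u] by simp
    then have "e (interp (FA V X) \<sigma> t) = e (fmap V (TV V X) X e (interp (FA V (TV V X)) \<sigma> ?u))"
      using em qalg_interp_in[OF qT \<sigma> u] by (simp add: TV_def)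
    also have "fmap V (TV V X) X e (interp (FA V (TV V X)) \<sigma> ?u) = interp (FA V X) \<sigma> (\<lambda>i\<in>?n. fmap V (TV V X) X e (?u i))"
      by (rule qalg_hom_interp[OF fmap_hom[OF V TX X e] \<sigma> u])
    also have "(\<lambda>i\<in>?n. fmap V (TV V X) X e (?u i)) = (\<lambda>i\<in>?n. unit_map V X ((\<lambda>i\<in>?n. e (t i)) i))"
      using t' fmap_unit[OF V TX X e] by (intro restrict_ext) simp
    also have "e (interp (FA V X) \<sigma> \<dots>) = interp (EM_alg V X e) \<sigma> (\<lambda>i\<in>?n. e (t i))"
    proof -
      have "(\<lambda>i\<in>?n. e (t i)) \<in> ?n \<rightarrow>\<^sub>E pts X" using t' nonexp_in[OF e] by simp
      then show ?thesis by (rule EM_alg_interp[OF \<sigma>, symmetric])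
    qed
    finally show "e (interp (FA V X) \<sigma> t) = interp (EM_alg V X e) \<sigma> (\<lambda>i\<in>?n. e (t i))" .
  qed
  show "EM_alg V X e \<in> algs V"
  proof (rule variety_closed_lift[OF V E])
    show "qspace (EM_alg V X e) \<in> Obj Met" using X by (simp add: Q)
    fix N :: "'u emet" and f assume f: "f \<in> nonexp N (qspace (EM_alg V X e))"
    then have f': "f \<in> nonexp N X" by (simp add: Q)
    have "compose (pts N) (unit_map V X) f \<in> nonexp N (qspace (FA V X))"
      using nonexp_compose[OF f' unit_map_nonexp[OF V X]] by (simp add: TV_def)
    moreover have "\<forall>x\<in>pts N. e (compose (pts N) (unit_map V X) f x) = f x"
      using eu nonexp_in[OF f'] by (simp add: compose_eq)
    ultimately show "\<exists>A\<in>algs V. \<exists>g\<in>qalg_hom lam ?S A (EM_alg V X e). \<exists>f'\<in>nonexp N (qspace A). \<forall>x\<in>pts N. g (f' x) = f x"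
      using FA_alg[OF V X] hom by blast
  qed
qed

definition counit :: "'u variety \<Rightarrow> ('u, 'u) qalg \<Rightarrow> 'u \<Rightarrow> 'u" where
  "counit W A = fext W (qspace A) A (\<lambda>x\<in>pts (qspace A). x)"

lemma counit:
  assumes W: "basic_variety lam W" and A: "A \<in> algs W"
  shows counit_hom: "counit W A \<in> qalg_hom lam (sig W) (FA W (qspace A)) A"
    and counit_nonexp: "counit W A \<in> nonexp (TV W (qspace A)) (qspace A)"
    and counit_unit: "x \<in> pts (qspace A) \<Longrightarrow> counit W A (unit_map W (qspace A) x) = x"
proof -
  note f = fext[OF W variety_alg(2)[OF W A] A nonexp_ident, folded counit_def]
  show "counit W A \<in> qalg_hom lam (sig W) (FA W (qspace A)) A" by (rule f)
  then show "counit W A \<in> nonexp (TV W (qspace A)) (qspace A)" unfolding TV_def by (rule qalg_hom_nonexp)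
  show "x \<in> pts (qspace A) \<Longrightarrow> counit W A (unit_map W (qspace A) x) = x" using f(2) by simp
qed

text \<open>Thereby associativity of the multiplication becomes an instance of naturality of the
  counit, which is how the Eilenberg-Moore law is checked in \<open>ind_mor_surj\<close>.\<close>

lemma counit_FA: "counit W (FA W M) = mult_map W M"
  by (simp add: counit_def mult_map_def TV_def)

lemma counit_nat:
  assumes W: "basic_variety lam W" and A: "A \<in> algs W" and B: "B \<in> algs W" and f: "f \<in> qalg_hom lam (sig W) A B"
    and p: "p \<in> pts (TV W (qspace A))"
  shows "f (counit W A p) = counit W B (fmap W (qspace A) (qspace B) f p)"
proof -
  note XA = variety_alg(2)[OF W A] and XB = variety_alg(2)[OF W B] and f' = qalg_hom_nonexp[OF f]
  have "compose (pts (TV W (qspace A))) f (counit W A) = compose (pts (TV W (qspace A))) (counit W B) (fmap W (qspace A) (qspace B) f)"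
    by (rule FA_hom_eqI[OF W XA FA_hom_compose[OF W XA counit_hom[OF W A] f] FA_hom_compose[OF W XA fmap_hom[OF W XA XB f'] counit_hom[OF W B]]])
      (simp add: compose_eq unit_map_in[OF W XA] counit_unit[OF W A] counit_unit[OF W B] fmap_unit[OF W XA XB f'] nonexp_in[OF f'])
  then show ?thesis using p by (rule compose_apply_eq)
qed

text \<open>The algebra \<open>F A\<close> is the Eilenberg-Moore algebra of the composite of the monad morphism with the
  counit of \<open>A\<close>.\<close>

lemma concrete_functor_EM:
  assumes V: "basic_variety lam V" and W: "basic_variety lam W" and F: "concrete_functor lam W V F" and A: "A \<in> algs W"
    and \<sigma>: "\<sigma> \<in> syms (sig V)" and a: "a \<in> args lam (sig V) \<sigma> \<rightarrow>\<^sub>E pts (qspace A)"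
  shows "interp (fo F A) \<sigma> a = counit W A (ind_map V W F (qspace A) (interp (FA V (qspace A)) \<sigma> (\<lambda>i\<in>args lam (sig V) \<sigma>. unit_map V (qspace A) (a i))))"
proof -
  let ?X = "qspace A" and ?n = "args lam (sig V) \<sigma>"
  let ?u = "\<lambda>i\<in>?n. unit_map V ?X (a i)"
  note X = variety_alg(2)[OF W A]
  \<comment> \<open>Since \<open>F\<close> carries the counit, a homomorphism of \<open>W\<close>,
    to a homomorphism of \<open>V\<close>, so is \<open>?e\<close>. It sends units back to their
    points, so preservation of \<sigma> at the tuple \<open>?u\<close> is the claimed
    formula.\<close>
  let ?e = "compose (pts (TV V ?X)) (counit W A) (ind_map V W F ?X)"
  have e: "?e \<in> qalg_hom lam (sig V) (FA V ?X) (fo F A)"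
    by (rule FA_hom_compose[OF V X ind_map_hom[OF V W F X] concrete_functorD(4)[OF F FA_alg[OF W X] A counit_hom[OF W A]]])
  have u: "?u \<in> ?n \<rightarrow>\<^sub>E pts (qspace (FA V ?X))" using PiE_mem[OF a] unit_map_in[OF V X] by (simp add: TV_def)
  have "(\<lambda>i\<in>?n. ?e (?u i)) = a"
    using a PiE_mem[OF a] unit_map_in[OF V X] ind_map_unit[OF V W F X] counit_unit[OF W A]
    by (intro extensionalityI[of _ ?n]) (auto simp: PiE_def compose_eq)
  then have "interp (fo F A) \<sigma> a = ?e (interp (FA V ?X) \<sigma> ?u)" using qalg_hom_interp[OF e \<sigma> u] by simp
  then show ?thesis using qalg_interp_in[OF FA_qalg[OF V X] \<sigma> u] by (simp add: compose_eq TV_def)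
qed

section \<open>Full faithfulness\<close>

text \<open>By \<open>concrete_functor_EM\<close>, the component of the monad morphism at the space
  of \<open>A\<close> determines every operation of the image of \<open>A\<close>.\<close>

lemma ind_mor_inj:
  assumes V: "basic_variety lam V" and W: "basic_variety lam W"
    and F: "concrete_functor lam W V F" and G: "concrete_functor lam W V G" and eq: "ind_mor V W F = ind_mor V W G"
  shows "F = G"
proof (rule concrete_functor_eqI[OF F G])
  fix A assume A: "A \<in> algs W"
  have "ind_map V W F (qspace A) = ind_map V W G (qspace A)"
    using fun_cong[OF eq, of "qspace A"] variety_alg(2)[OF W A] by (simp add: ind_mor_def)
  then show "fo F A = fo G A"
    using concrete_functorD(1,2)[OF F A] concrete_functorD(1,2)[OF G A]
      concrete_functor_EM[OF V W F A] concrete_functor_EM[OF V W G A] variety_alg(1)[OF V]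
    by (intro qalg_eqI[of lam "sig V"]) auto
qed

text \<open>The counit of an algebra of \<open>W\<close>, preceded by \<alpha>, is an
  Eilenberg-Moore structure for the monad of \<open>V\<close>; its two laws come from those of the
  counit and the axioms of a monad morphism. The desired functor assigns to the algebra the
  corresponding algebra of \<open>V\<close>.\<close>

lemma ind_mor_surj:
  assumes V: "basic_variety lam V" and W: "basic_variety lam W" and a: "\<alpha> \<in> monad_mor Met (var_monad V) (var_monad W)"
  shows "\<exists>F. concrete_functor lam W V F \<and> ind_mor V W F = \<alpha>"
proof -
  have an: "\<alpha> M \<in> nonexp (TV V M) (TV W M)" if "M \<in> Obj Met" for M using monad_mor_nonexp[OF a that] that by simp
  have a_nat: "\<alpha> N (fmap V M N f p) = fmap W M N f (\<alpha> M p)" if "M \<in> Obj Met" "N \<in> Obj Met" "f \<in> nonexp M N" "p \<in> pts (TV V M)" for M N f p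
    using monad_mor_nat[OF a that(1-3), of p] that by simp
  have a_unit: "\<alpha> M (unit_map V M x) = unit_map W M x" if "M \<in> Obj Met" "x \<in> pts M" for M x
    using monad_mor_unit[OF a that] that by simp
  have a_mult: "\<alpha> M (mult_map V M p) = mult_map W M (fmap W (TV V M) (TV W M) (\<alpha> M) (\<alpha> (TV V M) p))"
    if "M \<in> Obj Met" "p \<in> pts (TV V (TV V M))" for M p
    using monad_mor_mult[OF a that(1), of p] that an[OF that(1)] TV_Obj[OF V that(1)] TV_Obj[OF W that(1)] by simp
  define e where "e A = compose (pts (TV V (qspace A))) (counit W A) (\<alpha> (qspace A))" for A
  have en: "e A \<in> nonexp (TV V (qspace A)) (qspace A)" if "A \<in> algs W" for A
    unfolding e_def by (rule nonexp_compose[OF an[OF variety_alg(2)[OF W that]] counit_nonexp[OF W that]])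
  have ea: "e A p = counit W A (\<alpha> (qspace A) p)" if "p \<in> pts (TV V (qspace A))" for A p
    using that by (simp add: e_def compose_eq)
  have eu: "e A (unit_map V (qspace A) x) = x" if A: "A \<in> algs W" and x: "x \<in> pts (qspace A)" for A x
    using variety_alg(2)[OF W A] x by (simp add: ea unit_map_in[OF V] a_unit counit_unit[OF W A])
  have em: "e A (mult_map V (qspace A) p) = e A (fmap V (TV V (qspace A)) (qspace A) (e A) p)"
    if A: "A \<in> algs W" and p: "p \<in> pts (TV V (TV V (qspace A)))" for A p
  proof -
    let ?X = "qspace A"
    note X = variety_alg(2)[OF W A] and VX = TV_Obj[OF V variety_alg(2)[OF W A]] and WX = TV_Obj[OF W variety_alg(2)[OF W A]]
    let ?q = "\<alpha> (TV V ?X) p"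
    have q: "?q \<in> pts (TV W (TV V ?X))" by (rule nonexp_in[OF an[OF VX] p])
    have "e A (mult_map V ?X p) = counit W A (mult_map W ?X (fmap W (TV V ?X) (TV W ?X) (\<alpha> ?X) ?q))"
      using mult_map_in[OF V X p] a_mult[OF X p] by (simp add: ea)
    also have "\<dots> = counit W A (fmap W (TV W ?X) ?X (counit W A) (fmap W (TV V ?X) (TV W ?X) (\<alpha> ?X) ?q))"
      using counit_nat[OF W FA_alg[OF W X] A counit_hom[OF W A], of "fmap W (TV V ?X) (TV W ?X) (\<alpha> ?X) ?q"]
        fmap_in[OF W VX WX an[OF X] q] by (simp add: counit_FA TV_def)
    also have "fmap W (TV W ?X) ?X (counit W A) (fmap W (TV V ?X) (TV W ?X) (\<alpha> ?X) ?q) = fmap W (TV V ?X) ?X (e A) ?q"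
      using fmap_compose[OF W VX WX X an[OF X] counit_nonexp[OF W A]] q by (simp add: e_def compose_eq)
    also have "\<dots> = \<alpha> ?X (fmap V (TV V ?X) ?X (e A) p)" using a_nat[OF VX X en[OF A] p] by simp
    also have "counit W A \<dots> = e A (fmap V (TV V ?X) ?X (e A) p)" using ea[OF fmap_in[OF V VX X en[OF A] p]] by simp
    finally show ?thesis .
  qed
  define Fo where "Fo A = EM_alg V (qspace A) (e A)" for A
  have E: "Fo A \<in> algs V" "e A \<in> qalg_hom lam (sig V) (FA V (qspace A)) (Fo A)" if A: "A \<in> algs W" for A
    unfolding Fo_def using EM_alg[OF V variety_alg(2)[OF W A] en[OF A] eu[OF A] em[OF A]] by auto
  have Fq: "qspace (Fo A) = qspace A" for A by (simp add: Fo_def EM_alg_def)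
  have Fi: "interp (Fo A) \<sigma> c = e A (interp (FA V (qspace A)) \<sigma> (\<lambda>i\<in>args lam (sig V) \<sigma>. unit_map V (qspace A) (c i)))"
    if "\<sigma> \<in> syms (sig V)" "c \<in> args lam (sig V) \<sigma> \<rightarrow>\<^sub>E pts (qspace A)" for A \<sigma> c
    unfolding Fo_def using that by (rule EM_alg_interp)
  have hom: "f \<in> qalg_hom lam (sig V) (Fo A) (Fo B)" if A: "A \<in> algs W" and B: "B \<in> algs W" and f: "f \<in> qalg_hom lam (sig W) A B" for A B f
  proof (rule qalg_homI)
    let ?X = "qspace A" and ?Y = "qspace B"
    note X = variety_alg(2)[OF W A] and Y = variety_alg(2)[OF W B] and f' = qalg_hom_nonexp[OF f]
    show "f \<in> nonexp (qspace (Fo A)) (qspace (Fo B))" using f' by (simp add: Fq)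
    fix \<sigma> c assume \<sigma>: "\<sigma> \<in> syms (sig V)" and "c \<in> args lam (sig V) \<sigma> \<rightarrow>\<^sub>E pts (qspace (Fo A))"
    then have c: "c \<in> args lam (sig V) \<sigma> \<rightarrow>\<^sub>E pts ?X" by (simp add: Fq)
    let ?n = "args lam (sig V) \<sigma>"
    let ?u = "\<lambda>i\<in>?n. unit_map V ?X (c i)" and ?fc = "\<lambda>i\<in>?n. f (c i)"
    have u: "?u \<in> ?n \<rightarrow>\<^sub>E pts (qspace (FA V ?X))" using PiE_mem[OF c] unit_map_in[OF V X] by (simp add: TV_def)
    have fc: "?fc \<in> ?n \<rightarrow>\<^sub>E pts ?Y" using PiE_mem[OF c] nonexp_in[OF f'] by simp
    have p: "interp (FA V ?X) \<sigma> ?u \<in> pts (TV V ?X)" using qalg_interp_in[OF FA_qalg[OF V X] \<sigma> u] by (simp add: TV_def)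
    \<comment> \<open>Naturality of \<open>e\<close>, inherited from the counit and from \<alpha>.
      Together with the definition of the operations of \<open>Fo\<close> it makes \<open>f\<close>
      a homomorphism of \<open>V\<close>.\<close>
    have ef: "f (e A p) = e B (fmap V ?X ?Y f p)" if p: "p \<in> pts (TV V ?X)" for p
      using ea[OF p] counit_nat[OF W A B f nonexp_in[OF an[OF X] p]] a_nat[OF X Y f' p] ea[OF fmap_in[OF V X Y f' p]] by simp
    have "(\<lambda>i\<in>?n. fmap V ?X ?Y f (?u i)) = (\<lambda>i\<in>?n. unit_map V ?Y (?fc i))"
      using PiE_mem[OF c] fmap_unit[OF V X Y f'] by (intro restrict_ext) simp
    then have "fmap V ?X ?Y f (interp (FA V ?X) \<sigma> ?u) = interp (FA V ?Y) \<sigma> (\<lambda>i\<in>?n. unit_map V ?Y (?fc i))"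
      using qalg_hom_interp[OF fmap_hom[OF V X Y f'] \<sigma> u] by simp
    then show "f (interp (Fo A) \<sigma> c) = interp (Fo B) \<sigma> ?fc"
      using Fi[OF \<sigma> c] Fi[OF \<sigma> fc] ef[OF p] by simp
  qed
  define F where "F = mk_func (var_cat lam W) Fo (\<lambda>A B f. f)"
  have F: "concrete_functor lam W V F"
    unfolding F_def by (rule concrete_functorI[OF W]) (use E Fq hom in auto)
  moreover have "ind_mor V W F = \<alpha>"
  proof (rule monad_mor_eqI[OF ind_mor_monad_mor[OF V W F] a])
    fix M p assume M: "M \<in> Obj (Met :: ('u emet, _) mcat)" and "p \<in> pts (fo (Fun (var_monad V)) M)"
    then have p: "p \<in> pts (TV V M)" by simp
    note A = FA_alg[OF W M] and TM = TV_Obj[OF W M] and u = unit_map_nonexp[OF W M]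
    have foF: "fo F (FA W M) = Fo (FA W M)" using A by (simp add: F_def)
    have qM: "qspace (FA W M) = TV W M" by (simp add: TV_def)
    \<comment> \<open>Once this is known, naturality of \<alpha> moves it past the image of the
      unit, and the right unit law of the monad of \<open>W\<close> leaves just \<alpha>.\<close>
    have "ind_map V W F M = compose (pts (TV V M)) (e (FA W M)) (fmap V M (TV W M) (unit_map W M))"
    proof (rule FA_hom_eqI[OF V M])
      show "ind_map V W F M \<in> qalg_hom lam (sig V) (FA V M) (Fo (FA W M))" using ind_map_hom[OF V W F M] foF by simp
      show "compose (pts (TV V M)) (e (FA W M)) (fmap V M (TV W M) (unit_map W M)) \<in> qalg_hom lam (sig V) (FA V M) (Fo (FA W M))"
        using FA_hom_compose[OF V M fmap_hom[OF V M TM u]] E(2)[OF A] qM by simp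
      show "ind_map V W F M (unit_map V M x) = compose (pts (TV V M)) (e (FA W M)) (fmap V M (TV W M) (unit_map W M)) (unit_map V M x)"
        if x: "x \<in> pts M" for x
        using eu[OF A, of "unit_map W M x"] unit_map_in[OF W M x]
        by (simp add: ind_map_unit[OF V W F M x] compose_eq unit_map_in[OF V M x] fmap_unit[OF V M TM u x] qM)
    qed
    then have "ind_map V W F M p = e (FA W M) (fmap V M (TV W M) (unit_map W M) p)" using p by (simp add: compose_eq)
    also have "\<dots> = mult_map W M (\<alpha> (TV W M) (fmap V M (TV W M) (unit_map W M) p))"
      using ea[of "fmap V M (TV W M) (unit_map W M) p" "FA W M"] fmap_in[OF V M TM u p] by (simp add: qM counit_FA)
    also have "\<dots> = mult_map W M (fmap W M (TV W M) (unit_map W M) (\<alpha> M p))" using a_nat[OF M TM u p] by simp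
    also have "\<dots> = \<alpha> M p"
      using monad_right[OF is_monad_var_monad[OF W] M, of "\<alpha> M p"] nonexp_in[OF an[OF M] p] M TM u by simp
    finally show "ind_mor V W F M p = \<alpha> M p" using M by (simp add: ind_mor_def)
  qed
  ultimately show ?thesis by blast
qed

definition monad_functor :: "('u variety, (('u, 'u) qalg, 'u \<Rightarrow> 'u, ('u, 'u) qalg, 'u \<Rightarrow> 'u) func,
    ('u emet, 'u \<Rightarrow> 'u) monad, 'u emet \<Rightarrow> 'u \<Rightarrow> 'u) func" where
  "monad_functor = mk_func (op_cat (basic_varieties_cat lam)) var_monad ind_mor"

lemma is_functor_monad_functor: "is_functor (op_cat (basic_varieties_cat lam)) (basic_monads_cat lam) monad_functor"
  unfolding monad_functor_def
proof (rule is_functor_mk_funcI)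
  fix V assume "V \<in> Obj (op_cat (basic_varieties_cat lam))"
  then have V: "basic_variety lam V" by simp
  show "ind_mor V V (Ident (op_cat (basic_varieties_cat lam)) V) = Ident (basic_monads_cat lam) (var_monad V)"
    by (rule extensionalityI[of _ "Obj Met"]) (simp_all add: ind_mor_def ind_map_ident[OF V])
next
  fix V W X F G assume "V \<in> Obj (op_cat (basic_varieties_cat lam))" "W \<in> Obj (op_cat (basic_varieties_cat lam))"
    "X \<in> Obj (op_cat (basic_varieties_cat lam))" "F \<in> Mor (op_cat (basic_varieties_cat lam)) V W"
    "G \<in> Mor (op_cat (basic_varieties_cat lam)) W X"
  then have a: "basic_variety lam V" "basic_variety lam W" "basic_variety lam X" "concrete_functor lam W V F" "concrete_functor lam X W G"
    by simp_all
  show "ind_mor V X (Comp (op_cat (basic_varieties_cat lam)) V W X G F) =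
      Comp (basic_monads_cat lam) (var_monad V) (var_monad W) (var_monad X) (ind_mor W X G) (ind_mor V W F)"
    by (rule extensionalityI[of _ "Obj Met"]) (simp_all add: ind_mor_def ind_map_compose[OF a])
qed (use is_categoryD(1,2)[OF is_category_op_cat[OF is_category_basic_varieties]] in
    \<open>auto simp: basic_monad_var_monad ind_mor_monad_mor\<close>)

lemma monad_functor_bij:
  assumes "V \<in> Obj (op_cat (basic_varieties_cat lam))" "W \<in> Obj (op_cat (basic_varieties_cat lam))"
  shows "bij_betw (fm monad_functor V W) (Mor (op_cat (basic_varieties_cat lam)) V W)
    (Mor (basic_monads_cat lam) (fo monad_functor V) (fo monad_functor W))"
proof -
  have V: "basic_variety lam V" and W: "basic_variety lam W" using assms by simp_all
  have "bij_betw (ind_mor V W) {F. concrete_functor lam W V F} (monad_mor Met (var_monad V) (var_monad W))"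
    unfolding bij_betw_def
  proof (intro conjI inj_onI equalityI subsetI)
    show "\<alpha> \<in> ind_mor V W ` {F. concrete_functor lam W V F}" if "\<alpha> \<in> monad_mor Met (var_monad V) (var_monad W)" for \<alpha>
      using ind_mor_surj[OF V W that] by blast
  qed (use ind_mor_inj[OF V W] ind_mor_monad_mor[OF V W] in auto)
  then show ?thesis
    using assms unfolding monad_functor_def by (subst bij_betw_cong[of _ _ "ind_mor V W"]) simp_all
qed

end

subsection \<open>The variety of a monad\<close>

text \<open>Each law for \<beta> is the law for \<alpha> read backwards. That \<beta> is
  nonexpanding is a separate hypothesis because a bijective nonexpanding map need not be an
  isometry.\<close>

lemma monad_mor_inverse:
  assumes S: "is_monad Met S" and T: "is_monad Met T" and a: "\<alpha> \<in> monad_mor Met S T"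
    and ext: "\<beta> \<in> extensional (Obj Met)" and b: "\<And>A. A \<in> Obj Met \<Longrightarrow> \<beta> A \<in> nonexp (fo (Fun T) A) (fo (Fun S) A)"
    and ba: "\<And>A p. A \<in> Obj Met \<Longrightarrow> p \<in> pts (fo (Fun S) A) \<Longrightarrow> \<beta> A (\<alpha> A p) = p"
    and ab: "\<And>A p. A \<in> Obj Met \<Longrightarrow> p \<in> pts (fo (Fun T) A) \<Longrightarrow> \<alpha> A (\<beta> A p) = p"
  shows "\<beta> \<in> monad_mor Met T S"
proof (rule monad_morI[OF S ext b])
  have b_in: "\<beta> A p \<in> pts (fo (Fun S) A)" if "A \<in> Obj Met" "p \<in> pts (fo (Fun T) A)" for A p
    using that by (intro nonexp_in[OF b])
  show nat: "\<beta> B (fm (Fun T) A B f p) = fm (Fun S) A B f (\<beta> A p)"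
    if A: "A \<in> Obj Met" and B: "B \<in> Obj Met" and f: "f \<in> nonexp A B" and p: "p \<in> pts (fo (Fun T) A)" for A B f p
  proof -
    have "\<alpha> B (fm (Fun S) A B f (\<beta> A p)) = fm (Fun T) A B f p"
      using monad_mor_nat[OF a A B f b_in[OF A p]] ab[OF A p] by simp
    then show ?thesis using ba[OF B nonexp_in[OF monad_map[OF S A B f] b_in[OF A p]]] by simp
  qed
  show "\<beta> A (munit T A x) = munit S A x" if A: "A \<in> Obj Met" and x: "x \<in> pts A" for A x
    using monad_mor_unit[OF a A x] ba[OF A nonexp_in[OF monad_unit[OF S A] x]] by simp
  fix A p assume A: "A \<in> Obj Met" and p: "p \<in> pts (fo (Fun T) (fo (Fun T) A))"
  note TA = monad_Obj[OF T A] and SA = monad_Obj[OF S A]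
  have Tb: "fm (Fun T) (fo (Fun T) A) (fo (Fun S) A) (\<beta> A) p \<in> pts (fo (Fun T) (fo (Fun S) A))"
    by (rule nonexp_in[OF monad_map[OF T TA SA b[OF A]] p])
  \<comment> \<open>Chosen so that the component of \<alpha> at \<open>fo (Fun S) A\<close>,
    followed by the image of \<open>\<alpha> A\<close> under \<open>T\<close>, sends
    \<open>q\<close> to \<open>p\<close>. The multiplication law of \<alpha> at \<open>q\<close> is
    then the one of \<beta> at \<open>p\<close>.\<close>
  define q where "q = \<beta> (fo (Fun S) A) (fm (Fun T) (fo (Fun T) A) (fo (Fun S) A) (\<beta> A) p)"
  have q: "q \<in> pts (fo (Fun S) (fo (Fun S) A))" unfolding q_def by (rule b_in[OF SA Tb])
  have "compose (pts (fo (Fun T) A)) (\<alpha> A) (\<beta> A) = (\<lambda>x\<in>pts (fo (Fun T) A). x)"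
    by (rule extensionalityI[of _ "pts (fo (Fun T) A)"]) (auto simp: compose_eq ab[OF A])
  then have "fm (Fun T) (fo (Fun S) A) (fo (Fun T) A) (\<alpha> A) (fm (Fun T) (fo (Fun T) A) (fo (Fun S) A) (\<beta> A) p) = p"
    using monad_comp[OF T TA SA TA b[OF A] monad_mor_nonexp[OF a A] p] monad_ident[OF T TA] p by simp
  then have "\<alpha> A (mmult S A q) = mmult T A p"
    using monad_mor_mult[OF a A q] ab[OF SA Tb] by (simp add: q_def)
  then have "\<beta> A (mmult T A p) = mmult S A q"
    using ba[OF A nonexp_in[OF monad_mult[OF S A] q]] by simp
  then show "\<beta> A (mmult T A p) = mmult S A (fm (Fun S) (fo (Fun T) A) (fo (Fun S) A) (\<beta> A) (\<beta> (fo (Fun T) A) p))"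
    unfolding q_def nat[OF TA SA b[OF A] p] .
qed

section \<open>Renaming of variables and supports of terms\<close>

lemma terms_mono: "t \<in> terms lam S X \<Longrightarrow> X \<subseteq> Y \<Longrightarrow> t \<in> terms lam S Y"
  by (induction rule: terms.induct) (auto intro: terms.intros)

lemma Op_terms: "\<sigma> \<in> syms S \<Longrightarrow> t \<in> args lam S \<sigma> \<rightarrow>\<^sub>E terms lam S X \<Longrightarrow> Op \<sigma> t \<in> terms lam S X"
  by (rule terms.Op) (auto simp: PiE_def)

text \<open>Substitution of variables, expressed as evaluation in the free algebra so that its
  properties are instances of those of \<open>term_ext\<close>.\<close>

definition rename :: "'u rel \<Rightarrow> 'u signature \<Rightarrow> 'v emet \<Rightarrow> ('x \<Rightarrow> 'v) \<Rightarrow> ('u, 'x) trm \<Rightarrow> ('u, 'v) trm" where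
  "rename lam S C g = term_ext lam S (free_qalg lam S C) (\<lambda>x. Var (g x))"

lemma rename_terms:
  assumes C: "is_emet C" and g: "\<And>x. x \<in> X \<Longrightarrow> g x \<in> pts C" and t: "t \<in> terms lam S X"
  shows "rename lam S C g t \<in> terms lam S (pts C)"
  using term_ext_in[OF free_qalg_is_qalg[OF C], where X = X and f = "\<lambda>x. Var (g x)", OF _ t] g
  unfolding rename_def by (simp add: free_qalg_def terms.Var)

text \<open>Evaluation along \<open>f\<close> is a homomorphism from the free algebra on
  \<open>C\<close>, and homomorphisms commute with evaluation.\<close>

lemma term_ext_rename:
  assumes C: "is_emet C" and g: "\<And>x. x \<in> X \<Longrightarrow> g x \<in> pts C" and t: "t \<in> terms lam S X"
    and A: "is_qalg lam S A" and f: "f \<in> nonexp C (qspace A)"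
  shows "term_ext lam S A f (rename lam S C g t) = term_ext lam S A (\<lambda>x. f (g x)) t"
proof -
  let ?h = "restrict (term_ext lam S A f) (terms lam S (pts C))"
  have V: "Var (g x) \<in> pts (qspace (free_qalg lam S C))" if "x \<in> X" for x
    using g[OF that] by (simp add: free_qalg_def terms.Var)
  have "?h (rename lam S C g t) = term_ext lam S A (\<lambda>x. ?h (Var (g x))) t"
    unfolding rename_def by (rule hom_term_ext[OF term_ext_hom[OF A f] free_qalg_is_qalg[OF C] V t])
  also have "\<dots> = term_ext lam S A (\<lambda>x. f (g x)) t"
    using g by (intro term_ext_cong[OF _ t]) (simp add: terms.Var)
  finally show ?thesis using rename_terms[OF C g t] by simp
qed

text \<open>By regularity the union of the supports of fewer than \<open>lam\<close> arguments still
  has fewer than \<open>lam\<close> elements.\<close>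

lemma (in cardinal_universe) terms_support:
  assumes S: "is_signature lam S" and "t \<in> terms lam S X"
  shows "\<exists>N. N \<subseteq> X \<and> |N| <o lam \<and> t \<in> terms lam S N"
  using assms(2)
proof induction
  case (Var x)
  then show ?case by (intro exI[of _ "{x}"]) (simp add: lt_finite terms.Var)
next
  case (Op \<sigma> t)
  have "\<forall>i\<in>args lam S \<sigma>. \<exists>N. N \<subseteq> X \<and> |N| <o lam \<and> t i \<in> terms lam S N" using Op.IH by (rule ballI)
  from bchoice[OF this] obtain N where
    "\<forall>i\<in>args lam S \<sigma>. N i \<subseteq> X \<and> |N i| <o lam \<and> t i \<in> terms lam S (N i)" ..
  then have N: "N i \<subseteq> X" "|N i| <o lam" "t i \<in> terms lam S (N i)" if "i \<in> args lam S \<sigma>" for i using that by simp_all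
  let ?N = "\<Union>i\<in>args lam S \<sigma>. N i"
  have "|?N| <o lam" by (rule lt_UN[OF signature_arity_lt[OF S Op.hyps(1)] N(2)])
  moreover have "t i \<in> terms lam S ?N" if "i \<in> args lam S \<sigma>" for i
    by (rule terms_mono[OF N(3)[OF that]]) (use that in blast)
  then have "Op \<sigma> t \<in> terms lam S ?N" using Op.hyps(1,3) by (intro terms.Op)
  moreover have "?N \<subseteq> X" using N(1) by (rule UN_least)
  ultimately show ?case by (intro exI[of _ ?N] conjI)
qed

lemma nonexp_sub_emet_incl: "N \<subseteq> N' \<Longrightarrow> (\<lambda>x\<in>N. x) \<in> nonexp (sub_emet M N) (sub_emet M N')"
  by (rule nonexpI) (simp_all add: subset_iff)

lemma nonexp_sub_emet_incl_whole: "N \<subseteq> pts M \<Longrightarrow> (\<lambda>x\<in>N. x) \<in> nonexp (sub_emet M N) M"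
  by (rule nonexpI) auto

section \<open>Kleisli extension for a basic monad\<close>

locale basic_monad_on = cardinal_universe lam for lam :: "'u rel" +
  fixes T :: "('u emet, 'u \<Rightarrow> 'u) monad"
  assumes basic: "basic_monad lam T"
begin

abbreviation F :: "'u emet \<Rightarrow> 'u emet" where "F \<equiv> fo (Fun T)"
abbreviation Fm :: "'u emet \<Rightarrow> 'u emet \<Rightarrow> ('u \<Rightarrow> 'u) \<Rightarrow> 'u \<Rightarrow> 'u" where "Fm \<equiv> fm (Fun T)"
abbreviation \<eta> :: "'u emet \<Rightarrow> 'u \<Rightarrow> 'u" where "\<eta> \<equiv> munit T"

lemma monad: "is_monad Met T"
  using basic by (rule basic_monad_is_monad)

lemmas F_Obj = monad_Obj[OF monad] and Fm_nonexp = monad_map[OF monad] and \<eta>_nonexp = monad_unit[OF monad]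

lemma Fm_le:
  assumes "A \<in> Obj Met" "B \<in> Obj Met" "f \<in> nonexp A B" "g \<in> nonexp A B" "p \<in> pts (F A)"
  shows "edist (F B) (Fm A B f p) (Fm A B g p) \<le> sup_dist A B f g"
proof -
  have "sup_dist (F A) (F B) (Fm A B f) (Fm A B g) \<le> sup_dist A B f g"
    using basic assms(1-4) by (simp add: basic_monad_def enriched_functor_def)
  moreover have "edist (F B) (Fm A B f p) (Fm A B g p) \<le> sup_dist (F A) (F B) (Fm A B f) (Fm A B g)"
    unfolding sup_dist_def using assms(5) by (rule SUP_upper)
  ultimately show ?thesis by (rule order_trans[rotated])
qed

lemma Fm_surj:
  "A \<in> Obj Met \<Longrightarrow> B \<in> Obj Met \<Longrightarrow> f \<in> nonexp A B \<Longrightarrow> f ` pts A = pts B \<Longrightarrow> Fm A B f ` pts (F A) = pts (F B)"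
  using basic by (simp add: basic_monad_def)

text \<open>The Kleisli extension of a map from \<open>A\<close> to \<open>F B\<close>. With
  \<open>A\<close> discrete, \<open>f\<close> is a tuple of elements of \<open>F B\<close>, and the
  extension evaluates formal operations at this tuple.\<close>

definition kext :: "'u emet \<Rightarrow> 'u emet \<Rightarrow> ('u \<Rightarrow> 'u) \<Rightarrow> 'u \<Rightarrow> 'u" where
  "kext A B f = compose (pts (F A)) (mmult T B) (Fm A (F B) f)"

context
  fixes A B f
  assumes A: "A \<in> Obj (Met :: ('u emet, 'u \<Rightarrow> 'u) mcat)" and B: "B \<in> Obj (Met :: ('u emet, 'u \<Rightarrow> 'u) mcat)"
    and f: "f \<in> nonexp A (F B)"
begin

lemma kext_nonexp: "kext A B f \<in> nonexp (F A) (F B)"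
  unfolding kext_def by (rule nonexp_compose[OF Fm_nonexp[OF A F_Obj[OF B] f] monad_mult[OF monad B]])

lemma kext_in: "p \<in> pts (F A) \<Longrightarrow> kext A B f p \<in> pts (F B)"
  by (rule nonexp_in[OF kext_nonexp])

lemma kext_unit: "x \<in> pts A \<Longrightarrow> kext A B f (\<eta> A x) = f x"
  using nonexp_in[OF \<eta>_nonexp[OF A]] monad_unit_nat[OF monad A F_Obj[OF B] f] monad_left[OF monad B] nonexp_in[OF f]
  by (simp add: kext_def compose_eq)

text \<open>Enrichment of \<open>T\<close> enters here: the extension depends on the map in a
  nonexpanding way. For discrete \<open>A\<close> this says that the operations on
  \<open>F B\<close> are nonexpanding.\<close>

lemma kext_le:
  assumes g: "g \<in> nonexp A (F B)" and p: "p \<in> pts (F A)"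
  shows "edist (F B) (kext A B f p) (kext A B g p) \<le> sup_dist A (F B) f g"
proof -
  note FB = F_Obj[OF B]
  have "edist (F B) (kext A B f p) (kext A B g p) \<le> edist (F (F B)) (Fm A (F B) f p) (Fm A (F B) g p)"
    using p nonexp_le[OF monad_mult[OF monad B]] nonexp_in[OF Fm_nonexp[OF A FB f] p] nonexp_in[OF Fm_nonexp[OF A FB g] p]
    by (simp add: kext_def compose_eq)
  also have "\<dots> \<le> sup_dist A (F B) f g" by (rule Fm_le[OF A FB f g p])
  finally show ?thesis .
qed

text \<open>Associativity of Kleisli composition, from naturality and associativity of the
  multiplication. It is the source of all homomorphisms between the algebras
  \<open>TA M\<close>.\<close>

lemma kext_kext:
  assumes C: "C \<in> Obj Met" and g: "g \<in> nonexp B (F C)" and p: "p \<in> pts (F A)"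
  shows "kext B C g (kext A B f p) = kext A C (compose (pts A) (kext B C g) f) p"
proof -
  note FB = F_Obj[OF B] and FC = F_Obj[OF C] and FFC = F_Obj[OF F_Obj[OF C]]
  have Fp: "Fm A (F B) f p \<in> pts (F (F B))" by (rule nonexp_in[OF Fm_nonexp[OF A FB f] p])
  note Fg = Fm_nonexp[OF B FC g]
  have FFp: "Fm (F B) (F (F C)) (Fm B (F C) g) (Fm A (F B) f p) \<in> pts (F (F (F C)))"
    by (rule nonexp_in[OF Fm_nonexp[OF FB FFC Fg] Fp])
  have mu: "mmult T C \<in> nonexp (F (F C)) (F C)" by (rule monad_mult[OF monad C])
  have "kext B C g (kext A B f p) = mmult T C (Fm B (F C) g (mmult T B (Fm A (F B) f p)))"
    using p kext_in[OF p] by (simp add: kext_def compose_eq)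
  also have "\<dots> = mmult T C (mmult T (F C) (Fm (F B) (F (F C)) (Fm B (F C) g) (Fm A (F B) f p)))"
    by (simp add: monad_mult_nat[OF monad B FC g Fp])
  also have "\<dots> = mmult T C (Fm (F (F C)) (F C) (mmult T C) (Fm (F B) (F (F C)) (Fm B (F C) g) (Fm A (F B) f p)))"
    by (rule monad_assoc[OF monad C FFp])
  also have "Fm (F (F C)) (F C) (mmult T C) (Fm (F B) (F (F C)) (Fm B (F C) g) (Fm A (F B) f p)) =
      Fm (F B) (F C) (kext B C g) (Fm A (F B) f p)"
    unfolding kext_def by (rule monad_comp[OF monad FB FFC FC Fg mu Fp, symmetric])
  also have "\<dots> = Fm A (F C) (compose (pts A) (kext B C g) f) p"
  proof (rule monad_comp[OF monad A FB FC f _ p, symmetric])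
    show "kext B C g \<in> nonexp (F B) (F C)" unfolding kext_def by (rule nonexp_compose[OF Fg mu])
  qed
  finally show ?thesis using p by (simp add: kext_def compose_eq)
qed

end

lemma Fm_kext:
  assumes A: "A \<in> Obj Met" and B: "B \<in> Obj Met" and f: "f \<in> nonexp A B" and p: "p \<in> pts (F A)"
  shows "Fm A B f p = kext A B (compose (pts A) (\<eta> B) f) p"
  using p monad_comp[OF monad A B F_Obj[OF B] f \<eta>_nonexp[OF B] p] monad_right[OF monad B nonexp_in[OF Fm_nonexp[OF A B f] p]]
  by (simp add: kext_def compose_eq)

text \<open>In this form the multiplication is recognized as a homomorphism by
  \<open>kext_hom\<close>.\<close>

lemma mult_kext:
  assumes A: "A \<in> Obj Met" and p: "p \<in> pts (F (F A))"
  shows "mmult T A p = kext (F A) A (\<lambda>x\<in>pts (F A). x) p"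
  using p monad_ident[OF monad F_Obj[OF A]] by (simp add: kext_def compose_eq)

section \<open>The signature of a monad and the algebras that it carries\<close>

text \<open>With distinct points infinitely far apart, every tuple is a nonexpanding map. Thus an
  element of \<open>F (discrete n)\<close> can be evaluated at any tuple of \<open>n\<close>
  elements of any \<open>F M\<close>.\<close>

definition discrete :: "'u \<Rightarrow> 'u emet" where
  "discrete n = mk_emet (underS lam n) (\<lambda>x y. if x = y then 0 else \<infinity>)"

lemma pts_discrete [simp]: "pts (discrete n) = underS lam n"
  by (simp add: discrete_def)

lemma underS_Field: "underS lam n \<subseteq> Field lam"
  by (auto simp: underS_def Field_def)

lemma discrete_Obj: "discrete n \<in> Obj Met"
proof (rule Obj_MetI)
  show "is_emet (discrete n)" unfolding discrete_def by (rule is_emet_mk_emet) (auto split: if_splits)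
  show "small TYPE('u) (pts (discrete n))" using small_subset[OF small_Field_lam underS_Field] by simp
qed

lemma nonexp_discrete: "a \<in> underS lam n \<rightarrow>\<^sub>E pts B \<Longrightarrow> is_emet B \<Longrightarrow> a \<in> nonexp (discrete n) B"
  by (rule nonexpI) (auto simp: discrete_def PiE_def Pi_iff edist_self)

text \<open>The arity is stored with the element since the point sets of the spaces
  \<open>F (discrete n)\<close> may overlap. As symbols have to be elements of \<open>'u\<close>,
  the pairs are then replaced by codes.\<close>

definition ops :: "('u \<times> 'u) set" where
  "ops = {(n, s). cardinal_below lam n \<and> s \<in> pts (F (discrete n))}"

definition code :: "'u \<times> 'u \<Rightarrow> 'u" where "code = (SOME c. inj_on c ops)"

definition dec :: "'u \<Rightarrow> 'u \<times> 'u" where "dec = inv_into ops code"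

definition monad_sig :: "'u signature" where
  "monad_sig = \<lparr>syms = code ` ops, arity = (\<lambda>\<sigma>\<in>code ` ops. fst (dec \<sigma>))\<rparr>"

lemma small_ops: "small TYPE('u) ops"
proof -
  have "small TYPE('u) (Sigma (Field lam) (\<lambda>n. pts (F (discrete n))))"
    by (intro small_Sigma small_Field_lam Obj_Met_small F_Obj discrete_Obj)
  then show ?thesis by (rule small_subset) (auto simp: ops_def cardinal_below_def)
qed

lemma inj_code: "inj_on code ops"
proof -
  have "\<exists>c :: 'u \<times> 'u \<Rightarrow> 'u. inj_on c ops" using small_code[OF small_ops] by blast
  then show ?thesis unfolding code_def by (rule someI_ex)
qed

lemma dec_code [simp]: "z \<in> ops \<Longrightarrow> dec (code z) = z"
  unfolding dec_def by (rule inv_into_f_f[OF inj_code])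

lemma syms_code: "\<sigma> \<in> syms monad_sig \<Longrightarrow> \<exists>z\<in>ops. \<sigma> = code z"
  by (auto simp: monad_sig_def)

lemma code_syms: "z \<in> ops \<Longrightarrow> code z \<in> syms monad_sig"
  by (simp add: monad_sig_def)

lemma args_dec: "\<sigma> \<in> syms monad_sig \<Longrightarrow> args lam monad_sig \<sigma> = underS lam (fst (dec \<sigma>))"
  by (simp add: monad_sig_def)

lemma dec_in: "\<sigma> \<in> syms monad_sig \<Longrightarrow> snd (dec \<sigma>) \<in> pts (F (discrete (fst (dec \<sigma>))))"
  using syms_code[of \<sigma>] by (auto simp: ops_def[unfolded set_eq_iff] split_beta)

lemma monad_sig: "is_signature lam monad_sig"
  using small_image[OF small_ops, of code] by (auto simp: is_signature_def monad_sig_def) (simp add: ops_def)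

text \<open>A tuple \<open>a\<close> of points of \<open>F M\<close> is extended to
  \<open>F (discrete n)\<close>, and its value at the element named by the symbol is the result of
  the operation.\<close>

definition TA :: "'u emet \<Rightarrow> ('u, 'u) qalg" where
  "TA M = \<lparr>qspace = F M, interp = (\<lambda>\<sigma>\<in>syms monad_sig. \<lambda>a\<in>args lam monad_sig \<sigma> \<rightarrow>\<^sub>E pts (F M).
     kext (discrete (fst (dec \<sigma>))) M a (snd (dec \<sigma>)))\<rparr>"

lemma qspace_TA [simp]: "qspace (TA M) = F M"
  by (simp add: TA_def)

lemma interp_TA: "\<sigma> \<in> syms monad_sig \<Longrightarrow> a \<in> args lam monad_sig \<sigma> \<rightarrow>\<^sub>E pts (F M) \<Longrightarrow>
    interp (TA M) \<sigma> a = kext (discrete (fst (dec \<sigma>))) M a (snd (dec \<sigma>))"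
  by (simp add: TA_def)

lemma args_nonexp: "M \<in> Obj Met \<Longrightarrow> \<sigma> \<in> syms monad_sig \<Longrightarrow> a \<in> args lam monad_sig \<sigma> \<rightarrow>\<^sub>E pts (F M) \<Longrightarrow>
    a \<in> nonexp (discrete (fst (dec \<sigma>))) (F M)"
  using args_dec by (intro nonexp_discrete Obj_Met_emet F_Obj) simp_all

lemma TA_qalg:
  assumes M: "M \<in> Obj Met"
  shows "is_qalg lam monad_sig (TA M)"
  unfolding TA_def
proof (rule is_qalgI[OF Obj_Met_emet[OF F_Obj[OF M]]])
  fix \<sigma> a b assume \<sigma>: "\<sigma> \<in> syms monad_sig" and a: "a \<in> args lam monad_sig \<sigma> \<rightarrow>\<^sub>E pts (F M)"
  show "kext (discrete (fst (dec \<sigma>))) M a (snd (dec \<sigma>)) \<in> pts (F M)"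
    by (rule kext_in[OF discrete_Obj M args_nonexp[OF M \<sigma> a] dec_in[OF \<sigma>]])
  assume b: "b \<in> args lam monad_sig \<sigma> \<rightarrow>\<^sub>E pts (F M)"
  show "edist (F M) (kext (discrete (fst (dec \<sigma>))) M a (snd (dec \<sigma>))) (kext (discrete (fst (dec \<sigma>))) M b (snd (dec \<sigma>)))
      \<le> (SUP i\<in>args lam monad_sig \<sigma>. edist (F M) (a i) (b i))"
    using kext_le[OF discrete_Obj M args_nonexp[OF M \<sigma> a] args_nonexp[OF M \<sigma> b] dec_in[OF \<sigma>]]
    by (simp add: sup_dist_def args_dec[OF \<sigma>])
qed

text \<open>Preservation of an operation is Kleisli associativity with a tuple as the inner
  map.\<close>

lemma kext_hom:
  assumes M: "M \<in> Obj Met" and N: "N \<in> Obj Met" and f: "f \<in> nonexp M (F N)"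
  shows "kext M N f \<in> qalg_hom lam monad_sig (TA M) (TA N)"
proof (rule qalg_homI)
  show "kext M N f \<in> nonexp (qspace (TA M)) (qspace (TA N))" using kext_nonexp[OF M N f] by simp
  fix \<sigma> a assume \<sigma>: "\<sigma> \<in> syms monad_sig" and "a \<in> args lam monad_sig \<sigma> \<rightarrow>\<^sub>E pts (qspace (TA M))"
  then have a: "a \<in> args lam monad_sig \<sigma> \<rightarrow>\<^sub>E pts (F M)" by simp
  have fa: "(\<lambda>i\<in>args lam monad_sig \<sigma>. kext M N f (a i)) \<in> args lam monad_sig \<sigma> \<rightarrow>\<^sub>E pts (F N)"
    using PiE_mem[OF a] kext_in[OF M N f] by simp
  show "kext M N f (interp (TA M) \<sigma> a) = interp (TA N) \<sigma> (\<lambda>i\<in>args lam monad_sig \<sigma>. kext M N f (a i))"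
    unfolding interp_TA[OF \<sigma> a] interp_TA[OF \<sigma> fa]
    using kext_kext[OF discrete_Obj M args_nonexp[OF M \<sigma> a] N f dec_in[OF \<sigma>]]
    by (simp add: compose_def args_dec[OF \<sigma>])
qed

section \<open>Values of terms in the spaces of the monad\<close>

definition ev :: "'u emet \<Rightarrow> ('u, 'u) trm \<Rightarrow> 'u" where
  "ev M = term_ext lam monad_sig (TA M) (\<eta> M)"

lemma ev_in: "M \<in> Obj Met \<Longrightarrow> t \<in> terms lam monad_sig (pts M) \<Longrightarrow> ev M t \<in> pts (F M)"
  unfolding ev_def using term_ext_closed[OF TA_qalg, of M "\<eta> M" M t] \<eta>_nonexp[of M] by simp

text \<open>Every evaluation in \<open>TA N\<close> factors through the value in \<open>F M\<close>.
  Hence a distance of values in \<open>F M\<close> bounds the distance under all assignments, which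
  makes the equations to be chosen sound.\<close>

lemma kext_ev:
  assumes M: "M \<in> Obj Met" and N: "N \<in> Obj Met" and f: "f \<in> nonexp M (F N)" and t: "t \<in> terms lam monad_sig (pts M)"
  shows "kext M N f (ev M t) = term_ext lam monad_sig (TA N) f t"
proof -
  have "kext M N f (ev M t) = term_ext lam monad_sig (TA N) (\<lambda>x. kext M N f (\<eta> M x)) t"
    unfolding ev_def using nonexp_in[OF \<eta>_nonexp[OF M]] t by (intro hom_term_ext[OF kext_hom[OF M N f] TA_qalg[OF M]]) simp_all
  also have "\<dots> = term_ext lam monad_sig (TA N) f t"
    using kext_unit[OF M N f] by (intro term_ext_cong[OF _ t])
  finally show ?thesis .
qed

lemma Fm_hom:
  assumes M: "M \<in> Obj Met" and N: "N \<in> Obj Met" and f: "f \<in> nonexp M N"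
  shows "Fm M N f \<in> qalg_hom lam monad_sig (TA M) (TA N)"
proof -
  note f' = nonexp_compose[OF f \<eta>_nonexp[OF N]]
  have "Fm M N f = kext M N (compose (pts M) (\<eta> N) f)"
    using Fm_kext[OF M N f] by (rule nonexp_eqI[OF Fm_nonexp[OF M N f] kext_nonexp[OF M N f']])
  then show ?thesis using kext_hom[OF M N f'] by simp
qed

lemma Fm_ev:
  assumes M: "M \<in> Obj Met" and N: "N \<in> Obj Met" and f: "f \<in> nonexp M N" and t: "t \<in> terms lam monad_sig (pts M)"
  shows "Fm M N f (ev M t) = term_ext lam monad_sig (TA N) (\<lambda>x. \<eta> N (f x)) t"
proof -
  have "Fm M N f (ev M t) = term_ext lam monad_sig (TA N) (\<lambda>x. Fm M N f (\<eta> M x)) t"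
    unfolding ev_def using nonexp_in[OF \<eta>_nonexp[OF M]] t by (intro hom_term_ext[OF Fm_hom[OF M N f] TA_qalg[OF M]]) simp_all
  also have "\<dots> = term_ext lam monad_sig (TA N) (\<lambda>x. \<eta> N (f x)) t"
    using monad_unit_nat[OF monad M N f] by (intro term_ext_cong[OF _ t])
  finally show ?thesis .
qed

section \<open>Reduction to small subspaces and generation by the operations\<close>

lemma sub_emet_Obj: "(M :: 'u emet) \<in> Obj Met \<Longrightarrow> N \<subseteq> pts M \<Longrightarrow> sub_emet M N \<in> Obj Met"
  by (rule Obj_MetI[OF is_emet_sub_emet[OF Obj_Met_emet]]) (simp_all add: small_subset[OF Obj_Met_small[of M], of N])

lemma Fm_incl_ev:
  assumes M: "M \<in> Obj Met" and N: "N \<subseteq> pts M" and t: "t \<in> terms lam monad_sig N"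
  shows "Fm (sub_emet M N) M (\<lambda>x\<in>N. x) (ev (sub_emet M N) t) = ev M t"
proof -
  have "Fm (sub_emet M N) M (\<lambda>x\<in>N. x) (ev (sub_emet M N) t) = term_ext lam monad_sig (TA M) (\<lambda>x. \<eta> M ((\<lambda>x\<in>N. x) x)) t"
    using t by (intro Fm_ev sub_emet_Obj M N nonexp_sub_emet_incl_whole) simp_all
  also have "\<dots> = ev M t" unfolding ev_def by (intro term_ext_cong[OF _ t]) simp
  finally show ?thesis .
qed

lemma Fm_incl_incl:
  assumes M: "M \<in> Obj Met" and N: "N \<subseteq> N'" "N' \<subseteq> pts M" and t: "t \<in> terms lam monad_sig N"
  shows "Fm (sub_emet M N) (sub_emet M N') (\<lambda>x\<in>N. x) (ev (sub_emet M N) t) = ev (sub_emet M N') t"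
proof -
  have "Fm (sub_emet M N) (sub_emet M N') (\<lambda>x\<in>N. x) (ev (sub_emet M N) t) =
      term_ext lam monad_sig (TA (sub_emet M N')) (\<lambda>x. \<eta> (sub_emet M N') ((\<lambda>x\<in>N. x) x)) t"
    using t N by (intro Fm_ev sub_emet_Obj M nonexp_sub_emet_incl) simp_all
  also have "\<dots> = ev (sub_emet M N') t" unfolding ev_def by (intro term_ext_cong[OF _ t]) simp
  finally show ?thesis .
qed

text \<open>Every space is the directed colimit of its subspaces of fewer than \<open>lam\<close> points, and \<open>T\<close> preserves it.\<close>

lemma small_subspaces:
  assumes M: "M \<in> Obj Met"
  shows generated_by_small: "p \<in> pts (F M) \<Longrightarrow>
      \<exists>N\<subseteq>pts M. |N| <o lam \<and> (\<exists>p'\<in>pts (F (sub_emet M N)). p = Fm (sub_emet M N) M (\<lambda>x\<in>N. x) p')"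
    and distance_attained: "N \<subseteq> pts M \<Longrightarrow> |N| <o lam \<Longrightarrow> p \<in> pts (F (sub_emet M N)) \<Longrightarrow> p' \<in> pts (F (sub_emet M N)) \<Longrightarrow>
      \<exists>N'. N \<subseteq> N' \<and> N' \<subseteq> pts M \<and> |N'| <o lam \<and>
        edist (F (sub_emet M N')) (Fm (sub_emet M N) (sub_emet M N') (\<lambda>x\<in>N. x) p) (Fm (sub_emet M N) (sub_emet M N') (\<lambda>x\<in>N. x) p') =
        edist (F M) (Fm (sub_emet M N) M (\<lambda>x\<in>N. x) p) (Fm (sub_emet M N) M (\<lambda>x\<in>N. x) p')"
proof -
  let ?P = "{N. N \<subseteq> pts M \<and> |N| <o lam}"
  have sP: "small TYPE('u) ?P" by (rule small_lt_subsets[OF Obj_Met_small[OF M]])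
  \<comment> \<open>Accessibility concerns index sets inside \<open>'u\<close>, so the subsets of
    fewer than \<open>lam\<close> points are coded there and \<open>r\<close> compares the decoded
    subsets by inclusion.\<close>
  obtain c :: "'u set \<Rightarrow> 'u" where c: "inj_on c ?P" using small_code[OF sP] .
  define d where "d = inv_into ?P c"
  have dc: "d (c N) = N" if "N \<in> ?P" for N unfolding d_def using inv_into_f_f[OF c that] .
  define I where "I = c ` ?P"
  define r where "r = {(i, j). i \<in> I \<and> j \<in> I \<and> d i \<subseteq> d j}"
  define X where "X i = sub_emet M (d i)" for i
  define b where "b i j = (\<lambda>x\<in>d i. x)" for i j :: 'u
  have d: "d i \<subseteq> pts M" "|d i| <o lam" "c (d i) = i" if "i \<in> I" for i
    using that dc unfolding I_def by auto
  have sI: "small TYPE('u) I" unfolding I_def by (rule small_image[OF sP])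
  have dir: "directed_poset lam I r"
    unfolding directed_poset_def
  proof (intro conjI allI impI)
    show "partial_order_on I r"
      unfolding partial_order_on_def preorder_on_def
    proof (intro conjI)
      show "refl_on I r" by (auto simp: refl_on_def r_def)
      show "trans r" by (auto simp: trans_def r_def)
      show "antisym r"
      proof (rule antisymI)
        fix i j assume "(i, j) \<in> r" "(j, i) \<in> r"
        then have "i \<in> I" "j \<in> I" "d i = d j" by (auto simp: r_def)
        then show "i = j" using d(3) by metis
      qed
    qed (auto simp: r_def)
    fix J assume J: "J \<subseteq> I" "|J| <o lam"
    \<comment> \<open>Regularity of \<open>lam\<close> makes the union of fewer than
      \<open>lam\<close> such subsets another one, so it is an upper bound in the diagram.\<close>
    have "(\<Union>j\<in>J. d j) \<in> ?P" using J d by (auto intro!: lt_UN)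
    then have "c (\<Union>j\<in>J. d j) \<in> I" "d (c (\<Union>j\<in>J. d j)) = (\<Union>j\<in>J. d j)" using dc by (auto simp: I_def)
    then show "\<exists>i\<in>I. \<forall>j\<in>J. (j, i) \<in> r" using J unfolding r_def by auto
  qed
  have X_Obj: "X i \<in> Obj Met" if "i \<in> I" for i unfolding X_def by (rule sub_emet_Obj[OF M d(1)[OF that]])
  have rI: "i \<in> I" "j \<in> I" "d i \<subseteq> d j" if "(i, j) \<in> r" for i j using that by (auto simp: r_def)
  have b_nonexp: "b i j \<in> nonexp (X i) (X j)" if "(i, j) \<in> r" for i j
    unfolding b_def X_def by (rule nonexp_sub_emet_incl[OF rI(3)[OF that]])
  interpret X: directed_diagram lam I r X b
  proof unfold_locales
    show "b j k (b i j x) = b i k x" if "(i, j) \<in> r" "(j, k) \<in> r" "x \<in> pts (X i)" for i j k x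
      using rI(3)[OF that(1)] that(3) by (auto simp: b_def X_def)
  qed (use sI dir X_Obj b_nonexp rI in \<open>auto simp: b_def X_def\<close>)
  define \<gamma> where "\<gamma> i = (\<lambda>x\<in>d i. x)" for i
  have \<gamma>: "\<gamma> i \<in> nonexp (X i) M" if "i \<in> I" for i
    unfolding \<gamma>_def X_def by (rule nonexp_sub_emet_incl_whole[OF d(1)[OF that]])
  have compat: "\<gamma> j (b i j x) = \<gamma> i x" if "(i, j) \<in> r" "x \<in> pts (X i)" for i j x
    using rI(3)[OF that(1)] that(2) by (auto simp: \<gamma>_def b_def X_def)
  have good: "X.good_cocone M \<gamma>"
    unfolding X.good_cocone_def
  proof (intro conjI ballI allI impI)
    fix p assume p: "p \<in> pts M"
    then have P: "{p} \<in> ?P" by (simp add: lt_finite)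
    have "c {p} \<in> I" unfolding I_def by (rule imageI[OF P])
    moreover have "p \<in> pts (X (c {p}))" "p = \<gamma> (c {p}) p" by (simp_all add: X_def \<gamma>_def dc[OF P])
    ultimately show "\<exists>i\<in>I. \<exists>x\<in>pts (X i). p = \<gamma> i x" by blast
  next
    fix i j x y assume *: "i \<in> I" "j \<in> I" "x \<in> pts (X i)" "y \<in> pts (X j)"
    show "edist M (\<gamma> i x) (\<gamma> j y) = X.delta (i, x) (j, y)"
    proof (rule antisym)
      show "edist M (\<gamma> i x) (\<gamma> j y) \<le> X.delta (i, x) (j, y)" by (rule X.cocone_le_delta[of \<gamma>, OF \<gamma> compat *])
      \<comment> \<open>The inclusions are isometric, so any common stage already realizes the
        distance of \<open>M\<close>.\<close>
      obtain k where k: "k \<in> I" "(i, k) \<in> r" "(j, k) \<in> r" using X.upper_bound2[OF *(1,2)] .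
      have "x \<in> d k" "y \<in> d k" using * rI(3)[OF k(2)] rI(3)[OF k(3)] by (auto simp: X_def)
      then show "X.delta (i, x) (j, y) \<le> edist M (\<gamma> i x) (\<gamma> j y)"
        using X.delta_le[OF k(2,3), of x y] * by (simp add: \<gamma>_def b_def X_def)
    qed
  qed (use M \<gamma> compat in auto)
  define D :: "('u, unit, 'u emet, 'u \<Rightarrow> 'u) func" where "D = mk_func (poset_cat I r) X (\<lambda>i j _. b i j)"
  have D_o: "fo D i = X i" if "i \<in> I" for i using that by (simp add: D_def X.poset_cat_simps)
  have D_m: "fm D i j () = b i j" if "(i, j) \<in> r" for i j
    using that rI[OF that] by (simp add: D_def X.poset_cat_simps)
  have D: "is_functor (poset_cat I r) Met D"
    unfolding D_def
  proof (rule is_functor_mk_funcI)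
    show "X i \<in> Obj Met" if "i \<in> Obj (poset_cat I r)" for i using that X_Obj by (simp add: X.poset_cat_simps)
    show "b i j \<in> Mor Met (X i) (X j)" if "k \<in> Mor (poset_cat I r) i j" for i j k
      using that b_nonexp by (simp add: X.poset_cat_simps split: if_splits)
    show "Ident (poset_cat I r) i \<in> Mor (poset_cat I r) i i" if "i \<in> Obj (poset_cat I r)" for i
      using that X.r_refl by (simp add: X.poset_cat_simps)
    show "b i i = Ident Met (X i)" for i by (simp add: b_def X_def)
    show "Comp (poset_cat I r) i j k m l \<in> Mor (poset_cat I r) i k"
      if "l \<in> Mor (poset_cat I r) i j" "m \<in> Mor (poset_cat I r) j k" for i j k l m
      using that X.r_trans[of i j k] by (simp add: X.poset_cat_simps split: if_splits)
    show "b i k = Comp Met (X i) (X j) (X k) (b j k) (b i j)"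
      if "l \<in> Mor (poset_cat I r) i j" "m \<in> Mor (poset_cat I r) j k" for i j k l m
    proof -
      have "d i \<subseteq> d j" using that rI(3) by (auto simp: X.poset_cat_simps split: if_splits)
      then show ?thesis by (auto simp: b_def X_def compose_def intro!: restrict_ext)
    qed
  qed
  have "is_colimit (poset_cat I r) Met D M \<gamma>" using X.colimit_iff_good[of D] D_o D_m good by simp
  moreover have "accessible lam Met Met (Fun T)" using basic by (simp add: basic_monad_def)
  ultimately have colim: "is_colimit (poset_cat I r) Met (comp_func (poset_cat I r) (Fun T) D) (F M) (\<lambda>i. Fm (fo D i) M (\<gamma> i))"
    unfolding accessible_def using sI dir D by blast
  have Fb: "Fm (X j) (X k) (b j k) (Fm (X i) (X j) (b i j) p) = Fm (X i) (X k) (b i k) p"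
    if ij: "(i, j) \<in> r" and jk: "(j, k) \<in> r" and p: "p \<in> pts (F (X i))" for i j k p
  proof -
    have "b i k = compose (pts (X i)) (b j k) (b i j)"
      using rI(3)[OF ij] by (auto simp: b_def X_def compose_def intro!: restrict_ext)
    then show ?thesis using monad_comp[OF monad X_Obj X_Obj X_Obj b_nonexp[OF ij] b_nonexp[OF jk] p] rI[OF ij] rI[OF jk] by simp
  qed
  interpret FX: directed_diagram lam I r "\<lambda>i. F (X i)" "\<lambda>i j. Fm (X i) (X j) (b i j)"
  proof unfold_locales
    show "Fm (X i) (X i) (b i i) p = p" if i: "i \<in> I" and p: "p \<in> pts (F (X i))" for i p
    proof -
      have "b i i = (\<lambda>x\<in>pts (X i). x)" by (simp add: b_def X_def)
      then show ?thesis using monad_ident[OF monad X_Obj[OF i]] p by simp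
    qed
  qed (use sI dir F_Obj X_Obj Fm_nonexp b_nonexp rI Fb in auto)
  \<comment> \<open>Preservation of the colimit is now translated to points: an element of
    \<open>F M\<close> comes from a small subspace, and by \<open>delta_attained\<close> a distance
    in \<open>F M\<close> is attained over a possibly larger one.\<close>
  have "FX.good_cocone (F M) (\<lambda>i. Fm (fo D i) M (\<gamma> i))"
    using colim by (subst (asm) FX.colimit_iff_good)
      (auto simp: comp_func_def X.poset_cat_simps D_o D_m rI)
  then have good': "FX.good_cocone (F M) (\<lambda>i. Fm (X i) M (\<gamma> i))"
    unfolding FX.good_cocone_def using D_o rI by (simp cong: ball_cong)
  note G = FX.good_coconeD[OF good']
  show "p \<in> pts (F M) \<Longrightarrow> \<exists>N\<subseteq>pts M. |N| <o lam \<and> (\<exists>p'\<in>pts (F (sub_emet M N)). p = Fm (sub_emet M N) M (\<lambda>x\<in>N. x) p')"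
    using G(4)[of p] d unfolding X_def \<gamma>_def by blast
  assume N: "N \<subseteq> pts M" "|N| <o lam" and p: "p \<in> pts (F (sub_emet M N))" "p' \<in> pts (F (sub_emet M N))"
  have i: "c N \<in> I" "d (c N) = N" using N dc[of N] by (auto simp: I_def)
  have pX: "p \<in> pts (F (X (c N)))" "p' \<in> pts (F (X (c N)))" using p i by (simp_all add: X_def)
  obtain k where k: "(c N, k) \<in> r" "edist (F (X k)) (Fm (X (c N)) (X k) (b (c N) k) p) (Fm (X (c N)) (X k) (b (c N) k) p') = FX.delta (c N, p) (c N, p')"
    using FX.delta_attained[OF i(1) i(1) pX] by blast
  then have "edist (F (X k)) (Fm (X (c N)) (X k) (b (c N) k) p) (Fm (X (c N)) (X k) (b (c N) k) p') =
      edist (F M) (Fm (X (c N)) M (\<gamma> (c N)) p) (Fm (X (c N)) M (\<gamma> (c N)) p')"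
    using G(5)[OF i(1) i(1) pX] by simp
  then show "\<exists>N'. N \<subseteq> N' \<and> N' \<subseteq> pts M \<and> |N'| <o lam \<and>
        edist (F (sub_emet M N')) (Fm (sub_emet M N) (sub_emet M N') (\<lambda>x\<in>N. x) p) (Fm (sub_emet M N) (sub_emet M N') (\<lambda>x\<in>N. x) p') =
        edist (F M) (Fm (sub_emet M N) M (\<lambda>x\<in>N. x) p) (Fm (sub_emet M N) M (\<lambda>x\<in>N. x) p')"
    using d(1,2)[OF rI(2)[OF k(1)]] rI(3)[OF k(1)] unfolding X_def \<gamma>_def b_def i(2) by (intro exI[of _ "d k"]) simp
qed

lemma ev_surj:
  assumes M: "M \<in> Obj Met" and p: "p \<in> pts (F M)"
  shows "\<exists>t\<in>terms lam monad_sig (pts M). ev M t = p"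
proof -
  obtain N p' where N: "N \<subseteq> pts M" "|N| <o lam" and p': "p' \<in> pts (F (sub_emet M N))" "p = Fm (sub_emet M N) M (\<lambda>x\<in>N. x) p'"
    using generated_by_small[OF M p] by blast
  \<comment> \<open>An enumeration of \<open>N\<close> is nonexpanding from the discrete space and
    onto, so \<open>T\<close> maps it to a surjection and \<open>p'\<close> comes from some
    \<open>s\<close> over a discrete arity.\<close>
  obtain n h where n: "cardinal_below lam n" and h: "bij_betw h (underS lam n) N" using lt_code[OF N(2)] .
  note sN = sub_emet_Obj[OF M N(1)]
  let ?h = "\<lambda>i\<in>underS lam n. h i"
  have h1: "?h \<in> nonexp (discrete n) (sub_emet M N)"
    using bij_betwE[OF h] by (intro nonexp_discrete Obj_Met_emet sN) simp
  have h2: "?h \<in> nonexp (discrete n) M"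
    using bij_betwE[OF h] N(1) by (intro nonexp_discrete Obj_Met_emet M) auto
  have "?h ` pts (discrete n) = pts (sub_emet M N)" using h by (simp add: bij_betw_def)
  from Fm_surj[OF discrete_Obj sN h1 this] p'(1) obtain s where s: "s \<in> pts (F (discrete n))" "p' = Fm (discrete n) (sub_emet M N) ?h s"
    by (metis imageE)
  have "compose (pts (discrete n)) (\<lambda>x\<in>N. x) ?h = ?h"
    using bij_betwE[OF h] by (auto simp: compose_def intro!: restrict_ext)
  then have "p = Fm (discrete n) M ?h s"
    using monad_comp[OF monad discrete_Obj sN M h1 nonexp_sub_emet_incl_whole[OF N(1)] s(1)] p'(2) s(2) by simp
  also have "\<dots> = kext (discrete n) M (compose (underS lam n) (\<eta> M) ?h) s"
    using Fm_kext[OF discrete_Obj M h2 s(1)] by simp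
  finally have pk: "p = kext (discrete n) M (compose (underS lam n) (\<eta> M) ?h) s" .
  have z: "(n, s) \<in> ops" using n s(1) by (simp add: ops_def)
  note \<sigma> = code_syms[OF z]
  have args: "args lam monad_sig (code (n, s)) = underS lam n" using args_dec[OF \<sigma>] z by simp
  \<comment> \<open>The element \<open>s\<close> itself is the operation symbol, applied to the
    enumerated points of \<open>N\<close> as variables.\<close>
  let ?t = "Op (code (n, s)) (\<lambda>i\<in>underS lam n. Var (h i))"
  have t: "?t \<in> terms lam monad_sig (pts M)"
    using bij_betwE[OF h] N(1) by (intro Op_terms \<sigma>) (auto simp: args intro: terms.Var)
  let ?a = "\<lambda>i\<in>underS lam n. \<eta> M (h i)"
  have a: "?a \<in> args lam monad_sig (code (n, s)) \<rightarrow>\<^sub>E pts (F M)"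
    using bij_betwE[OF h] N(1) nonexp_in[OF \<eta>_nonexp[OF M]] by (auto simp: args)
  have "ev M ?t = interp (TA M) (code (n, s)) (\<lambda>i\<in>underS lam n. term_ext lam monad_sig (TA M) (\<eta> M) ((\<lambda>i\<in>underS lam n. Var (h i)) i))"
    unfolding ev_def term_ext.simps args ..
  also have "(\<lambda>i\<in>underS lam n. term_ext lam monad_sig (TA M) (\<eta> M) ((\<lambda>i\<in>underS lam n. Var (h i)) i)) = ?a"
    by (intro restrict_ext) simp
  also have "interp (TA M) (code (n, s)) ?a = kext (discrete n) M ?a s" using interp_TA[OF \<sigma> a] z by simp
  also have "?a = compose (underS lam n) (\<eta> M) ?h" by (auto simp: compose_def intro!: restrict_ext)
  finally have "ev M ?t = p" unfolding pk .
  with t show ?thesis by blast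
qed

text \<open>Contexts are restricted to initial segments of \<open>lam\<close> so that only a small set of equations arises.\<close>

definition eqs :: "'u qeq set" where
  "eqs = {e. \<exists>n. cardinal_below lam n \<and> pts (ctxt e) = underS lam n \<and> is_basic_qeq lam monad_sig e \<and>
     edist (F (ctxt e)) (ev (ctxt e) (lhs e)) (ev (ctxt e) (rhs e)) \<le> ennreal (real_of_rat (eps e))}"

text \<open>Such an equation is determined by an index \<open>n\<close>, a metric on its initial
  segment, two terms and a rational, each of which ranges over a small set.\<close>

lemma small_eqs: "small TYPE('u) eqs"
proof -
  let ?Z = "SIGMA n:Field lam. ((underS lam n \<times> underS lam n) \<rightarrow>\<^sub>E (UNIV :: ennreal set)) \<times>
    terms lam monad_sig (underS lam n) \<times> terms lam monad_sig (underS lam n) \<times> (UNIV :: rat set)"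
  let ?g = "\<lambda>(n, d, l, r, q). \<lparr>ctxt = mk_emet (underS lam n) (\<lambda>x y. d (x, y)), lhs = l, rhs = r, eps = q\<rparr>"
  have "small TYPE('u) ?Z"
    by (intro small_Sigma small_Field_lam small_PiE small_ennreal lt_Sigma lt_underS small_terms monad_sig
        small_countable small_subset[OF small_Field_lam underS_Field]) simp_all
  then have "small TYPE('u) (?g ` ?Z)" by (rule small_image)
  moreover have "eqs \<subseteq> ?g ` ?Z"
  proof
    fix e assume "e \<in> eqs"
    then obtain n where n: "cardinal_below lam n" "pts (ctxt e) = underS lam n" and e: "is_basic_qeq lam monad_sig e"
      by (auto simp: eqs_def)
    have em: "is_emet (ctxt e)" using e by (simp add: is_basic_qeq_def)
    let ?d = "\<lambda>z\<in>underS lam n \<times> underS lam n. edist (ctxt e) (fst z) (snd z)"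
    \<comment> \<open>A metric space is \<open>undefined\<close> off its points, so the context is
      recovered from the restriction \<open>?d\<close> of its distance.\<close>
    have "ctxt e = mk_emet (underS lam n) (\<lambda>x y. ?d (x, y))"
    proof -
      have "edist (ctxt e) x y = (if x \<in> underS lam n \<and> y \<in> underS lam n then ?d (x, y) else undefined)" for x y
        using em n(2) unfolding is_emet_def by auto
      then have "edist (ctxt e) = (\<lambda>x y. if x \<in> underS lam n \<and> y \<in> underS lam n then ?d (x, y) else undefined)" by blast
      then show ?thesis unfolding mk_emet_def using n(2) by simp
    qed
    then have "e = ?g (n, ?d, lhs e, rhs e, eps e)" by simp
    moreover have "(n, ?d, lhs e, rhs e, eps e) \<in> ?Z"
      using n e by (auto simp: cardinal_below_def is_basic_qeq_def free_qalg_def)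
    ultimately show "e \<in> ?g ` ?Z" by (rule image_eqI)
  qed
  ultimately show ?thesis by (rule small_subset)
qed

section \<open>Soundness and completeness of the equations\<close>

definition monad_variety :: "'u variety" where
  "monad_variety = \<lparr>sig = monad_sig, algs = {A \<in> all_qalgs lam monad_sig. \<forall>e\<in>eqs. satisfies lam monad_sig A e}\<rparr>"

lemma sig_monad_variety [simp]: "sig monad_variety = monad_sig"
  by (simp add: monad_variety_def)

lemma monad_variety: "basic_variety lam monad_variety"
proof -
  have "is_basic_qeq lam monad_sig e" if "e \<in> eqs" for e using that by (auto simp: eqs_def)
  then show ?thesis
    unfolding basic_variety_def monad_variety_def using monad_sig small_eqs by (auto intro!: exI[of _ eqs])
qed

lemma lt_emet_Obj: "is_emet N \<Longrightarrow> |pts N| <o lam \<Longrightarrow> (N :: 'u emet) \<in> Obj Met"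
  by (intro Obj_MetI lt_lam_imp_small)

text \<open>The Kleisli extension of an assignment is nonexpanding and takes values of terms in the
  space of the context to their values in \<open>F M\<close>, so the bound is inherited.\<close>

lemma TA_in_variety:
  assumes M: "M \<in> Obj Met"
  shows "TA M \<in> algs monad_variety"
proof -
  have "satisfies lam monad_sig (TA M) e" if e: "e \<in> eqs" for e
    unfolding satisfies_def
  proof (rule ballI)
    fix f assume "f \<in> nonexp (ctxt e) (qspace (TA M))"
    then have f: "f \<in> nonexp (ctxt e) (F M)" by simp
    have b: "is_basic_qeq lam monad_sig e" using e by (auto simp: eqs_def)
    then have C: "ctxt e \<in> Obj Met" by (intro lt_emet_Obj) (simp_all add: is_basic_qeq_def)
    have lr: "lhs e \<in> terms lam monad_sig (pts (ctxt e))" "rhs e \<in> terms lam monad_sig (pts (ctxt e))"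
      using b by (simp_all add: is_basic_qeq_def free_qalg_def)
    have "edist (F M) (kext (ctxt e) M f (ev (ctxt e) (lhs e))) (kext (ctxt e) M f (ev (ctxt e) (rhs e))) \<le>
        edist (F (ctxt e)) (ev (ctxt e) (lhs e)) (ev (ctxt e) (rhs e))"
      by (rule nonexp_le[OF kext_nonexp[OF C M f] ev_in[OF C lr(1)] ev_in[OF C lr(2)]])
    also have "\<dots> \<le> ennreal (real_of_rat (eps e))" using e by (auto simp: eqs_def)
    finally show "edist (qspace (TA M)) (term_ext lam monad_sig (TA M) f (lhs e)) (term_ext lam monad_sig (TA M) f (rhs e)) \<le> ennreal (real_of_rat (eps e))"
      using kext_ev[OF C M f lr(1)] kext_ev[OF C M f lr(2)] by simp
  qed
  then show ?thesis using TA_qalg[OF M] F_Obj[OF M] by (simp add: monad_variety_def all_qalgs_def)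
qed

text \<open>Completeness of \<open>eqs\<close>: two terms over \<open>M\<close> live over a subspace with fewer than \<open>lam\<close> points in which their
  distance is already attained, and this subspace is renamed to an initial segment of \<open>lam\<close>.\<close>

lemma variety_le_monad:
  assumes A: "A \<in> algs monad_variety" and M: "M \<in> Obj Met" and f: "f \<in> nonexp M (qspace A)"
    and l: "l \<in> terms lam monad_sig (pts M)" and r: "r \<in> terms lam monad_sig (pts M)"
  shows "edist (qspace A) (term_ext lam monad_sig A f l) (term_ext lam monad_sig A f r) \<le> edist (F M) (ev M l) (ev M r)"
proof -
  have qA: "is_qalg lam monad_sig A" using variety_alg(1)[OF monad_variety A] by simp
  obtain N1 N2 where N12: "N1 \<subseteq> pts M" "|N1| <o lam" "l \<in> terms lam monad_sig N1" "N2 \<subseteq> pts M" "|N2| <o lam" "r \<in> terms lam monad_sig N2"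
    using terms_support[OF monad_sig l] terms_support[OF monad_sig r] by blast
  \<comment> \<open>A common subspace on which both terms can be evaluated; it is enlarged to
    \<open>N\<close> below until their distance agrees with the one in \<open>F M\<close>.\<close>
  define N0 where "N0 = N1 \<union> N2"
  have N0: "N0 \<subseteq> pts M" "|N0| <o lam" "l \<in> terms lam monad_sig N0" "r \<in> terms lam monad_sig N0"
    using N12 by (auto simp: N0_def intro: terms_mono lt_Un)
  have e0: "ev (sub_emet M N0) l \<in> pts (F (sub_emet M N0))" "ev (sub_emet M N0) r \<in> pts (F (sub_emet M N0))"
    using N0 by (auto intro!: ev_in sub_emet_Obj M)
  obtain N where N: "N0 \<subseteq> N" "N \<subseteq> pts M" "|N| <o lam"
    "edist (F (sub_emet M N)) (ev (sub_emet M N) l) (ev (sub_emet M N) r) = edist (F M) (ev M l) (ev M r)"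
    using distance_attained[OF M N0(1,2) e0] Fm_incl_incl[OF M _ _ N0(3)] Fm_incl_incl[OF M _ _ N0(4)]
      Fm_incl_ev[OF M N0(1,3)] Fm_incl_ev[OF M N0(1,4)] by auto
  have lr: "l \<in> terms lam monad_sig N" "r \<in> terms lam monad_sig N" using N0(3,4) N(1) by (auto intro: terms_mono)
  obtain n h where n: "cardinal_below lam n" and h: "bij_betw h (underS lam n) N" using lt_code[OF N(3)] .
  note sN = sub_emet_Obj[OF M N(2)] and em = Obj_Met_emet[OF M]
  \<comment> \<open>The isometric copy of the subspace \<open>N\<close> on an initial segment of
    \<open>lam\<close>, since \<open>eqs\<close> admits only such contexts.\<close>
  define C where "C = mk_emet (underS lam n) (\<lambda>x y. edist M (h x) (h y))"
  have pC: "pts C = underS lam n" by (simp add: C_def)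
  have hM: "h x \<in> pts M" if "x \<in> underS lam n" for x using bij_betwE[OF h] N(2) that by blast
  have C: "is_emet C"
    unfolding C_def
  proof (rule is_emet_mk_emet)
    show "x = y" if "x \<in> underS lam n" "y \<in> underS lam n" "edist M (h x) (h y) = 0" for x y
      using edist_0[OF em hM hM] that h by (metis bij_betw_def inj_onD)
  qed (use hM edist_self[OF em] edist_sym[OF em] edist_tri[OF em] in auto)
  have C_lt: "|pts C| <o lam" using cardinal_below_lt[OF n] by (simp add: pC)
  note CO = lt_emet_Obj[OF C C_lt]
  let ?g = "inv_into (underS lam n) h"
  have gh: "?g x \<in> underS lam n" "h (?g x) = x" if "x \<in> N" for x
    using h that by (auto simp: bij_betw_def intro: inv_into_into f_inv_into_f)
  have g: "restrict ?g N \<in> nonexp (sub_emet M N) C"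
    using gh by (intro nonexpI) (auto simp: C_def)
  have fh: "(\<lambda>x\<in>underS lam n. f (h x)) \<in> nonexp C (qspace A)"
    using hM nonexp_in[OF f] nonexp_le[OF f] by (intro nonexpI) (auto simp: C_def)
  let ?rn = "rename lam monad_sig C ?g"
  have gC: "?g x \<in> pts C" if "x \<in> N" for x using gh(1)[OF that] by (simp add: pC)
  have rn: "?rn t \<in> terms lam monad_sig (pts C)" if "t \<in> terms lam monad_sig N" for t
    using rename_terms[OF C gC that] .
  have ev_rn: "ev C (?rn t) = Fm (sub_emet M N) C (restrict ?g N) (ev (sub_emet M N) t)" if t: "t \<in> terms lam monad_sig N" for t
  proof -
    have \<eta>C: "\<eta> C \<in> nonexp C (qspace (TA C))" using \<eta>_nonexp[OF CO] by simp
    have "ev C (?rn t) = term_ext lam monad_sig (TA C) (\<lambda>x. \<eta> C (?g x)) t"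
      unfolding ev_def by (rule term_ext_rename[OF C gC t TA_qalg[OF CO] \<eta>C])
    also have "\<dots> = term_ext lam monad_sig (TA C) (\<lambda>x. \<eta> C (restrict ?g N x)) t"
      by (rule term_ext_cong[OF _ t]) simp
    also have "\<dots> = Fm (sub_emet M N) C (restrict ?g N) (ev (sub_emet M N) t)"
      using t by (intro Fm_ev[OF sN CO g, symmetric]) simp
    finally show ?thesis .
  qed
  have A_rn: "term_ext lam monad_sig A (\<lambda>x\<in>underS lam n. f (h x)) (?rn t) = term_ext lam monad_sig A f t"
    if t: "t \<in> terms lam monad_sig N" for t
  proof -
    have "term_ext lam monad_sig A (\<lambda>x\<in>underS lam n. f (h x)) (?rn t) =
        term_ext lam monad_sig A (\<lambda>x. (\<lambda>x\<in>underS lam n. f (h x)) (?g x)) t"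
      by (rule term_ext_rename[OF C gC t qA fh])
    also have "\<dots> = term_ext lam monad_sig A f t" by (rule term_ext_cong[OF _ t]) (simp add: gh)
    finally show ?thesis .
  qed
  have ev_N: "ev (sub_emet M N) t \<in> pts (F (sub_emet M N))" if "t \<in> terms lam monad_sig N" for t
    using that by (intro ev_in sN) simp
  have le: "edist (F C) (ev C (?rn l)) (ev C (?rn r)) \<le> edist (F M) (ev M l) (ev M r)"
    using nonexp_le[OF Fm_nonexp[OF sN CO g] ev_N[OF lr(1)] ev_N[OF lr(2)]] N(4) by (simp add: ev_rn lr)
  show ?thesis
  proof (rule ennreal_le_ratI)
    \<comment> \<open>Each rational above the distance in \<open>F M\<close> contributes one
      equation of the presentation; together they bound by the distance itself.\<close>
    fix q :: rat assume q: "0 \<le> q" "edist (F M) (ev M l) (ev M r) \<le> ennreal (real_of_rat q)"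
    let ?e = "\<lparr>ctxt = C, lhs = ?rn l, rhs = ?rn r, eps = q\<rparr>"
    have "?e \<in> eqs"
      using n q le C C_lt rn lr by (auto simp: eqs_def is_basic_qeq_def pC free_qalg_def)
    then have "satisfies lam monad_sig A ?e" using A by (simp add: monad_variety_def)
    then show "edist (qspace A) (term_ext lam monad_sig A f l) (term_ext lam monad_sig A f r) \<le> ennreal (real_of_rat q)"
      using fh A_rn lr by (auto simp: satisfies_def)
  qed
qed

lemma ev_Op:
  "ev M (Op \<sigma> t) = interp (TA M) \<sigma> (\<lambda>i\<in>args lam monad_sig \<sigma>. ev M (t i))"
  unfolding ev_def term_ext.simps ..

text \<open>Generation is \<open>ev_surj\<close>. The extension of \<open>f\<close> sends the value
  of a term in \<open>F M\<close> to its value in \<open>B\<close>; by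
  \<open>variety_le_monad\<close> this depends only on the value in \<open>F M\<close> and is
  nonexpanding.\<close>

lemma TA_free:
  assumes M: "M \<in> Obj Met"
  shows "free_on lam monad_variety M (TA M) (\<eta> M)"
  unfolding free_on_def sig_monad_variety qspace_TA
proof (intro conjI allI impI ballI)
  show "TA M \<in> algs monad_variety" by (rule TA_in_variety[OF M])
  show "\<eta> M \<in> nonexp M (F M)" by (rule \<eta>_nonexp[OF M])
next
  fix P p
  assume gen: "\<forall>x\<in>pts M. P (\<eta> M x)" and op: "\<forall>\<sigma>\<in>syms monad_sig. \<forall>a\<in>args lam monad_sig \<sigma> \<rightarrow>\<^sub>E pts (F M).
      (\<forall>i\<in>args lam monad_sig \<sigma>. P (a i)) \<longrightarrow> P (interp (TA M) \<sigma> a)" and p: "p \<in> pts (F M)"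
  have "P (ev M t)" if "t \<in> terms lam monad_sig (pts M)" for t
    using that
  proof induction
    case (Var x) then show ?case using gen by (simp add: ev_def)
  next
    case (Op \<sigma> t)
    have "(\<lambda>i\<in>args lam monad_sig \<sigma>. ev M (t i)) \<in> args lam monad_sig \<sigma> \<rightarrow>\<^sub>E pts (F M)"
      using ev_in[OF M] Op.hyps(2) by auto
    then show ?case unfolding ev_Op using op Op.hyps(1) Op.IH by auto
  qed
  then show "P p" using ev_surj[OF M p] by blast
next
  fix B f assume B: "B \<in> algs monad_variety" and f: "f \<in> nonexp M (qspace B)"
  have qB: "is_qalg lam monad_sig B" and eB: "is_emet (qspace B)" using variety_alg[OF monad_variety B] by simp_all
  let ?t = "term_ext lam monad_sig B f"
  let ?rp = "\<lambda>p. SOME t. t \<in> terms lam monad_sig (pts M) \<and> ev M t = p"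
  have rp: "?rp p \<in> terms lam monad_sig (pts M)" "ev M (?rp p) = p" if "p \<in> pts (F M)" for p
    using someI_ex[of "\<lambda>t. t \<in> terms lam monad_sig (pts M) \<and> ev M t = p"] ev_surj[OF M that] by auto
  have t_in: "?t t \<in> pts (qspace B)" if "t \<in> terms lam monad_sig (pts M)" for t
    by (rule term_ext_closed[OF qB f that])
  define h where "h = (\<lambda>p\<in>pts (F M). ?t (?rp p))"
  have h_ev: "h (ev M t) = ?t t" if t: "t \<in> terms lam monad_sig (pts M)" for t
  proof -
    note e = ev_in[OF M t]
    have "edist (qspace B) (?t (?rp (ev M t))) (?t t) \<le> edist (F M) (ev M (?rp (ev M t))) (ev M t)"
      by (rule variety_le_monad[OF B M f rp(1)[OF e] t])
    also have "\<dots> = 0" using rp(2)[OF e] edist_self[OF Obj_Met_emet[OF F_Obj[OF M]] e] by simp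
    finally have "?t (?rp (ev M t)) = ?t t" using edist_0[OF eB t_in[OF rp(1)[OF e]] t_in[OF t]] by simp
    then show ?thesis using e by (simp add: h_def)
  qed
  have "h \<in> qalg_hom lam monad_sig (TA M) B"
  proof (rule qalg_homI)
    show "h \<in> nonexp (qspace (TA M)) (qspace B)"
    proof (rule nonexpI)
      fix p p' assume "p \<in> pts (qspace (TA M))" "p' \<in> pts (qspace (TA M))"
      then have p: "p \<in> pts (F M)" "p' \<in> pts (F M)" by simp_all
      show "edist (qspace B) (h p) (h p') \<le> edist (qspace (TA M)) p p'"
        using variety_le_monad[OF B M f rp(1)[OF p(1)] rp(1)[OF p(2)]] p rp(2) by (simp add: h_def)
    qed (use rp(1) t_in in \<open>auto simp: h_def\<close>)
    fix \<sigma> a assume \<sigma>: "\<sigma> \<in> syms monad_sig" and "a \<in> args lam monad_sig \<sigma> \<rightarrow>\<^sub>E pts (qspace (TA M))"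
    then have a: "a \<in> args lam monad_sig \<sigma> \<rightarrow>\<^sub>E pts (F M)" by simp
    let ?s = "\<lambda>i\<in>args lam monad_sig \<sigma>. ?rp (a i)"
    have s: "Op \<sigma> ?s \<in> terms lam monad_sig (pts M)"
      using rp(1)[OF PiE_mem[OF a]] by (intro Op_terms \<sigma>) simp
    have "(\<lambda>i\<in>args lam monad_sig \<sigma>. ev M (?s i)) = a"
      using a rp(2)[OF PiE_mem[OF a]] by (intro extensionalityI[of _ "args lam monad_sig \<sigma>"]) (auto simp: PiE_def)
    then have "h (interp (TA M) \<sigma> a) = ?t (Op \<sigma> ?s)" using h_ev[OF s] ev_Op[of M \<sigma> ?s] by simp
    also have "\<dots> = interp B \<sigma> (\<lambda>i\<in>args lam monad_sig \<sigma>. ?t (?s i))" by (rule term_ext.simps(2))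
    also have "(\<lambda>i\<in>args lam monad_sig \<sigma>. ?t (?s i)) = (\<lambda>i\<in>args lam monad_sig \<sigma>. h (a i))"
      using PiE_mem[OF a] by (intro restrict_ext) (simp add: h_def)
    finally show "h (interp (TA M) \<sigma> a) = interp B \<sigma> (\<lambda>i\<in>args lam monad_sig \<sigma>. h (a i))" .
  qed
  moreover have "\<forall>x\<in>pts M. h (\<eta> M x) = f x"
    using h_ev[OF terms.Var] by (simp add: ev_def)
  ultimately show "\<exists>h\<in>qalg_hom lam monad_sig (TA M) B. \<forall>x\<in>pts M. h (\<eta> M x) = f x" by blast
qed

section \<open>The comparison isomorphism between a monad and the monad of its variety\<close>

definition comparison :: "'u emet \<Rightarrow> 'u \<Rightarrow> 'u" where
  "comparison = (\<lambda>M\<in>Obj Met. fext monad_variety M (TA M) (\<eta> M))"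

lemma comparison:
  assumes M: "M \<in> Obj Met"
  shows comparison_hom: "comparison M \<in> qalg_hom lam monad_sig (FA monad_variety M) (TA M)"
    and comparison_nonexp: "comparison M \<in> nonexp (TV monad_variety M) (F M)"
    and comparison_unit: "x \<in> pts M \<Longrightarrow> comparison M (unit_map monad_variety M x) = \<eta> M x"
proof -
  have "\<eta> M \<in> nonexp M (qspace (TA M))" using \<eta>_nonexp[OF M] by simp
  note f = fext[OF monad_variety M TA_in_variety[OF M] this]
  show c: "comparison M \<in> qalg_hom lam monad_sig (FA monad_variety M) (TA M)"
    using f(1) M by (simp add: comparison_def)
  show "comparison M \<in> nonexp (TV monad_variety M) (F M)" using qalg_hom_nonexp[OF c] by (simp add: TV_def)
  show "x \<in> pts M \<Longrightarrow> comparison M (unit_map monad_variety M x) = \<eta> M x" using f(2) M by (simp add: comparison_def)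
qed

text \<open>Both algebras are free on \<open>M\<close>, so each extends the unit of the other, and
  the two extensions are inverse by agreement on generators.\<close>

lemma comparison_inverse:
  assumes M: "M \<in> Obj Met"
  shows "\<exists>g\<in>nonexp (F M) (TV monad_variety M).
    (\<forall>p\<in>pts (TV monad_variety M). g (comparison M p) = p) \<and> (\<forall>p\<in>pts (F M). comparison M (g p) = p)"
proof -
  let ?V = monad_variety
  note V = monad_variety
  have u: "unit_map ?V M \<in> nonexp M (qspace (FA ?V M))" using unit_map_nonexp[OF V M] by (simp add: TV_def)
  obtain g where g: "g \<in> qalg_hom lam monad_sig (TA M) (FA ?V M)" "\<And>x. x \<in> pts M \<Longrightarrow> g (\<eta> M x) = unit_map ?V M x"
    using free_onD(3)[OF TA_free[OF M] FA_alg[OF V M] u] by auto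
  have gn: "g \<in> nonexp (F M) (TV ?V M)" using qalg_hom_nonexp[OF g(1)] by (simp add: TV_def)
  have c: "comparison M \<in> qalg_hom lam (sig ?V) (FA ?V M) (TA M)" using comparison_hom[OF M] by simp
  have g': "g \<in> qalg_hom lam (sig ?V) (TA M) (FA ?V M)" using g(1) by simp
  have gc: "g (comparison M p) = p" if p: "p \<in> pts (TV ?V M)" for p
  proof -
    have "compose (pts (TV ?V M)) g (comparison M) = (\<lambda>x\<in>pts (TV ?V M). x)"
      by (rule FA_hom_eqI[OF V M FA_hom_compose[OF V M c g'] qalg_hom_ident[OF FA_qalg[OF V M], folded TV_def]])
        (simp add: compose_eq unit_map_in[OF V M] comparison_unit[OF M] g(2))
    from fun_cong[OF this, of p] show ?thesis using p by (simp add: compose_eq)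
  qed
  have cg: "comparison M (g p) = p" if p: "p \<in> pts (F M)" for p
  proof -
    have qT: "is_qalg lam (sig ?V) (TA M)" using TA_qalg[OF M] by simp
    have "compose (pts (qspace (TA M))) (comparison M) g p = (\<lambda>x\<in>pts (qspace (TA M)). x) p"
      by (rule free_on_hom_eq[OF TA_free[OF M] qalg_hom_compose[OF g' c qT] qalg_hom_ident[OF qT]])
        (use p in \<open>simp_all add: compose_eq nonexp_in[OF \<eta>_nonexp[OF M]] g(2) comparison_unit[OF M]\<close>)
    then show ?thesis using p by (simp add: compose_eq)
  qed
  show ?thesis using gn gc cg by blast
qed

text \<open>The maps \<open>Fm A B f\<close> and the multiplication of \<open>T\<close>, the latter
  as the Kleisli extension of an identity, are homomorphisms of the algebras \<open>TA\<close>.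
  Hence the diagrams can be checked on the generators of free algebras.\<close>

lemma comparison_monad_mor: "comparison \<in> monad_mor Met (var_monad monad_variety) T"
proof (rule monad_morI[OF monad])
  let ?V = monad_variety
  note V = monad_variety
  show "comparison \<in> extensional (Obj Met)" by (simp add: comparison_def)
  show "comparison A \<in> nonexp (fo (Fun (var_monad ?V)) A) (F A)" if "A \<in> Obj Met" for A
    using comparison_nonexp[OF that] that by simp
  show "comparison A (munit (var_monad ?V) A x) = \<eta> A x" if "A \<in> Obj Met" "x \<in> pts A" for A x
    using comparison_unit[OF that] that by simp
  have c: "comparison M \<in> qalg_hom lam (sig ?V) (FA ?V M) (TA M)" if "M \<in> Obj Met" for M using comparison_hom[OF that] by simp
  show "comparison B (fm (Fun (var_monad ?V)) A B f p) = Fm A B f (comparison A p)"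
    if A: "A \<in> Obj Met" and B: "B \<in> Obj Met" and f: "f \<in> nonexp A B" and p: "p \<in> pts (fo (Fun (var_monad ?V)) A)" for A B f p
  proof -
    have Ff: "Fm A B f \<in> qalg_hom lam (sig ?V) (TA A) (TA B)" using Fm_hom[OF A B f] by simp
    have "compose (pts (TV ?V A)) (comparison B) (fmap ?V A B f) = compose (pts (TV ?V A)) (Fm A B f) (comparison A)"
      by (rule FA_hom_eqI[OF V A FA_hom_compose[OF V A fmap_hom[OF V A B f] c[OF B]] FA_hom_compose[OF V A c[OF A] Ff]])
        (simp add: compose_eq unit_map_in[OF V A] fmap_unit[OF V A B f] comparison_unit[OF A] comparison_unit[OF B]
          nonexp_in[OF f] monad_unit_nat[OF monad A B f])
    from compose_apply_eq[OF this] show ?thesis using A B f p by simp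
  qed
  fix A p assume A: "A \<in> Obj (Met :: ('u emet, 'u \<Rightarrow> 'u) mcat)" and "p \<in> pts (fo (Fun (var_monad ?V)) (fo (Fun (var_monad ?V)) A))"
  note VA = TV_Obj[OF V A] and FA' = F_Obj[OF A] and cA = comparison_nonexp[OF A]
  have p: "p \<in> pts (TV ?V (TV ?V A))" using \<open>p \<in> _\<close> A VA by simp
  have m: "kext (F A) A (\<lambda>x\<in>pts (F A). x) \<in> qalg_hom lam (sig ?V) (TA (F A)) (TA A)"
    using kext_hom[OF FA' A nonexp_ident] by simp
  have Fc: "Fm (TV ?V A) (F A) (comparison A) \<in> qalg_hom lam (sig ?V) (TA (TV ?V A)) (TA (F A))"
    using Fm_hom[OF VA FA' cA] by simp
  have "compose (pts (TV ?V (TV ?V A))) (comparison A) (mult_map ?V A) =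
      compose (pts (TV ?V (TV ?V A))) (kext (F A) A (\<lambda>x\<in>pts (F A). x))
        (compose (pts (TV ?V (TV ?V A))) (Fm (TV ?V A) (F A) (comparison A)) (comparison (TV ?V A)))"
    by (rule FA_hom_eqI[OF V VA FA_hom_compose[OF V VA mult_map_hom[OF V A] c[OF A]]
         FA_hom_compose[OF V VA FA_hom_compose[OF V VA c[OF VA] Fc] m]])
      (simp add: compose_eq unit_map_in[OF V VA] mult_map_unit[OF V A] comparison_unit[OF VA]
        monad_unit_nat[OF monad VA FA' cA] kext_unit[OF FA' A nonexp_ident] nonexp_in[OF cA])
  from fun_cong[OF this, of p]
  have "comparison A (mult_map ?V A p) = kext (F A) A (\<lambda>x\<in>pts (F A). x) (Fm (TV ?V A) (F A) (comparison A) (comparison (TV ?V A) p))"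
    using p by (simp add: compose_eq)
  also have "\<dots> = mmult T A (Fm (TV ?V A) (F A) (comparison A) (comparison (TV ?V A) p))"
    by (rule mult_kext[OF A nonexp_in[OF Fm_nonexp[OF VA FA' cA] nonexp_in[OF comparison_nonexp[OF VA] p]], symmetric])
  finally show "comparison A (mmult (var_monad ?V) A p) = mmult T A
      (Fm (fo (Fun (var_monad ?V)) A) (F A) (comparison A) (comparison (fo (Fun (var_monad ?V)) A) p))"
    using A by simp
qed

lemma comparison_iso: "is_iso (basic_monads_cat lam) (var_monad monad_variety) T comparison"
proof -
  let ?V = monad_variety
  have "\<forall>M\<in>Obj Met. \<exists>g. g \<in> nonexp (F M) (TV ?V M) \<and> (\<forall>p\<in>pts (TV ?V M). g (comparison M p) = p) \<and> (\<forall>p\<in>pts (F M). comparison M (g p) = p)"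
    using comparison_inverse by blast
  from bchoice[OF this] obtain g where g: "\<And>M. M \<in> Obj Met \<Longrightarrow> g M \<in> nonexp (F M) (TV ?V M)"
    "\<And>M p. M \<in> Obj Met \<Longrightarrow> p \<in> pts (TV ?V M) \<Longrightarrow> g M (comparison M p) = p"
    "\<And>M p. M \<in> Obj Met \<Longrightarrow> p \<in> pts (F M) \<Longrightarrow> comparison M (g M p) = p" by blast
  let ?g = "\<lambda>M\<in>Obj Met. g M"
  have gm: "?g \<in> monad_mor Met T (var_monad ?V)"
    by (rule monad_mor_inverse[OF is_monad_var_monad[OF monad_variety] monad comparison_monad_mor]) (simp_all add: g)
  have "(\<lambda>A\<in>Obj Met. compose (pts (fo (Fun (var_monad ?V)) A)) (?g A) (comparison A)) = (\<lambda>A\<in>Obj Met. \<lambda>x\<in>pts (fo (Fun (var_monad ?V)) A). x)"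
    by (intro restrict_ext) (simp add: compose_def g cong: restrict_cong)
  moreover have "(\<lambda>A\<in>Obj Met. compose (pts (F A)) (comparison A) (?g A)) = (\<lambda>A\<in>Obj Met. \<lambda>x\<in>pts (F A). x)"
    by (intro restrict_ext) (simp add: compose_def g cong: restrict_cong)
  ultimately show ?thesis
    unfolding is_iso_def basic_monads_cat_simps using comparison_monad_mor gm by blast
qed

end

theorem theorem8p17:
  fixes lam :: "'u rel"
  assumes "uncountable_regular_cardinal lam" and "universe_for lam"
  shows "dually_equivalent (basic_varieties_cat lam) (basic_monads_cat lam)"
proof -
  interpret cardinal_universe lam by unfold_locales (rule assms)+
  show ?thesis
    unfolding dually_equivalent_def
  proof (rule fully_faithful_essentially_surjective_equivalence[OF is_category_op_cat[OF is_category_basic_varieties]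
        is_category_basic_monads is_functor_monad_functor monad_functor_bij])
    fix T :: "('u emet, 'u \<Rightarrow> 'u) monad" assume "T \<in> Obj (basic_monads_cat lam)"
    \<comment> \<open>Essential surjectivity: \<open>T\<close> is isomorphic, by the comparison, to
      the monad of its own variety.\<close>
    then interpret basic_monad_on lam T by unfold_locales simp
    have "fo monad_functor monad_variety = var_monad monad_variety"
      using monad_variety by (simp add: monad_functor_def)
    then show "\<exists>V\<in>Obj (op_cat (basic_varieties_cat lam)). \<exists>f. is_iso (basic_monads_cat lam) (fo monad_functor V) T f"
      using comparison_iso monad_variety by (intro bexI[of _ monad_variety]) auto
  qed
qed

end
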